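(* Let $n\ge1$ and let $\lambda$ be a partition with $l(\lambda)\le 2n$, regarded as having $2n$ parts (zeros allowed). Then $$\frac1Z\int_T P_\lambda(x_1^{\pm1},\dots,x_n^{\pm1};t)\,\tilde\Delta_K^{(n)}(x;1,\sqrt t,0,0;t)\,dT=\frac{\phi_{2n}(\sqrt t)}{(1-\sqrt t)^{2n}\,v_\lambda(\sqrt t)}=\frac{C^0_\lambda(t^n;0,\sqrt t)}{C^-_\lambda(\sqrt t;0,\sqrt t)},$$ where $Z=\int_T\tilde\Delta_K^{(n)}(x;1,\sqrt t,0,0;t)\,dT$.
   Context: Let $t\in\mathbb{C}$ with $0<|t|<1$ and fix a square root $\sqrt t$. $T=\{(x_1,\dots,x_n):|x_1|=\dots=|x_n|=1\}$, $dT=\prod_j\frac{dx_j}{2\pi\sqrt{-1}\,x_j}$. $\phi_r(t)=(1-t)(1-t^2)\cdots(1-t^r)$. For a partition $\lambda$ with $N$ parts (zeros included), $m_i(\lambda)$ is the number of parts equal to $i$ (so $m_0$ counts zero parts) and $v_\lambda(t)=\prod_{i\ge0}\prod_{j=1}^{m_i(\lambda)}\frac{1-t^j}{1-t}$; $\phi_{2n}(\sqrt t)$ and $v_\lambda(\sqrt t)$ are obtained by replacing $t$ by $\sqrt t$ (with $\lambda$ having $2n$ parts). The Hall--Littlewood polynomial in $N$ variables is $P_\lambda(z_1,\dots,z_N;t)=\frac{1}{v_\lambda(t)}\sum_{w\in S_N}w\Big(z^\lambda\prod_{1\le i<j\le N}\frac{z_i-tz_j}{z_i-z_j}\Big)$,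 with $w$ permuting the subscripts of the variables; here it is evaluated at the $2n$ arguments $x_1,x_1^{-1},\dots,x_n,x_n^{-1}$. The symmetric Koornwinder density is $$\tilde\Delta_K^{(n)}(x;a,b,c,d;t)=\frac{1}{2^nn!}\prod_{1\le i\le n}\frac{1-x_i^{\pm2}}{(1-ax_i^{\pm1})(1-bx_i^{\pm1})(1-cx_i^{\pm1})(1-dx_i^{\pm1})}\prod_{1\le i<j\le n}\frac{1-x_i^{\pm1}x_j^{\pm1}}{1-tx_i^{\pm1}x_j^{\pm1}},$$ where an expression with $\pm$ signs denotes the product over all choices of signs, e.g. $1-x_i^{\pm2}$ means $(1-x_i^2)(1-x_i^{-2})$ and $1-x_i^{\pm1}x_j^{\pm1}$ is a product of four factors. Common factors (when a parameter equals $1$) are cancelled. The $C$-symbols at $q=0$, with second parameter $s$ (here $s=\sqrt t$) and $l(\lambda)$ the number of nonzero parts, are $C^0_\lambda(x;0,s)=\prod_{1\le i\le l(\lambda)}(1-s^{1-i}x)$ and $C^-_\lambda(s;0,s)=(1-s)^{l(\lambda)}\prod_{i\ge1}\prod_{j=1}^{m_i(\lambda)}\frac{1-s^j}{1-s}$. *)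

theory Defs
  imports "HOL-Analysis.Analysis" "HOL-Combinatorics.Permutations"
begin

text \<open>
  A partition is a weakly decreasing, finitely supported sequence of parts. Indices start at 0,
  so the usual \<open>\<lambda>\<^sub>i\<close>, \<open>x\<^sub>i\<close>, \<open>z\<^sub>i\<close> are \<open>lam (i - 1)\<close>, \<open>x (i - 1)\<close>, \<open>z (i - 1)\<close>.
\<close>

definition is_partition :: "(nat \<Rightarrow> nat) \<Rightarrow> bool" where
  "is_partition lam \<longleftrightarrow> antimono lam \<and> finite {k. lam k \<noteq> 0}"

definition part_length :: "(nat \<Rightarrow> nat) \<Rightarrow> nat" where
  "part_length lam = card {k. lam k \<noteq> 0}"

text \<open>The multiplicity of \<open>i\<close> when \<open>lam\<close> is regarded as having \<open>N\<close> parts, zeros included.\<close>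

definition part_mult :: "nat \<Rightarrow> (nat \<Rightarrow> nat) \<Rightarrow> nat \<Rightarrow> nat" where
  "part_mult N lam i = card {k. k < N \<and> lam k = i}"

definition phi :: "nat \<Rightarrow> complex \<Rightarrow> complex" where
  "phi r t = (\<Prod>j=1..r. 1 - t ^ j)"

text \<open>
  Products over all part sizes are cut off at the largest part \<open>lam 0\<close>, as larger sizes
  have multiplicity 0.
\<close>

definition v_factor :: "nat \<Rightarrow> (nat \<Rightarrow> nat) \<Rightarrow> complex \<Rightarrow> complex" where
  "v_factor N lam t = (\<Prod>i=0..lam 0. \<Prod>j=1..part_mult N lam i. (1 - t ^ j) / (1 - t))"

text \<open>
  The defining symmetrization of the Hall--Littlewood polynomial in \<open>N\<close> variables. Where two of
  the arguments coincide, this expression need not be the value of the polynomial, since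
  \<open>u / 0 = 0\<close>. On the torus, the arguments \<open>pm_args x\<close> below are pairwise distinct outside a
  null set, so integrals of the polynomial are unaffected.
\<close>

definition hall_littlewood ::
  "nat \<Rightarrow> (nat \<Rightarrow> nat) \<Rightarrow> (nat \<Rightarrow> complex) \<Rightarrow> complex \<Rightarrow> complex" where
  "hall_littlewood N lam z t = 1 / v_factor N lam t *
     (\<Sum>w | w permutes {..<N}.
        (\<Prod>i<N. z (w i) ^ lam i) *
        (\<Prod>j<N. \<Prod>i<j. (z (w i) - t * z (w j)) / (z (w i) - z (w j))))"

text \<open>The argument list \<open>x\<^sub>1, x\<^sub>1\<^sup>-\<^sup>1, x\<^sub>2, x\<^sub>2\<^sup>-\<^sup>1, \<dots>\<close>\<close>

definition pm_args :: "(nat \<Rightarrow> complex) \<Rightarrow> nat \<Rightarrow> complex" where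
  "pm_args x k = (if even k then x (k div 2) else inverse (x (k div 2)))"

text \<open>
  The exponents \<open>e, e' \<in> {1, -1}\<close> run through the sign choices. If a parameter equals 1, the
  cancellation of the common factor \<open>1 - x\<^sub>i\<^sup>\<plusminus>\<^sup>1\<close> changes the value only where some \<open>x\<^sub>i = 1\<close>,
  which is a null set of the torus.
\<close>

definition koornwinder_density ::
  "nat \<Rightarrow> (nat \<Rightarrow> complex) \<Rightarrow> complex \<Rightarrow> complex \<Rightarrow> complex \<Rightarrow> complex \<Rightarrow> complex \<Rightarrow> complex" where
  "koornwinder_density n x a b c d t =
     1 / (2 ^ n * fact n) *
     (\<Prod>i<n. \<Prod>e\<in>{1, -1}.
        (1 - x i powi (2 * e)) /
        ((1 - a * x i powi e) * (1 - b * x i powi e) * (1 - c * x i powi e) * (1 - d * x i powi e))) *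
     (\<Prod>j<n. \<Prod>i<j. \<Prod>e\<in>{1, -1}. \<Prod>e'\<in>{1, -1}.
        (1 - x i powi e * x j powi e') / (1 - t * x i powi e * x j powi e'))"

text \<open>
  The measure \<open>dx / (2 \<pi> \<i> x)\<close> on the unit circle: with \<open>x = exp (2 \<pi> \<i> \<theta>)\<close> it is \<open>d\<theta>\<close> on
  \<open>[0, 1]\<close>. The torus measure \<open>dT\<close> is its \<open>n\<close>-fold product.
\<close>

definition circle_measure :: "complex measure" where
  "circle_measure = distr (restrict_space lborel {0..1}) borel (\<lambda>\<theta>. cis (2 * pi * \<theta>))"

definition torus_measure :: "nat \<Rightarrow> (nat \<Rightarrow> complex) measure" where
  "torus_measure n = (\<Pi>\<^sub>M i\<in>{..<n}. circle_measure)"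

text \<open>The symbols \<open>C\<^sup>0\<^sub>\<lambda>(x; 0, s)\<close> and \<open>C\<^sup>-\<^sub>\<lambda>(s; 0, s)\<close>, i.e. the \<open>C\<close>-symbols at \<open>q = 0\<close>.\<close>

definition C_zero :: "(nat \<Rightarrow> nat) \<Rightarrow> complex \<Rightarrow> complex \<Rightarrow> complex" where
  "C_zero lam x s = (\<Prod>i=1..part_length lam. 1 - s powi (1 - int i) * x)"

definition C_minus :: "(nat \<Rightarrow> nat) \<Rightarrow> complex \<Rightarrow> complex" where
  "C_minus lam s = (1 - s) ^ part_length lam *
     (\<Prod>i=1..lam 0. \<Prod>j=1..card {k. lam k = i}. (1 - s ^ j) / (1 - s))"

end

theory Submission
  imports
    Defs
    "HOL-Complex_Analysis.Cauchy_Integral_Formula"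
    "HOL-Probability.Infinite_Product_Measure"
    "HOL-Computational_Algebra.Polynomial"
begin

text \<open>
  Expand the Hall--Littlewood polynomial as a sum over the ways of placing the \<open>2 * n\<close> letters
  \<open>x i\<close> and \<open>1 / x i\<close> on the positions \<open>0, \<dots>, 2 * n - 1\<close>. In one such placement, a variable with
  letter \<open>y\<close> at position \<open>a\<close> and letter \<open>1 / y\<close> at a later position \<open>b\<close> forms an arc from \<open>a\<close> to
  \<open>b\<close>. Multiplied by the density, almost everything cancels: the arc itself contributes
  \<open>y ^ (lam a - lam b) * kernel y\<close>, every letter \<open>z\<close> of an arc that starts later contributes
  \<open>cross_factor (y * z)\<close> if it lies between \<open>a\<close> and \<open>b\<close>, and nothing else remains
  (\<open>word_sum_density\<close>).

  Now integrate out the variable that occupies the first free position. The function \<open>kernel\<close> has a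
  simple pole at 1, on the contour; it cancels when the contributions of \<open>y\<close> and \<open>1 / y\<close> are added,
  and the principal value is a combination of the value of the other factors at 0 and at 1
  (\<open>circle_integral_kernel\<close>). At \<open>y = 0\<close> a nonzero contribution needs equal parts at \<open>a\<close> and \<open>b\<close>,
  every cross factor becomes \<open>t\<close>, and the arc disappears. At \<open>y = 1\<close> the arc leaves the factor
  \<open>cross_factor z\<close> on every letter \<open>z\<close> between its ends. As \<open>cross_factor (1 / z)\<close> is the inverse of
  \<open>cross_factor z\<close>, these factors depend, within each later arc, only on how many ends of evaluated
  arcs lie between its own ends. So the integrand keeps its form once the positions \<open>a\<close> and \<open>b\<close> are
  remembered as marked, and iterating gives a sum over all pairings of the positions, each arc being
  of one of the two types (\<open>integral_pairing_sum\<close>).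

  This sum is evaluated by choosing first the set of marked positions. The arcs between marked
  positions carry the sign of their crossings, and these signs sum to 1, as in the Pfaffian of the
  all-ones matrix (\<open>mark_sign_expand\<close>). The other arcs join equal parts, and equal parts occupy
  consecutive positions, so what remains is a product over the parts \<open>i\<close> of a function of the
  multiplicity of \<open>i\<close>. That function satisfies a two-term recursion, solved up to a power of a constant
  by \<open>\<Prod>j=1..m. 1 + s ^ j\<close> (\<open>partial_pairings_eq_prod_blocks\<close>).

  For the zero partition the polynomial is 1 and the same evaluation gives \<open>Z\<close>. In the quotient, the
  factors \<open>1 + s ^ j = (1 - t ^ j) / (1 - s ^ j)\<close> turn \<open>v_factor\<close> at \<open>t\<close> into \<open>v_factor\<close> at \<open>s\<close>.

  The iterated integration needs every sum over \<open>y\<close> and \<open>1 / y\<close> to be bounded on the torus, even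
  though its two summands have a pole there. This is what the class \<open>tame\<close> is for: it contains the
  factors without poles and is closed under the divided difference with respect to \<open>y \<mapsto> 1 / y\<close>.
\<close>

section \<open>Weighted partial pairings of the positions\<close>

lemma sum_rank:
  fixes g :: "nat \<Rightarrow> 'a::comm_monoid_add" and B :: "'b::linorder set"
  assumes "finite B"
  shows "(\<Sum>b\<in>B. g (card {p\<in>B. p < b})) = (\<Sum>k<card B. g k)"
  using assms
proof (induction B rule: finite_linorder_max_induct)
  case empty
  then show ?case by simp
next
  case (insert b A)
  have "(\<Sum>x\<in>A. g (card {p \<in> insert b A. p < x})) = (\<Sum>x\<in>A. g (card {p \<in> A. p < x}))"
    by (intro sum.cong refl arg_cong[of _ _ g] arg_cong[of _ _ card]) (use insert in force)
  moreover have "{p \<in> insert b A. p < b} = A"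
    using insert by auto
  moreover have "b \<notin> A"
    using insert by auto
  ultimately have "(\<Sum>x\<in>insert b A. g (card {p \<in> insert b A. p < x}))
      = g (card A) + (\<Sum>x\<in>A. g (card {p \<in> A. p < x}))"
    using insert by (simp del: insert_iff)
  with \<open>b \<notin> A\<close> insert show ?case
    by (simp add: add.commute del: insert_iff)
qed

lemma sum_alternating: "(\<Sum>k<n. (-1) ^ k) = (if odd n then 1 else (0::complex))"
  by (induction n) (auto simp: sum.lessThan_Suc)

lemma Min_mem: "finite F \<Longrightarrow> b \<in> F \<Longrightarrow> Min F \<in> F"
  by (metis Min_in empty_iff)

lemma sum_Pow_remove:
  fixes g :: "'a set \<Rightarrow> 'b::comm_monoid_add"
  assumes "finite F" "a \<in> F"
  shows "(\<Sum>S\<in>Pow F. g S) = (\<Sum>S\<in>Pow (F - {a}). g S) + (\<Sum>S\<in>Pow (F - {a}). g (insert a S))"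
proof -
  have "Pow F = Pow (F - {a}) \<union> insert a ` Pow (F - {a})"
    using Pow_insert[of a "F - {a}"] assms by (simp add: insert_absorb)
  moreover have "inj_on (insert a) (Pow (F - {a}))"
    by (auto simp: inj_on_def)
  ultimately show ?thesis
    using assms by (simp, subst sum.union_disjoint) (auto simp: sum.reindex)
qed

text \<open>
  In \<open>sum_Pow_swap\<close> and \<open>sum_Pow_swap_in\<close>, a subset \<open>S\<close> with a distinguished element outside or
  inside of \<open>S\<close> is described by the element and the remaining subset.
\<close>

lemma sum_Pow_swap:
  fixes g :: "'a set \<Rightarrow> 'a \<Rightarrow> 'b::comm_monoid_add"
  assumes "finite F"
  shows "(\<Sum>S\<in>Pow F. \<Sum>b\<in>F - S. g S b) = (\<Sum>b\<in>F. \<Sum>S\<in>Pow (F - {b}). g S b)"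
proof -
  have "(\<Sum>S\<in>Pow F. \<Sum>b\<in>F - S. g S b) = (\<Sum>S\<in>Pow F. \<Sum>b\<in>F. if b \<in> S then 0 else g S b)"
    using assms by (intro sum.cong[OF refl]) (simp add: sum.If_cases set_diff_eq Int_def)
  also have "\<dots> = (\<Sum>b\<in>F. \<Sum>S\<in>Pow F. if b \<in> S then 0 else g S b)"
    by (rule sum.swap)
  also have "\<dots> = (\<Sum>b\<in>F. \<Sum>S\<in>Pow (F - {b}). g S b)"
  proof (rule sum.cong[OF refl])
    fix b assume "b \<in> F"
    have "Pow F \<inter> {x. b \<notin> x} = Pow (F - {b})" by auto
    then show "(\<Sum>S\<in>Pow F. if b \<in> S then 0 else g S b) = (\<Sum>S\<in>Pow (F - {b}). g S b)"
      using assms by (simp add: sum.If_cases Collect_neg_eq[symmetric])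
  qed
  finally show ?thesis .
qed

lemma sum_Pow_swap_in:
  fixes g :: "'a set \<Rightarrow> 'a \<Rightarrow> 'b::comm_monoid_add"
  assumes "finite F"
  shows "(\<Sum>S\<in>Pow F. \<Sum>b\<in>S. g S b) = (\<Sum>b\<in>F. \<Sum>S\<in>Pow (F - {b}). g (insert b S) b)"
proof -
  have "(\<Sum>S\<in>Pow F. \<Sum>b\<in>S. g S b) = (\<Sum>S\<in>Pow F. \<Sum>b\<in>F. if b \<in> S then g S b else 0)"
  proof (rule sum.cong[OF refl])
    fix S assume "S \<in> Pow F"
    then have "F \<inter> S = S" by auto
    then show "(\<Sum>b\<in>S. g S b) = (\<Sum>b\<in>F. if b \<in> S then g S b else 0)"
      using assms by (simp add: sum.If_cases)
  qed
  also have "\<dots> = (\<Sum>b\<in>F. \<Sum>S\<in>Pow F. if b \<in> S then g S b else 0)"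
    by (rule sum.swap)
  also have "\<dots> = (\<Sum>b\<in>F. \<Sum>S\<in>Pow (F - {b}). g (insert b S) b)"
  proof (rule sum.cong[OF refl])
    fix b assume "b \<in> F"
    moreover have "(\<Sum>S\<in>Pow (F - {b}). if b \<in> S then g S b else 0) = 0"
      by (rule sum.neutral) auto
    ultimately show "(\<Sum>S\<in>Pow F. if b \<in> S then g S b else 0)
        = (\<Sum>S\<in>Pow (F - {b}). g (insert b S) b)"
      using assms by (subst sum_Pow_remove[of F b]) auto
  qed
  finally show ?thesis .
qed

locale hl_params =
  fixes s t :: complex
  assumes s_sq: "s ^ 2 = t" and s_nonzero: "s \<noteq> 0" and norm_s: "norm s < 1"
begin

text \<open>
  Half the residue of \<open>kernel y / y\<close> at 1, which enters the principal values below. The residue at 0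
  is \<open>- s\<close>.
\<close>

definition c_one :: complex where "c_one = (1 + s) / (1 - s)"

text \<open>
  A marked arc has the weight \<open>c_one\<close>; a square root distributes it evenly over the two ends, so that
  the weight of a set of marked positions is a power that makes sense for each position separately.
  The choice of the root cancels in the end.
\<close>

definition gam :: complex where "gam = csqrt c_one"

lemma gam_sq: "gam ^ 2 = c_one"
  by (simp add: gam_def)

lemma norm_t: "norm t < 1"
  using norm_s by (simp flip: s_sq add: norm_power power_less_one_iff)

lemma one_plus_s: "1 + s \<noteq> 0"
  using norm_s by (metis add_eq_0_iff norm_minus_cancel norm_one less_irrefl)

lemma one_minus_s: "1 - s \<noteq> 0"
  using norm_s by auto

lemma one_minus_t: "1 - t \<noteq> 0"
  using norm_t by auto

text \<open>
  The total weight of all partial pairings of \<open>m\<close> consecutive positions with equal parts.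
\<close>

definition block_weight :: "nat \<Rightarrow> complex" where
  "block_weight m = (gam / (1 + s)) ^ m * (\<Prod>j=1..m. 1 + s ^ j)"

lemma block_weight_0: "block_weight 0 = 1"
  by (simp add: block_weight_def)

lemma block_weight_1: "block_weight (Suc 0) = gam * block_weight 0"
  using one_plus_s by (simp add: block_weight_def)

text \<open>
  The recursion that arises from deciding what happens to the first position: it is marked, or it is
  joined to a position with \<open>k\<close> free positions in between.
\<close>

lemma block_weight_rec:
  "block_weight (Suc (Suc m)) =
     gam * block_weight (Suc m) - s * (\<Sum>k<Suc m. t ^ k) * block_weight m"
proof -
  define d where "d = gam / (1 + s)"
  define h where "h = (\<Prod>j=1..m. 1 + s ^ j)"
  have gam: "gam = d * (1 + s)"
    using one_plus_s by (simp add: d_def)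
  have bw: "block_weight k = d ^ k * (\<Prod>j=1..k. 1 + s ^ j)" for k
    by (simp add: block_weight_def d_def)
  have "d ^ 2 * (1 - t) = c_one * (1 - t) / (1 + s) ^ 2"
    by (simp add: d_def power_divide gam_sq)
  also have "\<dots> = 1"
    using one_plus_s one_minus_s
    by (simp add: c_one_def divide_simps) (simp flip: s_sq add: power2_eq_square algebra_simps)
  finally have d: "d ^ 2 * (1 - t) = 1" .
  \<comment> \<open>The normalization \<open>d\<close> is chosen such that the geometric sum has no denominator.\<close>
  have geo: "(\<Sum>k<Suc m. t ^ k) = d ^ 2 * (1 - t ^ Suc m)"
  proof -
    have "(\<Sum>k<Suc m. t ^ k) = d ^ 2 * ((1 - t) * (\<Sum>k<Suc m. t ^ k))"
      using d by (simp only: mult.assoc[symmetric]) simp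
    then show ?thesis
      by (simp only: one_diff_power_eq)
  qed
  have t: "t ^ Suc m = s ^ Suc m * s ^ Suc m"
    by (simp flip: s_sq power_mult power_add add: mult_2)
  have "block_weight (Suc (Suc m)) = d ^ m * d ^ 2 * h * (1 + s ^ Suc m) * (1 + s ^ Suc (Suc m))"
    by (simp add: bw h_def power2_eq_square)
  also have "\<dots> = d * (1 + s) * (d ^ m * d * h * (1 + s ^ Suc m))
      - s * (d ^ 2 * (1 - s ^ Suc m * s ^ Suc m)) * (d ^ m * h)"
    by (simp add: algebra_simps power2_eq_square)
  also have "\<dots> = gam * block_weight (Suc m) - s * (\<Sum>k<Suc m. t ^ k) * block_weight m"
    unfolding geo t
    by (simp add: bw gam h_def mult.assoc)
  finally show ?thesis .
qed

end

locale hl_word = hl_params +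
  fixes lam :: "nat \<Rightarrow> nat"
  assumes antimono_lam: "antimono lam"
begin

definition between :: "nat \<Rightarrow> nat \<Rightarrow> nat set \<Rightarrow> nat set" where
  "between a b X = {p\<in>X. a < p \<and> p < b}"

text \<open>
  The weight of an arc whose variable is evaluated at 0; \<open>X\<close> is the set of all positions that are
  still present when this happens.
\<close>

definition zero_weight :: "nat \<Rightarrow> nat \<Rightarrow> nat set \<Rightarrow> complex" where
  "zero_weight a b X = (if lam a = lam b then - s * t ^ card (between a b X) else 0)"

text \<open>
  The weighted sum over the perfect pairings of \<open>Y\<close> by arcs of the type \<open>zero_weight\<close>, in the
  presence of further positions \<open>X\<close>. Arcs are removed in the order of their left ends, so that the
  exponent of \<open>t\<close> of an arc counts only arcs which start later. It vanishes if \<open>Y\<close> has odd size,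
  because a single remaining position has no partner.
\<close>

function pairings :: "nat set \<Rightarrow> nat set \<Rightarrow> complex" where
  "pairings Y X = (if card Y = 0 then 1 else
     (\<Sum>b\<in>Y - {Min Y}. zero_weight (Min Y) b (X \<union> Y) * pairings (Y - {Min Y, b}) X))"
  by auto
termination
proof (relation "Wellfounded.measure (\<lambda>(Y, X). card Y)")
  fix Y X :: "nat set" and b
  assume "card Y \<noteq> 0" and b: "b \<in> Y - {Min Y}"
  then have "finite Y" by (auto intro: card_ge_0_finite)
  then show "((Y - {Min Y, b}, X), Y, X) \<in> Wellfounded.measure (\<lambda>(Y, X). card Y)"
    using b by (auto intro!: psubset_card_mono)
qed simp

declare pairings.simps [simp del]

lemma pairings_empty: "pairings {} X = 1"
  by (simp add: pairings.simps)

lemma pairings_rec: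
  assumes "finite Y" "a \<in> Y" "\<And>p. p \<in> Y \<Longrightarrow> a \<le> p"
  shows "pairings Y X = (\<Sum>b\<in>Y - {a}. zero_weight a b (X \<union> Y) * pairings (Y - {a, b}) X)"
proof -
  have "Min Y = a"
    using assms by (intro Min_eqI) auto
  with assms show ?thesis
    by (subst pairings.simps) auto
qed

lemma pairings_odd: "finite Y \<Longrightarrow> odd (card Y) \<Longrightarrow> pairings Y X = 0"
proof (induction "card Y" arbitrary: Y rule: less_induct)
  case less
  then have ne: "Y \<noteq> {}" by auto
  define a where "a = Min Y"
  have a: "a \<in> Y" "\<And>p. p \<in> Y \<Longrightarrow> a \<le> p"
    using less ne by (auto simp: a_def)
  have "pairings (Y - {a, b}) X = 0" if "b \<in> Y - {a}" for b
  proof -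
    have c: "card (Y - {a, b}) = card Y - 2"
      using that a less.prems by (subst card_Diff_subset) auto
    have "card Y \<ge> 2"
      using card_mono[of Y "{a, b}"] that a less.prems by auto
    then show ?thesis
      using less.prems by (intro less.hyps) (auto simp: c)
  qed
  then show ?case
    by (subst pairings_rec[OF less.prems(1) a]) auto
qed

text \<open>
  Positions in front of all of \<open>Y\<close> lie between the ends of no arc.
\<close>

lemma pairings_cong_below:
  assumes "finite Y" "\<And>y x. y \<in> Y \<Longrightarrow> y < x \<Longrightarrow> x \<in> X \<longleftrightarrow> x \<in> X'"
  shows "pairings Y X = pairings Y X'"
  using assms
proof (induction "card Y" arbitrary: Y rule: less_induct)
  case less
  show ?case
  proof (cases "Y = {}")
    case False
    define a where "a = Min Y"
    have a: "a \<in> Y" "\<And>p. p \<in> Y \<Longrightarrow> a \<le> p"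
      using less False by (auto simp: a_def)
    have "between a b (X \<union> Y) = between a b (X' \<union> Y)" for b
      using less.prems(2)[OF a(1)] by (auto simp: between_def)
    then have "zero_weight a b (X \<union> Y) = zero_weight a b (X' \<union> Y)" for b
      by (simp add: zero_weight_def)
    moreover have "pairings (Y - {a, b}) X = pairings (Y - {a, b}) X'" for b
      using a less.prems by (intro less.hyps psubset_card_mono) auto
    ultimately show ?thesis
      by (simp add: pairings_rec[OF less.prems(1) a])
  qed (simp add: pairings_empty)
qed

text \<open>
  For \<open>S\<close> of even size, the sum over the pairings of \<open>S\<close> of the product of the signs \<open>(- 1) ^ k\<close>
  over all arcs, where \<open>k\<close> counts the positions between the ends of an arc that were marked before:
  those in \<open>X\<close> and the ends of earlier arcs. That this sum is a single sign is the content of \<open>mark_sign_expand\<close>.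
\<close>

definition mark_sign :: "nat set \<Rightarrow> nat set \<Rightarrow> complex" where
  "mark_sign X S = (\<Prod>x\<in>X. (-1) ^ card {p\<in>S. p < x})"

text \<open>
  Up to the factor \<open>2 ^ m * fact m\<close>, the value of the integral over the \<open>m\<close> variables on the free
  positions \<open>F\<close> when the positions \<open>X\<close> have been marked already: \<open>S\<close> is the set of free positions
  that will be marked.
\<close>

definition partial_pairings :: "nat set \<Rightarrow> nat set \<Rightarrow> complex" where
  "partial_pairings F X =
     (\<Sum>S\<in>Pow F. gam ^ card S * mark_sign X S * pairings (F - S) (X \<union> S))"

text \<open>
  Expansion along the arc that contains the first position \<open>a\<close>. Marking \<open>b\<close> contributes the rank of
  \<open>b\<close> in \<open>S - {a}\<close> to the exponent of the sign, while the positions of \<open>X\<close> between \<open>a\<close> and \<open>b\<close>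
  change their sign and are compensated by the explicit factor. So the left-hand side is the
  right-hand side times \<open>1 - 1 + \<dots> + 1\<close>, with an odd number of terms.
\<close>

lemma mark_sign_expand:
  assumes "finite S" "finite X" "X \<inter> S = {}" "even (card S)" "a \<in> S" "\<And>p. p \<in> S \<Longrightarrow> a \<le> p"
  shows "(\<Sum>b\<in>S - {a}. (-1) ^ card (between a b X) * mark_sign (X \<union> {a, b}) (S - {a, b}))
       = mark_sign X S"
proof -
  have term_eq: "(-1) ^ card (between a b X) * mark_sign (X \<union> {a, b}) (S - {a, b})
      = mark_sign X S * (-1) ^ card {p \<in> S - {a}. p < b}" if b: "b \<in> S - {a}" for b
  proof -
    have ab: "a < b" using assms(6)[of b] b by auto
    have "mark_sign (X \<union> {a, b}) (S - {a, b})
      = mark_sign X (S - {a, b}) * (-1) ^ card {p \<in> S - {a, b}. p < a}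
          * (-1) ^ card {p \<in> S - {a, b}. p < b}"
      using assms b ab unfolding mark_sign_def
      by (subst prod.union_disjoint) auto
    also have "{p \<in> S - {a, b}. p < a} = {}"
      using assms(6) by force
    also have "{p \<in> S - {a, b}. p < b} = {p \<in> S - {a}. p < b}"
      by auto
    also have "mark_sign X (S - {a, b}) = (-1) ^ card (between a b X) * mark_sign X S"
    proof -
      have "(-1) ^ card {p \<in> S - {a, b}. p < x} =
          (if a < x \<and> x < b then -1 else 1) * ((-1) ^ card {p \<in> S. p < x} :: complex)"
        if x: "x \<in> X" for x
      proof -
        have xn: "x \<noteq> a" "x \<noteq> b" using x assms b by auto
        consider "x < a" | "a < x" "x < b" | "b < x"
          using xn by linarith
        then show ?thesis
        proof cases
          case 1
          then have "{p \<in> S - {a, b}. p < x} = {p \<in> S. p < x}"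
            using ab by auto
          then show ?thesis using 1 by simp
        next
          case 2
          then have "{p \<in> S. p < x} = insert a {p \<in> S - {a, b}. p < x}"
            using assms by auto
          then show ?thesis using 2 assms(1) by simp
        next
          case 3
          then have "{p \<in> S. p < x} = insert a (insert b {p \<in> S - {a, b}. p < x})"
            using assms b ab by auto
          then show ?thesis using 3 ab assms(1) by simp
        qed
      qed
      then have "mark_sign X (S - {a, b}) =
          (\<Prod>x\<in>X. if a < x \<and> x < b then -1 else 1) * mark_sign X S"
        by (simp add: mark_sign_def prod.distrib)
      also have "(\<Prod>x\<in>X. if a < x \<and> x < b then -1 else 1 :: complex) = (-1) ^ card (between a b X)"
        using assms by (simp add: between_def prod.If_cases Int_def)
      finally show ?thesis .
    qed
    finally have "mark_sign (X \<union> {a, b}) (S - {a, b}) = (-1) ^ card (between a b X) *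
        (mark_sign X S * (-1) ^ card {p \<in> S - {a}. p < b})"
      by simp
    then show ?thesis
      by (simp add: mult.assoc[symmetric] flip: power_mult_distrib)
  qed
  have "odd (card (S - {a}))"
    using assms by (metis card_Suc_Diff1 even_Suc)
  then have rank: "(\<Sum>b\<in>S - {a}. (-1) ^ card {p \<in> S - {a}. p < b}) = (1 :: complex)"
    using assms sum_rank[of "S - {a}" "\<lambda>k. (-1) ^ k :: complex"]
    by (simp add: sum_alternating)
  have "(\<Sum>b\<in>S - {a}. (-1) ^ card (between a b X) * mark_sign (X \<union> {a, b}) (S - {a, b}))
      = mark_sign X S * (\<Sum>b\<in>S - {a}. (-1) ^ card {p \<in> S - {a}. p < b})"
    unfolding sum_distrib_left by (rule sum.cong[OF refl term_eq])
  then show ?thesis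
    unfolding rank by simp
qed

text \<open>
  The recursion of the iterated integral: the first free position \<open>a\<close> is joined to \<open>b\<close>, and the
  variable is evaluated at 0 or at 1. Its two parts correspond to the sets \<open>S\<close> that avoid or contain
  \<open>a\<close>.
\<close>

lemma partial_pairings_rec:
  assumes "finite F" "finite X" "F \<inter> X = {}" "even (card F)" "a \<in> F" "\<And>p. p \<in> F \<Longrightarrow> a \<le> p"
  shows "partial_pairings F X = (\<Sum>b\<in>F - {a}.
      zero_weight a b (F \<union> X) * partial_pairings (F - {a, b}) X
    + c_one * (-1) ^ card (between a b X) * partial_pairings (F - {a, b}) (X \<union> {a, b}))"
proof -
  define E where "E = F - {a}"
  define w where "w X S = gam ^ card S * mark_sign X S * pairings (F - S) (X \<union> S)" for X S
  have E: "finite E" using assms by (simp add: E_def)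
  have E_minus: "E - {b} = F - {a, b}" for b
    by (auto simp: E_def)
  have part1: "(\<Sum>S\<in>Pow E. w X S)
      = (\<Sum>b\<in>E. zero_weight a b (F \<union> X) * partial_pairings (F - {a, b}) X)"
  proof -
    have "(\<Sum>S\<in>Pow E. w X S) = (\<Sum>S\<in>Pow E. \<Sum>b\<in>E - S. gam ^ card S * mark_sign X S *
        (zero_weight a b (F \<union> X) * pairings (F - {a, b} - S) (X \<union> S)))"
    proof (rule sum.cong[OF refl])
      fix S assume S: "S \<in> Pow E"
      have "pairings (F - S) (X \<union> S) = (\<Sum>b\<in>F - S - {a}.
          zero_weight a b (X \<union> S \<union> (F - S)) * pairings (F - S - {a, b}) (X \<union> S))"
        using assms S by (intro pairings_rec) (auto simp: E_def)
      also have "\<dots> = (\<Sum>b\<in>E - S. zero_weight a b (F \<union> X) * pairings (F - {a, b} - S) (X \<union> S))"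
      proof (intro sum.cong)
        show "F - S - {a} = E - S" by (auto simp: E_def)
        fix b
        have "X \<union> S \<union> (F - S) = F \<union> X" using S by (auto simp: E_def)
        moreover have "F - S - {a, b} = F - {a, b} - S" by auto
        ultimately show "zero_weight a b (X \<union> S \<union> (F - S)) * pairings (F - S - {a, b}) (X \<union> S)
            = zero_weight a b (F \<union> X) * pairings (F - {a, b} - S) (X \<union> S)" by simp
      qed
      finally show "w X S = (\<Sum>b\<in>E - S. gam ^ card S * mark_sign X S *
        (zero_weight a b (F \<union> X) * pairings (F - {a, b} - S) (X \<union> S)))"
        by (simp add: w_def sum_distrib_left)
    qed
    also have "\<dots> = (\<Sum>b\<in>E. \<Sum>S\<in>Pow (E - {b}). gam ^ card S * mark_sign X S *
        (zero_weight a b (F \<union> X) * pairings (F - {a, b} - S) (X \<union> S)))"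
      using E by (rule sum_Pow_swap)
    also have "\<dots> = (\<Sum>b\<in>E. zero_weight a b (F \<union> X) * partial_pairings (F - {a, b}) X)"
      unfolding partial_pairings_def sum_distrib_left E_minus
      by (intro sum.cong refl) (simp add: mult_ac)
    finally show ?thesis .
  qed
  have part2: "(\<Sum>S\<in>Pow E. w X (insert a S)) = (\<Sum>b\<in>E.
      c_one * (-1) ^ card (between a b X) * partial_pairings (F - {a, b}) (X \<union> {a, b}))"
  proof -
    have "(\<Sum>S\<in>Pow E. w X (insert a S)) = (\<Sum>S\<in>Pow E. \<Sum>b\<in>S. gam ^ card (insert a S) *
        ((-1) ^ card (between a b X) * mark_sign (X \<union> {a, b}) (S - {b})) *
        pairings (F - insert a S) (X \<union> insert a S))"
    proof (rule sum.cong[OF refl])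
      fix S assume S: "S \<in> Pow E"
      then have fS: "finite S" "a \<notin> S" using E by (auto intro: finite_subset simp: E_def)
      show "w X (insert a S) = (\<Sum>b\<in>S. gam ^ card (insert a S) *
        ((-1) ^ card (between a b X) * mark_sign (X \<union> {a, b}) (S - {b})) *
        pairings (F - insert a S) (X \<union> insert a S))"
      proof (cases "even (card (insert a S))")
        case True
        have "mark_sign X (insert a S) = (\<Sum>b\<in>insert a S - {a}. (-1) ^ card (between a b X) *
            mark_sign (X \<union> {a, b}) (insert a S - {a, b}))"
          using S fS assms True by (intro mark_sign_expand[symmetric]) (auto simp: E_def)
        also have "\<dots> = (\<Sum>b\<in>S. (-1) ^ card (between a b X) * mark_sign (X \<union> {a, b}) (S - {b}))"
          using fS by (intro sum.cong) (auto intro!: arg_cong[of _ _ "mark_sign _"])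
        finally show ?thesis
          by (simp add: w_def sum_distrib_left sum_distrib_right mult_ac)
      next
        case False
        \<comment> \<open>An odd number of marks leaves an odd number of positions, which have no pairing.\<close>
        have "card (F - insert a S) = card F - card (insert a S)"
          using fS S assms by (intro card_Diff_subset) (auto simp: E_def)
        moreover have "card (insert a S) \<le> card F"
          using S assms by (intro card_mono) (auto simp: E_def)
        ultimately have "odd (card (F - insert a S))"
          using False assms by simp
        then have "pairings (F - insert a S) (X \<union> insert a S) = 0"
          using assms by (intro pairings_odd) auto
        then show ?thesis by (simp add: w_def)
      qed
    qed
    also have "\<dots> = (\<Sum>b\<in>E. \<Sum>S\<in>Pow (E - {b}). gam ^ card (insert a (insert b S)) *
        ((-1) ^ card (between a b X) * mark_sign (X \<union> {a, b}) (insert b S - {b})) *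
        pairings (F - insert a (insert b S)) (X \<union> insert a (insert b S)))"
      using E by (rule sum_Pow_swap_in)
    also have "\<dots> = (\<Sum>b\<in>E. \<Sum>S\<in>Pow (F - {a, b}). c_one * (-1) ^ card (between a b X) *
        (gam ^ card S * mark_sign (X \<union> {a, b}) S * pairings (F - {a, b} - S) (X \<union> {a, b} \<union> S)))"
    proof (intro sum.cong)
      fix b S assume b: "b \<in> E" and S: "S \<in> Pow (F - {a, b})"
      then have "finite S" "b \<notin> S" "a \<notin> S" "a \<noteq> b"
        using assms by (auto intro: finite_subset simp: E_def)
      then have 1: "gam ^ card (insert a (insert b S)) = gam ^ card S * c_one"
        by (simp add: gam_sq[symmetric] power2_eq_square)
      have 2: "insert b S - {b} = S" using \<open>b \<notin> S\<close> by auto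
      have 3: "F - insert a (insert b S) = F - {a, b} - S" by auto
      have 4: "X \<union> insert a (insert b S) = X \<union> {a, b} \<union> S" by auto
      show "gam ^ card (insert a (insert b S)) *
        ((-1) ^ card (between a b X) * mark_sign (X \<union> {a, b}) (insert b S - {b})) *
        pairings (F - insert a (insert b S)) (X \<union> insert a (insert b S)) =
        c_one * (-1) ^ card (between a b X) *
        (gam ^ card S * mark_sign (X \<union> {a, b}) S * pairings (F - {a, b} - S) (X \<union> {a, b} \<union> S))"
        unfolding 1 2 3 4 by (simp only: mult_ac)
    next
      show "Pow (E - {b}) = Pow (F - {a, b})" for b
        by (simp only: E_minus)
    qed (rule refl)
    finally show ?thesis
      by (simp add: partial_pairings_def sum_distrib_left)
  qed
  have "partial_pairings F X = (\<Sum>S\<in>Pow E. w X S) + (\<Sum>S\<in>Pow E. w X (insert a S))"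
    unfolding partial_pairings_def w_def E_def
    by (rule sum_Pow_remove) (use assms in auto)
  then show ?thesis
    unfolding part1 part2 by (simp add: sum.distrib E_def)
qed

lemma partial_pairings_empty: "partial_pairings {} X = 1"
  by (simp add: partial_pairings_def mark_sign_def pairings_empty)

text \<open>
  Without marks from before there are no signs, and the first position can be treated on its own: if
  it is marked, it influences nothing else, since no arc passes over it.
\<close>

lemma partial_pairings_unmarked_rec:
  assumes "finite F" "a \<in> F" "\<And>p. p \<in> F \<Longrightarrow> a \<le> p"
  shows "partial_pairings F {} = gam * partial_pairings (F - {a}) {} +
     (\<Sum>b\<in>F - {a}. zero_weight a b F * partial_pairings (F - {a, b}) {})"
proof -
  define E where "E = F - {a}"
  define w where "w S = gam ^ card S * pairings (F - S) S" for S
  have E: "finite E" using assms by (simp add: E_def)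
  have E_minus: "E - {b} = F - {a, b}" for b
    by (auto simp: E_def)
  have "(\<Sum>S\<in>Pow E. w S) = (\<Sum>S\<in>Pow E. \<Sum>b\<in>E - S. gam ^ card S *
        (zero_weight a b F * pairings (F - {a, b} - S) S))"
  proof (rule sum.cong[OF refl])
    fix S assume S: "S \<in> Pow E"
    have "pairings (F - S) S = (\<Sum>b\<in>F - S - {a}.
        zero_weight a b (S \<union> (F - S)) * pairings (F - S - {a, b}) S)"
      using assms S by (intro pairings_rec) (auto simp: E_def)
    also have "\<dots> = (\<Sum>b\<in>E - S. zero_weight a b F * pairings (F - {a, b} - S) S)"
    proof (intro sum.cong)
      show "F - S - {a} = E - S" by (auto simp: E_def)
      fix b
      have "S \<union> (F - S) = F" using S by (auto simp: E_def)
      moreover have "F - S - {a, b} = F - {a, b} - S" by auto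
      ultimately show "zero_weight a b (S \<union> (F - S)) * pairings (F - S - {a, b}) S
          = zero_weight a b F * pairings (F - {a, b} - S) S" by simp
    qed
    finally show "w S = (\<Sum>b\<in>E - S. gam ^ card S * (zero_weight a b F * pairings (F - {a, b} - S) S))"
      by (simp add: w_def sum_distrib_left)
  qed
  also have "\<dots> = (\<Sum>b\<in>E. \<Sum>S\<in>Pow (E - {b}). gam ^ card S *
        (zero_weight a b F * pairings (F - {a, b} - S) S))"
    using E by (rule sum_Pow_swap)
  also have "\<dots> = (\<Sum>b\<in>E. zero_weight a b F * partial_pairings (F - {a, b}) {})"
    unfolding partial_pairings_def sum_distrib_left E_minus
    by (intro sum.cong refl) (simp add: mark_sign_def mult_ac)
  finally have part1: "(\<Sum>S\<in>Pow E. w S) = \<dots>" .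
  have part2: "(\<Sum>S\<in>Pow E. w (insert a S)) = gam * partial_pairings E {}"
    unfolding partial_pairings_def sum_distrib_left
  proof (rule sum.cong[OF refl])
    fix S assume S: "S \<in> Pow E"
    then have "finite S" "a \<notin> S" using E by (auto intro: finite_subset simp: E_def)
    moreover have "F - insert a S = E - S" by (auto simp: E_def)
    moreover have "pairings (E - S) (insert a S) = pairings (E - S) S"
      using assms E by (intro pairings_cong_below) (force simp: E_def)+
    ultimately show "w (insert a S) =
        gam * (gam ^ card S * mark_sign {} S * pairings (E - S) ({} \<union> S))"
      by (simp add: w_def mark_sign_def)
  qed
  have "partial_pairings F {} = (\<Sum>S\<in>Pow F. w S)"
    by (simp add: partial_pairings_def w_def mark_sign_def)
  also have "\<dots> = (\<Sum>S\<in>Pow E. w S) + (\<Sum>S\<in>Pow E. w (insert a S))"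
    unfolding E_def by (rule sum_Pow_remove) (use assms in auto)
  finally show ?thesis
    unfolding part1 part2 by (simp add: E_def)
qed

text \<open>
  The partner of the first position \<open>a\<close> lies in the block of \<open>a\<close>, and as \<open>lam\<close> is decreasing
  everything in between lies in that block as well. So the recursion only concerns the first block,
  where it is the one of \<open>block_weight\<close>.
\<close>

lemma partial_pairings_eq_prod_blocks:
  assumes "finite F" "\<And>p. p \<in> F \<Longrightarrow> lam p \<le> L"
  shows "partial_pairings F {} = (\<Prod>i\<le>L. block_weight (card {p\<in>F. lam p = i}))"
  using assms
proof (induction "card F" arbitrary: F rule: less_induct)
  case less
  show ?case
  proof (cases "F = {}")
    case True
    then show ?thesis by (simp add: partial_pairings_empty block_weight_0)
  next
    case False
    define a where "a = Min F"
    have a: "a \<in> F" "\<And>p. p \<in> F \<Longrightarrow> a \<le> p"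
      using less False by (auto simp: a_def)
    define k where "k = lam a"
    define B where "B = {p\<in>F. lam p = k} - {a}"
    define rest where "rest = (\<Prod>i\<in>{..L} - {k}. block_weight (card {p\<in>F. lam p = i}))"
    have k: "k \<le> L" using less a by (auto simp: k_def)
    have B: "finite B" using less by (auto simp: B_def)
    have blocks: "partial_pairings (F - D) {} = rest * block_weight (card ({p\<in>F. lam p = k} - D))"
      if D: "D \<subseteq> {p\<in>F. lam p = k}" "a \<in> D" for D
    proof -
      have "partial_pairings (F - D) {} = (\<Prod>i\<le>L. block_weight (card {p\<in>F - D. lam p = i}))"
        using less.prems a D by (intro less.hyps) (auto intro!: psubset_card_mono)
      also have "\<dots> = block_weight (card {p\<in>F - D. lam p = k}) *
          (\<Prod>i\<in>{..L} - {k}. block_weight (card {p\<in>F - D. lam p = i}))"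
        using k by (subst prod.remove[of _ k]) auto
      also have "(\<Prod>i\<in>{..L} - {k}. block_weight (card {p\<in>F - D. lam p = i})) = rest"
        unfolding rest_def using D
        by (intro prod.cong refl arg_cong[of _ _ block_weight] arg_cong[of _ _ card]) auto
      also have "{p\<in>F - D. lam p = k} = {p\<in>F. lam p = k} - D" by auto
      finally show ?thesis by simp
    qed
    have "(\<Sum>b\<in>F - {a}. zero_weight a b F * partial_pairings (F - {a, b}) {})
        = (\<Sum>b\<in>B. zero_weight a b F * partial_pairings (F - {a, b}) {})"
      using less.prems
      by (intro sum.mono_neutral_right) (auto simp: B_def zero_weight_def k_def)
    also have "\<dots> = (\<Sum>b\<in>B. - s * t ^ card {p\<in>B. p < b} * (rest * block_weight (card B - 1)))"
    proof (intro sum.cong refl)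
      fix b assume b: "b \<in> B"
      have "{p\<in>F. lam p = k} - {a, b} = B - {b}" by (auto simp: B_def)
      then have "card ({p\<in>F. lam p = k} - {a, b}) = card B - 1"
        using b by simp
      moreover have "between a b F = {p\<in>B. p < b}"
      proof (intro set_eqI iffI)
        fix p assume p: "p \<in> between a b F"
        then have "lam p \<le> lam a" "lam b \<le> lam p"
          using antimono_lam by (auto simp: between_def antimono_def)
        then show "p \<in> {p\<in>B. p < b}"
          using p b by (auto simp: B_def k_def between_def)
      next
        fix p assume "p \<in> {p\<in>B. p < b}"
        then show "p \<in> between a b F"
          using a by (auto simp: B_def between_def le_neq_implies_less)
      qed
      ultimately show "zero_weight a b F * partial_pairings (F - {a, b}) {} =
          - s * t ^ card {p\<in>B. p < b} * (rest * block_weight (card B - 1))"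
        using b a blocks[of "{a, b}"] by (simp add: B_def zero_weight_def k_def)
    qed
    also have "\<dots> = - s * (\<Sum>j<card B. t ^ j) * (rest * block_weight (card B - 1))"
      unfolding sum_rank[OF B, of "\<lambda>j. t ^ j", symmetric] sum_distrib_left sum_distrib_right
      by simp
    finally have "partial_pairings F {} = gam * (rest * block_weight (card B))
        - s * (\<Sum>j<card B. t ^ j) * (rest * block_weight (card B - 1))"
      using partial_pairings_unmarked_rec[OF less.prems(1) a] blocks[of "{a}"] a
      by (simp add: B_def k_def)
    also have "\<dots> = rest * (gam * block_weight (card B)
        - s * (\<Sum>j<card B. t ^ j) * block_weight (card B - 1))"
      by (simp add: algebra_simps)
    also have "gam * block_weight (card B)
        - s * (\<Sum>j<card B. t ^ j) * block_weight (card B - 1) = block_weight (Suc (card B))"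
      using block_weight_rec[of "card B - 1"] block_weight_1 by (cases "card B") simp_all
    also have "Suc (card B) = card {p\<in>F. lam p = k}"
      unfolding B_def using less.prems a by (intro card_Suc_Diff1) (auto simp: k_def)
    also have "rest * block_weight (card {p\<in>F. lam p = k})
        = (\<Prod>i\<le>L. block_weight (card {p\<in>F. lam p = i}))"
      using k by (simp add: rest_def prod.remove[of "{..L}" k] mult.commute)
    finally show ?thesis .
  qed
qed

end

section \<open>Integrals over the unit circle\<close>

lemma space_circle_measure [simp]: "space circle_measure = UNIV"
  by (simp add: circle_measure_def)

lemma sets_circle_measure [simp]: "sets circle_measure = sets borel"
  by (simp add: circle_measure_def)

lemma measurable_circle_measure [simp]:
  "measurable circle_measure N = measurable borel N"
  "measurable N circle_measure = measurable N borel"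
  by (rule measurable_cong_sets; simp)+

lemma cis_turn_measurable [measurable]:
  "(\<lambda>\<theta>. cis (2 * pi * \<theta>)) \<in> restrict_space lborel {0..1} \<rightarrow>\<^sub>M borel"
  unfolding measurable_lborel1
  by (intro measurable_restrict_space1) (simp, intro borel_measurable_continuous_onI continuous_intros)

lemma prob_space_circle_measure: "prob_space circle_measure"
proof -
  have "emeasure (restrict_space lborel {0..1::real}) (space (restrict_space lborel {0..1})) = 1"
    by (simp add: emeasure_restrict_space)
  then have "prob_space (restrict_space lborel {0..1::real})"
    by (rule prob_spaceI)
  then show ?thesis
    unfolding circle_measure_def by (rule prob_space.prob_space_distr) measurable
qed

interpretation circle: prob_space circle_measure
  by (rule prob_space_circle_measure)

lemma AE_circle_norm: "AE y in circle_measure. norm y = 1"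
  unfolding circle_measure_def by (subst AE_distr_iff) auto

text \<open>
  A point of the circle has at most one preimage in \<open>{0..<1}\<close>.
\<close>

lemma AE_circle_neq: "AE y in circle_measure. y \<noteq> z"
proof -
  have "AE \<theta> in lborel. \<theta> \<in> {0..1} \<longrightarrow> cis (2 * pi * \<theta>) \<noteq> z"
  proof -
    define A where "A = {\<theta> \<in> {0..<1}. cis (2 * pi * \<theta>) = z}"
    have "\<theta> = \<theta>'" if "\<theta> \<in> A" "\<theta>' \<in> A" for \<theta> \<theta>'
    proof -
      have "cis (2 * pi * \<theta>) = cis (2 * pi * \<theta>')"
        using that by (simp add: A_def)
      then obtain k :: int where "2 * pi * \<theta> = 2 * pi * \<theta>' + 2 * pi * k"
        using sin_cos_eq_iff[of "2 * pi * \<theta>" "2 * pi * \<theta>'"] by (auto simp: complex_eq_iff)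
      then have "2 * pi * \<theta> = 2 * pi * (\<theta>' + k)"
        by (simp add: algebra_simps)
      then have "\<theta> = \<theta>' + k"
        by simp
      then show ?thesis
        using that by (auto simp: A_def)
    qed
    then have "finite A"
      by (metis finite.simps is_singletonI' is_singleton_def)
    then have "AE \<theta> in lborel. \<theta> \<notin> insert 1 A"
      by (intro AE_not_in finite_imp_null_set_lborel) auto
    then show ?thesis
      by (rule AE_mp) (auto simp: A_def less_le)
  qed
  then show ?thesis
    unfolding circle_measure_def
    by (subst AE_distr_iff) (auto simp: AE_restrict_space_iff)
qed

lemma circle_integral_eq:
  fixes f :: "complex \<Rightarrow> complex"
  assumes "f \<in> borel_measurable borel"
  shows "(\<integral>y. f y \<partial>circle_measure)
    = (\<integral>\<theta>. indicator {0..1} \<theta> *\<^sub>R f (cis (2 * pi * \<theta>)) \<partial>lborel)"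
  using assms unfolding circle_measure_def
  by (simp add: integral_distr integral_restrict_space)

lemma circle_integral_inverse:
  fixes f :: "complex \<Rightarrow> complex"
  assumes [measurable]: "f \<in> borel_measurable borel"
  shows "(\<integral>y. f (inverse y) \<partial>circle_measure) = (\<integral>y. f y \<partial>circle_measure)"
proof -
  have "(\<integral>y. f y \<partial>circle_measure)
      = (\<integral>\<theta>. indicator {0..1} (1 + - 1 * \<theta>) *\<^sub>R f (cis (2 * pi * (1 + - 1 * \<theta>))) \<partial>lborel)"
    by (subst circle_integral_eq, simp, subst lborel_integral_real_affine[of "-1" _ 1]) simp_all
  also have "\<dots> = (\<integral>\<theta>. indicator {0..1} \<theta> *\<^sub>R f (inverse (cis (2 * pi * \<theta>))) \<partial>lborel)"
  proof (intro Bochner_Integration.integral_cong refl)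
    fix \<theta> :: real
    have "cis (2 * pi * (1 + - 1 * \<theta>)) = inverse (cis (2 * pi * \<theta>))"
    proof -
      have "2 * pi * (1 + - 1 * \<theta>) = 2 * pi + - (2 * pi * \<theta>)"
        by (simp add: algebra_simps)
      then show ?thesis
        by (simp only: cis_mult[symmetric] cis_2pi cis_inverse) simp
    qed
    then show "indicator {0..1} (1 + - 1 * \<theta>) *\<^sub>R f (cis (2 * pi * (1 + - 1 * \<theta>)))
        = indicator {0..1} \<theta> *\<^sub>R f (inverse (cis (2 * pi * \<theta>)))"
      by (auto simp: indicator_def)
  qed
  also have "\<dots> = (\<integral>y. f (inverse y) \<partial>circle_measure)"
    by (subst circle_integral_eq) simp_all
  finally show ?thesis by simp
qed

text \<open>
  The function \<open>f\<close> is a measurable substitute for \<open>h\<close>, which is arbitrary away from the disc.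
\<close>

lemma circle_mean_value:
  assumes h: "h holomorphic_on ball 0 \<rho>" "1 < \<rho>"
    and f: "f \<in> borel_measurable borel" "\<And>y. norm y = 1 \<Longrightarrow> f y = h y"
  shows "(\<integral>y. f y \<partial>circle_measure) = h 0"
proof -
  have "h holomorphic_on cball 0 1"
    using h by (auto intro: holomorphic_on_subset)
  from Cauchy_integral_circlepath_simple[OF this, of 0]
  have "((\<lambda>u. h u / u) has_contour_integral (2 * of_real pi * \<i> * h 0)) (circlepath 0 1)"
    by simp
  then have "((\<lambda>\<theta>. h (cis (2 * pi * \<theta>)) * (2 * pi * \<i>)) has_integral (2 * of_real pi * \<i> * h 0)) {0..1}"
    unfolding has_contour_integral_def
  proof (rule has_integral_eq[rotated])
    fix \<theta> :: real assume \<theta>: "\<theta> \<in> {0..1}"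
    have "circlepath 0 1 \<theta> = cis (2 * pi * \<theta>)"
      by (simp add: circlepath cis_conv_exp mult_ac)
    moreover have "vector_derivative (circlepath 0 1) (at \<theta> within {0..1}) =
        2 * pi * \<i> * cis (2 * pi * \<theta>)"
      using \<theta> by (simp add: vector_derivative_circlepath01 cis_conv_exp mult_ac)
    ultimately show "h (circlepath 0 1 \<theta>) / circlepath 0 1 \<theta> *
        vector_derivative (circlepath 0 1) (at \<theta> within {0..1}) =
        h (cis (2 * pi * \<theta>)) * (2 * pi * \<i>)"
      by simp
  qed
  then have "((\<lambda>\<theta>. h (cis (2 * pi * \<theta>)) * (2 * pi * \<i>) * inverse (2 * pi * \<i>))
      has_integral (2 * of_real pi * \<i> * h 0 * inverse (2 * pi * \<i>))) {0..1}"
    by (rule has_integral_mult_left)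
  then have hk: "((\<lambda>\<theta>. h (cis (2 * pi * \<theta>))) has_integral h 0) {0..1}"
    by (simp add: mult.assoc) (simp add: field_simps)
  have "continuous_on {0..1} (\<lambda>\<theta>. h (cis (2 * pi * \<theta>)))"
    using h by (intro continuous_on_compose2[OF holomorphic_on_imp_continuous_on[OF h(1)]] continuous_intros) auto
  then have "(LINT \<theta> : {0..1} | lborel. h (cis (2 * pi * \<theta>))) = h 0"
    using set_borel_integral_eq_integral(2)[OF borel_integrable_atLeastAtMost'] integral_unique[OF hk]
    by metis
  then show ?thesis
    unfolding circle_integral_eq[OF f(1)] set_lebesgue_integral_def
    using f(2) by simp
qed

text \<open>
  The form in which the mean value property is used: a function which the symmetrization under
  \<open>y \<mapsto> 1 / y\<close> makes regular at 1.
\<close>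

lemma circle_integral_reflected_sum:
  assumes h: "h holomorphic_on ball 0 \<rho>" "1 < \<rho>"
    and f: "f \<in> borel_measurable borel"
      "\<And>y. norm y = 1 \<Longrightarrow> y \<noteq> 1 \<Longrightarrow> f y = h y + h (inverse y)"
  shows "(\<integral>y. f y \<partial>circle_measure) = 2 * h 0"
proof -
  have cont: "continuous_on (sphere 0 1) h"
    using h by (intro holomorphic_on_imp_continuous_on) (auto intro: holomorphic_on_subset)
  define g where "g = (\<lambda>y. indicator (sphere 0 1) y *\<^sub>R h y)"
  have g[measurable]: "g \<in> borel_measurable borel"
    unfolding g_def using cont by (intro borel_measurable_continuous_on_indicator) auto
  have g_eq: "g y = h y" if "norm y = 1" for y
    using that by (simp add: g_def)
  obtain B where "\<forall>y\<in>sphere 0 1. norm (h y) \<le> B"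
    using compact_imp_bounded[OF compact_continuous_image[OF cont compact_sphere]]
    by (auto simp: bounded_iff)
  then have B: "norm (h y) \<le> B" if "norm y = 1" for y
    using that by simp
  have int: "integrable circle_measure g" "integrable circle_measure (\<lambda>y. g (inverse y))"
  proof -
    have "AE y in circle_measure. norm (g y) \<le> B"
      using AE_circle_norm by eventually_elim (simp add: g_eq B)
    then show "integrable circle_measure g"
      by (rule circle.integrable_const_bound) simp
    have "AE y in circle_measure. norm (g (inverse y)) \<le> B"
      using AE_circle_norm by eventually_elim (simp add: g_eq B norm_inverse)
    then show "integrable circle_measure (\<lambda>y. g (inverse y))"
      by (rule circle.integrable_const_bound) simp
  qed
  have "(\<integral>y. f y \<partial>circle_measure) = (\<integral>y. g y + g (inverse y) \<partial>circle_measure)"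
  proof (rule integral_cong_AE)
    show "AE y in circle_measure. f y = g y + g (inverse y)"
      using AE_circle_norm AE_circle_neq[of 1]
      by eventually_elim (simp add: f(2) g_eq norm_inverse)
  qed (use f in auto)
  also have "\<dots> = 2 * (\<integral>y. g y \<partial>circle_measure)"
    using int by (simp add: circle_integral_inverse)
  also have "(\<integral>y. g y \<partial>circle_measure) = h 0"
    using h g g_eq by (rule circle_mean_value)
  finally show ?thesis .
qed

context hl_params
begin

text \<open>
  What remains of the density and of the Hall--Littlewood factors for a letter \<open>z\<close> between the ends
  of the arc of \<open>y\<close>, as a function of \<open>y * z\<close>. This is a Blaschke factor, with
  \<open>cross_factor (1 / z) = 1 / cross_factor z\<close>.
\<close>

definition cross_factor :: "complex \<Rightarrow> complex" where
  "cross_factor z = (t - z) / (1 - t * z)"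

text \<open>
  What remains of the density and of the Hall--Littlewood factors for a single arc. The parameters 1
  and \<open>s\<close> of the density are responsible for the pole at 1 and for the cancellation of the factor
  \<open>y - s\<close> of \<open>y\<^sup>2 - t\<close>.
\<close>

definition kernel :: "complex \<Rightarrow> complex" where
  "kernel y = (1 + y) * (y + s) / ((y - 1) * (1 - s * y))"

lemma one_minus_s_mult: "norm y \<le> 1 \<Longrightarrow> 1 - s * y \<noteq> 0"
  using norm_s mult_mono[of "norm s" "norm s" "norm y" 1]
  by (metis eq_iff_diff_eq_0 mult.right_neutral norm_ge_zero norm_mult norm_one not_less order.refl)

lemma one_minus_t_mult: "norm y \<le> 1 \<Longrightarrow> 1 - t * y \<noteq> 0"
  using norm_t mult_mono[of "norm t" "norm t" "norm y" 1]
  by (metis eq_iff_diff_eq_0 mult.right_neutral norm_ge_zero norm_mult norm_one not_less order.refl)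

text \<open>
  The poles at 1 cancel. The partial fraction form exhibits the result as the sum of a holomorphic
  function on the disc and its reflection.
\<close>

lemma kernel_reflected_sum:
  assumes "norm y = 1" "y \<noteq> 1"
  shows "kernel y + kernel (inverse y) = (1 + s\<^sup>2) / s *
    (c_one * (1 / (1 - s * y) + 1 / (1 - s * inverse y)) - c_one - 1)"
proof -
  have y: "y \<noteq> 0" using assms by auto
  have d1: "1 - s * y \<noteq> 0" using assms by (intro one_minus_s_mult) auto
  have "1 - s * inverse y \<noteq> 0" using assms by (intro one_minus_s_mult) (auto simp: norm_inverse)
  then have d2: "y - s \<noteq> 0" using y by (auto simp: field_simps)
  have d3: "y - 1 \<noteq> 0" "1 - y \<noteq> 0" using assms by auto
  have k2: "kernel (inverse y) = (y + 1) * (1 + s * y) / ((1 - y) * (y - s))"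
    using y d2 d3 by (simp add: kernel_def divide_simps)
  have "kernel y + kernel (inverse y) = (1 + s\<^sup>2) * (1 + y)\<^sup>2 / ((1 - s * y) * (y - s))"
    unfolding k2 kernel_def using d1 d2 d3 y
    by (simp add: divide_simps) (simp add: algebra_simps power2_eq_square)
  moreover have "1 / (1 - s * inverse y) = y / (y - s)"
    using y d2 by (simp add: divide_simps)
  moreover have "c_one * (1 / (1 - s * y) + y / (y - s)) - c_one - 1
      = s * (1 + y)\<^sup>2 / ((1 - s * y) * (y - s))"
  proof -
    have frac: "p / d * (1 / a + y / b) - p / d - 1 = (p * (b + y * a) - (p + d) * (a * b)) / (d * (a * b))"
      if "a \<noteq> 0" "b \<noteq> 0" "d \<noteq> 0" for a b d p :: complex
      using that by (simp add: field_simps)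
    have "(1 + s) * ((y - s) + y * (1 - s * y)) - ((1 + s) + (1 - s)) * ((1 - s * y) * (y - s))
        = (1 - s) * (s * (1 + y)\<^sup>2)"
      by (simp add: algebra_simps power2_eq_square)
    then show ?thesis
      unfolding c_one_def frac[OF d1 d2 one_minus_s] using one_minus_s by simp
  qed
  ultimately show ?thesis
    using s_nonzero by simp
qed

text \<open>
  This is twice the principal value of the integral of \<open>kernel * G\<close>: the residue of
  \<open>kernel y * G y / y\<close> at 0, plus one half of its residue at 1. To avoid principal values, \<open>G\<close> is split into \<open>G 1\<close>, for which the
  reflected sum is known, and \<open>(y - 1) * H y\<close>, which cancels the pole.
\<close>

lemma circle_integral_kernel:
  assumes G: "G holomorphic_on ball 0 \<rho>" "1 < \<rho>"
    and f: "f \<in> borel_measurable borel" "\<And>y. norm y = 1 \<Longrightarrow> y \<noteq> 1 \<Longrightarrow>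
      f y = kernel y * G y + kernel (inverse y) * G (inverse y)"
  shows "(\<integral>y. f y \<partial>circle_measure) = 2 * (c_one * G 1 - s * G 0)"
proof -
  define r where "r = min \<rho> (1 / norm s)"
  define H where "H y = (if y = 1 then deriv G 1 else (G y - G 1) / (y - 1))" for y
  define h where "h y = (1 + y) * (y + s) / (1 - s * y) * H y
    + G 1 * ((1 + s\<^sup>2) / s) * (c_one * (1 / (1 - s * y)) - (c_one + 1) / 2)" for y
  have "H holomorphic_on ball 0 \<rho>"
    unfolding H_def[abs_def] by (rule pole_lemma) (use G in auto)
  then have H: "H holomorphic_on ball 0 r"
    by (rule holomorphic_on_subset) (auto simp: r_def)
  have r: "1 < r"
    using G norm_s s_nonzero by (simp add: r_def)
  have d: "1 - s * y \<noteq> 0" if "y \<in> ball 0 r" for y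
  proof
    assume "1 - s * y = 0"
    then have "norm s * norm y = 1"
      by (metis eq_iff_diff_eq_0 norm_mult norm_one)
    moreover have "norm y < 1 / norm s"
      using that by (simp add: r_def)
    ultimately show False
      using s_nonzero by (simp add: field_simps)
  qed
  have h: "h holomorphic_on ball 0 r"
    unfolding h_def using d H by (intro holomorphic_intros) auto
  have "f y = h y + h (inverse y)" if y: "norm y = 1" "y \<noteq> 1" for y
  proof -
    have split: "kernel z * G z = (1 + z) * (z + s) / (1 - s * z) * H z + G 1 * kernel z"
      if "z \<noteq> 1" "norm z = 1" for z
      using that one_minus_s_mult[of z]
      by (simp add: kernel_def H_def divide_simps) (simp add: algebra_simps)
    have y': "inverse y \<noteq> 1" "norm (inverse y) = 1"
      using y by (auto simp: norm_inverse)
    have ring: "u + g * k + (u' + g * k') =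
        u + g * w * (c * p - (c + 1) / 2) + (u' + g * w * (c * p' - (c + 1) / 2))"
      if "k + k' = w * (c * (p + p') - c - 1)" for u u' g k k' w c p p' :: complex
    proof -
      have "u + g * k + (u' + g * k') = u + u' + g * (k + k')"
        by (simp add: algebra_simps)
      also have "\<dots> = u + g * w * (c * p - (c + 1) / 2) + (u' + g * w * (c * p' - (c + 1) / 2))"
        unfolding that by (simp add: field_simps)
      finally show ?thesis .
    qed
    show ?thesis
      unfolding f(2)[OF y] split[OF y(2) y(1)] split[OF y'] h_def
      by (rule ring[OF kernel_reflected_sum[OF y]])
  qed
  with h r f(1) have "(\<integral>y. f y \<partial>circle_measure) = 2 * h 0"
    by (intro circle_integral_reflected_sum) auto
  also have "h 0 = c_one * G 1 - s * G 0"
    using s_nonzero one_minus_s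
    by (simp add: h_def H_def c_one_def divide_simps) (simp add: algebra_simps power2_eq_square)
  finally show ?thesis .
qed

end

section \<open>Integrability on the torus\<close>

definition torus :: "nat set \<Rightarrow> (nat \<Rightarrow> complex) set" where
  "torus I = {x. \<forall>i\<in>I. norm (x i) = 1}"

abbreviation torus_on :: "nat set \<Rightarrow> (nat \<Rightarrow> complex) measure" where
  "torus_on I \<equiv> \<Pi>\<^sub>M i\<in>I. circle_measure"

definition flip :: "nat \<Rightarrow> (nat \<Rightarrow> complex) \<Rightarrow> nat \<Rightarrow> complex" where
  "flip i x = x(i := inverse (x i))"

lemma flip_torus: "x \<in> torus I \<Longrightarrow> flip i x \<in> torus I"
  by (auto simp: torus_def flip_def norm_inverse)

text \<open>
  An algebra of functions on the torus that are bounded, measurable, and smooth enough for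
  divided differences. It is presented by generators so that the closure under divided
  differences can be proved by induction; all rational functions that occur in the integrand,
  apart from \<open>kernel\<close>, are built from them.
\<close>

inductive tame :: "nat set \<Rightarrow> ((nat \<Rightarrow> complex) \<Rightarrow> complex) \<Rightarrow> bool" for I where
  const: "tame I (\<lambda>_. c)"
| coord: "i \<in> I \<Longrightarrow> tame I (\<lambda>x. x i)"
| inverse_coord: "i \<in> I \<Longrightarrow> tame I (\<lambda>x. inverse (x i))"
| add: "tame I g \<Longrightarrow> tame I h \<Longrightarrow> tame I (\<lambda>x. g x + h x)"
| mult: "tame I g \<Longrightarrow> tame I h \<Longrightarrow> tame I (\<lambda>x. g x * h x)"
| resolvent: "tame I g \<Longrightarrow> (\<And>x. x \<in> torus I \<Longrightarrow> norm (g x) \<le> 1) \<Longrightarrow> norm c < 1 \<Longrightarrow>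
    tame I (\<lambda>x. 1 / (1 - c * g x))"

lemma tame_diff: "tame I g \<Longrightarrow> tame I h \<Longrightarrow> tame I (\<lambda>x. g x - h x)"
  using tame.add[OF _ tame.mult[OF tame.const[of I "-1"]], of g h] by simp

lemma tame_power: "tame I g \<Longrightarrow> tame I (\<lambda>x. g x ^ k)"
  by (induction k) (auto intro: tame.const tame.mult)

lemma tame_measurable:
  assumes "tame I g"
  shows "g \<in> borel_measurable (torus_on I)"
  using assms
proof induction
  case (coord i)
  then show ?case
    using measurable_component_singleton[of i I "\<lambda>_. circle_measure"] by simp
next
  case (inverse_coord i)
  then have "(\<lambda>x. x i) \<in> borel_measurable (torus_on I)"
    using measurable_component_singleton[of i I "\<lambda>_. circle_measure"] by simp
  then show ?case by measurable
qed (auto intro: borel_measurable_add borel_measurable_times borel_measurable_divide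
    borel_measurable_diff)

lemma one_minus_mult_lower_bound:
  fixes c z :: complex
  assumes "norm c < 1" "norm z \<le> 1"
  shows "1 - norm c \<le> norm (1 - c * z)"
proof -
  have "norm (c * z) \<le> norm c"
    using assms by (simp add: norm_mult mult_left_le)
  then show ?thesis
    using norm_triangle_ineq2[of 1 "c * z"] by simp
qed

lemma tame_bounded:
  assumes "tame I g"
  shows "\<exists>B. \<forall>x\<in>torus I. norm (g x) \<le> B"
  using assms
proof induction
  case (add g h)
  then obtain B C where "\<forall>x\<in>torus I. norm (g x) \<le> B" "\<forall>x\<in>torus I. norm (h x) \<le> C" by auto
  then show ?case
    by (intro exI[of _ "B + C"]) (auto intro: norm_triangle_mono)
next
  case (mult g h)
  then obtain B C where "\<forall>x\<in>torus I. norm (g x) \<le> B" "\<forall>x\<in>torus I. norm (h x) \<le> C" by auto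
  then show ?case
    by (intro exI[of _ "B * C"]) (auto simp: norm_mult intro!: mult_mono intro: order_trans[OF norm_ge_zero])
next
  case (resolvent g c)
  show ?case
  proof (intro exI ballI)
    fix x assume "x \<in> torus I"
    with resolvent have "1 - norm c \<le> norm (1 - c * g x)" "0 < 1 - norm c"
      by (auto intro: one_minus_mult_lower_bound)
    then show "norm (1 / (1 - c * g x)) \<le> 1 / (1 - norm c)"
      by (simp add: norm_divide frac_le)
  qed
qed (auto simp: torus_def norm_inverse)

lemma tame_flip:
  assumes "tame I g" "i \<in> I"
  shows "tame I (\<lambda>x. g (flip i x))"
  using assms(1)
proof induction
  case (coord j)
  show ?case
  proof (cases "j = i")
    case True
    then show ?thesis using tame.inverse_coord[OF assms(2)] by (simp add: flip_def)
  next
    case False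
    then show ?thesis using tame.coord[OF coord] by (simp add: flip_def)
  qed
next
  case (inverse_coord j)
  show ?case
  proof (cases "j = i")
    case True
    then show ?thesis using tame.coord[OF assms(2)] by (simp add: flip_def)
  next
    case False
    then show ?thesis using tame.inverse_coord[OF inverse_coord] by (simp add: flip_def)
  qed
next
  case (resolvent g c)
  then show ?case by (intro tame.resolvent) (auto intro: flip_torus)
qed (auto intro: tame.intros)

text \<open>
  Products are covered by the product rule for differences, and resolvents by
  \<open>1 / (1 - u) - 1 / (1 - v) = (u - v) / ((1 - u) * (1 - v))\<close>.
\<close>

lemma tame_divided_difference:
  assumes "tame I g" "i \<in> I"
  shows "\<exists>h. tame I h \<and> (\<forall>x\<in>torus I. g x - g (flip i x) = (x i - inverse (x i)) * h x)"
  using assms(1)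
proof induction
  case (const c)
  then show ?case by (intro exI[of _ "\<lambda>_. 0"]) (auto intro: tame.const)
next
  case (coord j)
  show ?case
    by (rule exI[of _ "\<lambda>_. if j = i then 1 else 0"]) (auto intro: tame.const simp: flip_def)
next
  case (inverse_coord j)
  show ?case
    by (rule exI[of _ "\<lambda>_. if j = i then -1 else 0"]) (auto intro: tame.const simp: flip_def)
next
  case (add g1 g2)
  then obtain h1 h2 where h: "tame I h1" "tame I h2"
    and eq: "\<forall>x\<in>torus I. g1 x - g1 (flip i x) = (x i - inverse (x i)) * h1 x"
    "\<forall>x\<in>torus I. g2 x - g2 (flip i x) = (x i - inverse (x i)) * h2 x" by auto
  have "g1 x + g2 x - (g1 (flip i x) + g2 (flip i x)) = (x i - inverse (x i)) * (h1 x + h2 x)"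
    if "x \<in> torus I" for x
    using eq that by (simp add: distrib_left add_diff_add)
  with h show ?case
    by (intro exI[of _ "\<lambda>x. h1 x + h2 x"]) (auto intro: tame.add)
next
  case (mult g1 g2)
  then obtain h1 h2 where h: "tame I h1" "tame I h2"
    and eq: "\<forall>x\<in>torus I. g1 x - g1 (flip i x) = (x i - inverse (x i)) * h1 x"
    "\<forall>x\<in>torus I. g2 x - g2 (flip i x) = (x i - inverse (x i)) * h2 x" by auto
  have "tame I (\<lambda>x. h1 x * g2 x + g1 (flip i x) * h2 x)"
    using h mult tame_flip[OF mult.hyps(1) assms(2)] by (intro tame.intros)
  moreover have "g1 x * g2 x - g1 (flip i x) * g2 (flip i x)
      = (x i - inverse (x i)) * (h1 x * g2 x + g1 (flip i x) * h2 x)" if "x \<in> torus I" for x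
  proof -
    have "g1 x * g2 x - g1 (flip i x) * g2 (flip i x) =
        (g1 x - g1 (flip i x)) * g2 x + g1 (flip i x) * (g2 x - g2 (flip i x))"
      by (simp add: algebra_simps)
    then show ?thesis
      using eq that by (simp add: algebra_simps)
  qed
  ultimately show ?case by blast
next
  case (resolvent g c)
  then obtain h where h: "tame I h"
    and eq: "\<forall>x\<in>torus I. g x - g (flip i x) = (x i - inverse (x i)) * h x" by auto
  have r: "tame I (\<lambda>x. 1 / (1 - c * g x))"
    using resolvent by (intro tame.resolvent)
  have "tame I (\<lambda>x. c * h x * (1 / (1 - c * g x)) * (1 / (1 - c * g (flip i x))))"
    using h tame_flip[OF r assms(2)] r by (intro tame.mult tame.const)
  moreover have "1 / (1 - c * g x) - 1 / (1 - c * g (flip i x)) =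
      (x i - inverse (x i)) * (c * h x * (1 / (1 - c * g x)) * (1 / (1 - c * g (flip i x))))"
    if x: "x \<in> torus I" for x
  proof -
    have "1 - c * g y \<noteq> 0" if "y \<in> torus I" for y
      using one_minus_mult_lower_bound[of c "g y"] resolvent that by force
    then have nz: "1 - c * g x \<noteq> 0" "1 - c * g (flip i x) \<noteq> 0"
      using x flip_torus by blast+
    have "1 / (1 - c * g x) - 1 / (1 - c * g (flip i x)) =
        c * (g x - g (flip i x)) / ((1 - c * g x) * (1 - c * g (flip i x)))"
      using nz by (simp add: divide_simps) (simp add: algebra_simps)
    then show ?thesis
      using eq x by simp
  qed
  ultimately show ?case by blast
qed

text \<open>
  The integrands contain the factors \<open>kernel\<close>, whose values at 1 are those of a division by zero.
  Hence they can be compared with a tame function only where no coordinate is 1.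
\<close>

definition tame_off_1 :: "nat set \<Rightarrow> ((nat \<Rightarrow> complex) \<Rightarrow> complex) \<Rightarrow> bool" where
  "tame_off_1 I \<Phi> \<longleftrightarrow> \<Phi> \<in> borel_measurable (torus_on I) \<and>
     (\<exists>g. tame I g \<and> (\<forall>x\<in>torus I. (\<forall>i\<in>I. x i \<noteq> 1) \<longrightarrow> \<Phi> x = g x))"

lemma tame_off_1_tameI: "tame I g \<Longrightarrow> tame_off_1 I g"
  by (auto simp: tame_off_1_def tame_measurable)

lemma tame_off_1_mult:
  assumes "tame_off_1 I \<Phi>" "tame_off_1 I \<Psi>"
  shows "tame_off_1 I (\<lambda>x. \<Phi> x * \<Psi> x)"
proof -
  from assms obtain g h where "tame I g" "tame I h"
    "\<forall>x\<in>torus I. (\<forall>i\<in>I. x i \<noteq> 1) \<longrightarrow> \<Phi> x = g x" "\<forall>x\<in>torus I. (\<forall>i\<in>I. x i \<noteq> 1) \<longrightarrow> \<Psi> x = h x"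
    by (auto simp: tame_off_1_def)
  then have "tame I (\<lambda>x. g x * h x) \<and> (\<forall>x\<in>torus I. (\<forall>i\<in>I. x i \<noteq> 1) \<longrightarrow> \<Phi> x * \<Psi> x = g x * h x)"
    by (auto intro: tame.mult)
  moreover have "(\<lambda>x. \<Phi> x * \<Psi> x) \<in> borel_measurable (torus_on I)"
    using assms by (auto simp: tame_off_1_def)
  ultimately show ?thesis
    unfolding tame_off_1_def by blast
qed

lemma tame_off_1_add:
  assumes "tame_off_1 I \<Phi>" "tame_off_1 I \<Psi>"
  shows "tame_off_1 I (\<lambda>x. \<Phi> x + \<Psi> x)"
proof -
  from assms obtain g h where "tame I g" "tame I h"
    "\<forall>x\<in>torus I. (\<forall>i\<in>I. x i \<noteq> 1) \<longrightarrow> \<Phi> x = g x" "\<forall>x\<in>torus I. (\<forall>i\<in>I. x i \<noteq> 1) \<longrightarrow> \<Psi> x = h x"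
    by (auto simp: tame_off_1_def)
  then have "tame I (\<lambda>x. g x + h x) \<and> (\<forall>x\<in>torus I. (\<forall>i\<in>I. x i \<noteq> 1) \<longrightarrow> \<Phi> x + \<Psi> x = g x + h x)"
    by (auto intro: tame.add)
  moreover have "(\<lambda>x. \<Phi> x + \<Psi> x) \<in> borel_measurable (torus_on I)"
    using assms by (auto simp: tame_off_1_def)
  ultimately show ?thesis
    unfolding tame_off_1_def by blast
qed

lemma tame_off_1_sum: "(\<And>a. a \<in> A \<Longrightarrow> tame_off_1 I (\<Phi> a)) \<Longrightarrow> tame_off_1 I (\<lambda>x. \<Sum>a\<in>A. \<Phi> a x)"
  by (induction A rule: infinite_finite_induct)
     (auto intro: tame_off_1_tameI tame.const tame_off_1_add)

lemma measurable_flip [measurable]: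
  assumes "i \<in> I"
  shows "flip i \<in> torus_on I \<rightarrow>\<^sub>M torus_on I"
proof -
  have "(\<lambda>x. inverse (x i)) \<in> torus_on I \<rightarrow>\<^sub>M circle_measure"
    using tame_measurable[OF tame.inverse_coord[OF assms]] by simp
  then show ?thesis
    unfolding flip_def[abs_def] using assms
    by (intro measurable_fun_upd[of _ I]) auto
qed

lemma prob_space_torus_on: "prob_space (torus_on I)"
  by (intro prob_space_PiM prob_space_circle_measure)

lemma AE_torus_on:
  assumes "finite I"
  shows "AE x in torus_on I. x \<in> torus I \<and> (\<forall>i\<in>I. x i \<noteq> 1)"
proof -
  have "AE x in torus_on I. norm (x i) = 1 \<and> x i \<noteq> 1" if "i \<in> I" for i
    by (rule AE_PiM_component[OF prob_space_circle_measure that])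
       (use AE_circle_norm AE_circle_neq[of 1] in eventually_elim, simp)
  then have "AE x in torus_on I. \<forall>i\<in>I. norm (x i) = 1 \<and> x i \<noteq> 1"
    using assms by (intro AE_finite_allI) auto
  then show ?thesis
    by eventually_elim (auto simp: torus_def)
qed

lemma tame_off_1_integrable:
  assumes "tame_off_1 I \<Phi>" "finite I"
  shows "integrable (torus_on I) \<Phi>"
proof -
  interpret prob_space "torus_on I" by (rule prob_space_torus_on)
  obtain g where g: "tame I g" "\<forall>x\<in>torus I. (\<forall>i\<in>I. x i \<noteq> 1) \<longrightarrow> \<Phi> x = g x"
    using assms by (auto simp: tame_off_1_def)
  obtain B where B: "\<forall>x\<in>torus I. norm (g x) \<le> B"
    using tame_bounded[OF g(1)] by auto
  have "AE x in torus_on I. norm (\<Phi> x) \<le> B"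
    using AE_torus_on[OF assms(2)] by eventually_elim (use g B in auto)
  then show ?thesis
    using assms by (intro integrable_const_bound) (auto simp: tame_off_1_def)
qed

context hl_params
begin

lemma tame_cross_factor:
  assumes "tame I g" "\<And>x. x \<in> torus I \<Longrightarrow> norm (g x) \<le> 1"
  shows "tame I (\<lambda>x. cross_factor (g x))"
proof -
  have "tame I (\<lambda>x. (t - g x) * (1 / (1 - t * g x)))"
    using assms norm_t by (intro tame.mult tame_diff tame.const tame.resolvent)
  then show ?thesis
    by (simp add: cross_factor_def)
qed

text \<open>
  Write the sum as \<open>(kernel y + kernel (1 / y)) * \<Phi> x - kernel (1 / y) * (\<Phi> x - \<Phi> (flip i x))\<close>.
  In the first term the poles cancel, and in the second one the difference is divisible by
  \<open>y - 1 / y\<close>, which cancels the pole of \<open>kernel (1 / y)\<close>.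
\<close>

lemma tame_off_1_kernel_reflected_sum:
  assumes "tame_off_1 I \<Phi>" "i \<in> I"
  shows "tame_off_1 I (\<lambda>x. kernel (x i) * \<Phi> x + kernel (inverse (x i)) * \<Phi> (flip i x))"
proof -
  obtain g where g: "tame I g" "\<And>x. x \<in> torus I \<Longrightarrow> (\<And>i. i \<in> I \<Longrightarrow> x i \<noteq> 1) \<Longrightarrow> \<Phi> x = g x"
    using assms by (auto simp: tame_off_1_def)
  obtain h where h: "tame I h" "\<And>x. x \<in> torus I \<Longrightarrow> g x - g (flip i x) = (x i - inverse (x i)) * h x"
    using tame_divided_difference[OF g(1) assms(2)] by auto
  define k where "k x = (1 + s\<^sup>2) / s *
    (c_one * (1 / (1 - s * x i) + 1 / (1 - s * inverse (x i))) - c_one - 1)" for x :: "nat \<Rightarrow> complex"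
  define l where "l x = (x i + 1)^2 * (1 + s * x i) * inverse (x i) ^ 2 * (1 / (1 - s * inverse (x i)))"
    for x :: "nat \<Rightarrow> complex"
  have unit: "norm (x i) \<le> 1" "norm (inverse (x i)) \<le> 1" if "x \<in> torus I" for x
    using that assms by (auto simp: torus_def norm_inverse)
  have r: "tame I (\<lambda>x. 1 / (1 - s * x i))" "tame I (\<lambda>x. 1 / (1 - s * inverse (x i)))"
    using assms(2) norm_s unit by (auto intro!: tame.resolvent tame.coord tame.inverse_coord)
  have "tame I k" "tame I l"
    unfolding k_def l_def
    by (intro r tame.mult tame.add tame_diff tame_power tame.const tame.coord[OF assms(2)]
        tame.inverse_coord[OF assms(2)])+
  then have "tame I (\<lambda>x. k x * g x + l x * h x)"
    using g h by (intro tame.add tame.mult)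
  moreover have "kernel (x i) * \<Phi> x + kernel (inverse (x i)) * \<Phi> (flip i x) = k x * g x + l x * h x"
    if x: "x \<in> torus I" "\<forall>i\<in>I. x i \<noteq> 1" for x
  proof -
    have y: "norm (x i) = 1" "x i \<noteq> 1" "x i \<noteq> 0"
      using x assms by (auto simp: torus_def)
    have "1 - s * inverse (x i) \<noteq> 0"
      using unit[OF x(1)] by (intro one_minus_s_mult)
    then have l: "kernel (inverse (x i)) * (x i - inverse (x i)) = - l x"
      using y by (simp add: kernel_def l_def divide_simps) (simp add: algebra_simps power2_eq_square)
    have "\<Phi> (flip i x) = g (flip i x)"
      using x by (intro g(2) flip_torus) (auto simp: flip_def)
    also have "\<dots> = g x - (x i - inverse (x i)) * h x"
      using h(2)[OF x(1)] by (simp add: algebra_simps)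
    finally have flip_eq: "\<Phi> (flip i x) = g x - (x i - inverse (x i)) * h x" .
    have "\<Phi> x = g x"
      using x by (intro g(2)) auto
    then have "kernel (x i) * \<Phi> x + kernel (inverse (x i)) * \<Phi> (flip i x) =
        (kernel (x i) + kernel (inverse (x i))) * g x
        - kernel (inverse (x i)) * (x i - inverse (x i)) * h x"
      unfolding flip_eq by (simp add: algebra_simps)
    also have "\<dots> = k x * g x + l x * h x"
      unfolding l kernel_reflected_sum[OF y(1,2)] k_def by simp
    finally show ?thesis .
  qed
  moreover have "(\<lambda>x. kernel (x i) * \<Phi> x + kernel (inverse (x i)) * \<Phi> (flip i x))
      \<in> borel_measurable (torus_on I)"
  proof -
    have [measurable]: "kernel \<in> borel_measurable borel"
      unfolding kernel_def by measurable
    have [measurable]: "(\<lambda>x. x i) \<in> borel_measurable (torus_on I)"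
      by (rule tame_measurable[OF tame.coord[OF assms(2)]])
    have [measurable]: "\<Phi> \<in> borel_measurable (torus_on I)"
      using assms by (simp add: tame_off_1_def)
    have [measurable]: "flip i \<in> torus_on I \<rightarrow>\<^sub>M torus_on I"
      by (rule measurable_flip[OF assms(2)])
    show ?thesis by measurable
  qed
  ultimately show ?thesis
    unfolding tame_off_1_def by blast
qed

end

section \<open>Sums over pairings\<close>

context hl_params
begin

text \<open>
  The effect of an arc from the first free position to \<open>b\<close>, with letter \<open>y\<close>, on the weights \<open>f p z\<close>
  of a letter \<open>z\<close> at a free position \<open>p\<close>.
\<close>

definition twist :: "nat \<Rightarrow> complex \<Rightarrow> (nat \<Rightarrow> complex \<Rightarrow> complex) \<Rightarrow> nat \<Rightarrow> complex \<Rightarrow> complex" where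
  "twist b y f p z = f p z * (if p < b then cross_factor (y * z) else 1)"

text \<open>
  The sum over all placements of the letters of the variables \<open>x i\<close>, \<open>i \<in> I\<close>, on the positions \<open>F\<close>,
  after the cancellation described above, where \<open>f p z\<close> is the weight of the letter \<open>z\<close> at position
  \<open>p\<close>. In one step the first position receives the letter \<open>x i\<close> or \<open>1 / x i\<close>, and \<open>b\<close> is the
  position of its inverse. Passing the cross factors on to the weights of the remaining positions
  makes this a recursion on the number \<open>m\<close> of variables.
\<close>

primrec pairing_sum ::
  "nat \<Rightarrow> nat set \<Rightarrow> (nat \<Rightarrow> complex \<Rightarrow> complex) \<Rightarrow> nat set \<Rightarrow> (nat \<Rightarrow> complex) \<Rightarrow> complex" where
  "pairing_sum 0 F f I x = 1"
| "pairing_sum (Suc m) F f I x = (\<Sum>i\<in>I. \<Sum>b\<in>F - {Min F}.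
     kernel (x i) * (f (Min F) (x i) * f b (inverse (x i)) *
       pairing_sum m (F - {Min F, b}) (twist b (x i) f) (I - {i}) x) +
     kernel (inverse (x i)) * (f (Min F) (inverse (x i)) * f b (x i) *
       pairing_sum m (F - {Min F, b}) (twist b (inverse (x i)) f) (I - {i}) x))"

lemma pairing_sum_cong:
  assumes "finite F" "\<And>i. i \<in> I \<Longrightarrow> x i = x' i"
    "\<And>p i. p \<in> F \<Longrightarrow> i \<in> I \<Longrightarrow> f p (x i) = f' p (x i) \<and> f p (inverse (x i)) = f' p (inverse (x i))"
  shows "pairing_sum m F f I x = pairing_sum m F f' I x'"
  using assms
proof (induction m arbitrary: F f f' I)
  case (Suc m)
  show ?case
    unfolding pairing_sum.simps
  proof (intro sum.cong refl)
    fix i b assume i: "i \<in> I" and b: "b \<in> F - {Min F}"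
    then have a: "Min F \<in> F" "b \<in> F" using Suc.prems Min_mem[of F b] by auto
    have "pairing_sum m (F - {Min F, b}) (twist b y f) (I - {i}) x =
        pairing_sum m (F - {Min F, b}) (twist b y f') (I - {i}) x'" for y
      using Suc.prems by (intro Suc.IH) (auto simp: twist_def)
    then show "kernel (x i) * (f (Min F) (x i) * f b (inverse (x i)) *
         pairing_sum m (F - {Min F, b}) (twist b (x i) f) (I - {i}) x) +
       kernel (inverse (x i)) * (f (Min F) (inverse (x i)) * f b (x i) *
         pairing_sum m (F - {Min F, b}) (twist b (inverse (x i)) f) (I - {i}) x) =
       kernel (x' i) * (f' (Min F) (x' i) * f' b (inverse (x' i)) *
         pairing_sum m (F - {Min F, b}) (twist b (x' i) f') (I - {i}) x') +
       kernel (inverse (x' i)) * (f' (Min F) (inverse (x' i)) * f' b (x' i) *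
         pairing_sum m (F - {Min F, b}) (twist b (inverse (x' i)) f') (I - {i}) x')"
      using Suc.prems(3)[OF a(1) i] Suc.prems(3)[OF a(2) i] Suc.prems(2)[OF i] by simp
  qed
qed simp

lemma pairing_sum_scale:
  assumes "finite F" "card F = 2 * m"
  shows "pairing_sum m F (\<lambda>p z. r p * f p z) I x = (\<Prod>p\<in>F. r p) * pairing_sum m F f I x"
  using assms
proof (induction m arbitrary: F f I)
  case (Suc m)
  show ?case
    unfolding pairing_sum.simps sum_distrib_left
  proof (intro sum.cong refl)
    fix i b assume i: "i \<in> I" and b: "b \<in> F - {Min F}"
    have "Min F \<in> F" using Suc.prems b Min_mem[of F b] by auto
    then have "(\<Prod>p\<in>F. r p) = r (Min F) * r b * (\<Prod>p\<in>F - {Min F, b}. r p)"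
      and "card (F - {Min F, b}) = 2 * m"
      using Suc.prems b by (auto simp: prod.remove[of F "Min F"] prod.remove[of "F - {Min F}" b]
          card_Diff_subset Diff_insert2[of F "Min F" "{b}"])
    moreover have "twist b y (\<lambda>p z. r p * f p z) = (\<lambda>p z. r p * twist b y f p z)" for y
      by (auto simp: twist_def fun_eq_iff)
    ultimately show "kernel (x i) * (r (Min F) * f (Min F) (x i) * (r b * f b (inverse (x i))) *
         pairing_sum m (F - {Min F, b}) (twist b (x i) (\<lambda>p z. r p * f p z)) (I - {i}) x) +
       kernel (inverse (x i)) * (r (Min F) * f (Min F) (inverse (x i)) * (r b * f b (x i)) *
         pairing_sum m (F - {Min F, b}) (twist b (inverse (x i)) (\<lambda>p z. r p * f p z)) (I - {i}) x) =
       (\<Prod>p\<in>F. r p) * (kernel (x i) * (f (Min F) (x i) * f b (inverse (x i)) *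
         pairing_sum m (F - {Min F, b}) (twist b (x i) f) (I - {i}) x) +
       kernel (inverse (x i)) * (f (Min F) (inverse (x i)) * f b (x i) *
         pairing_sum m (F - {Min F, b}) (twist b (inverse (x i)) f) (I - {i}) x))"
      using Suc.prems by (simp add: Suc.IH algebra_simps)
  qed
qed simp

lemma pairing_sum_holomorphic:
  assumes "finite F" "\<And>p i. p \<in> F \<Longrightarrow> i \<in> I \<Longrightarrow>
    (\<lambda>y. f y p (x i)) holomorphic_on S \<and> (\<lambda>y. f y p (inverse (x i))) holomorphic_on S"
  shows "(\<lambda>y. pairing_sum m F (f y) I x) holomorphic_on S"
  using assms
proof (induction m arbitrary: F f I)
  case (Suc m)
  have "(\<lambda>y. pairing_sum m (F - {Min F, b}) (twist b z (f y)) (I - {i}) x) holomorphic_on S"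
    if "i \<in> I" for i b z
    using Suc.prems unfolding twist_def[abs_def]
    by (intro Suc.IH) (auto intro!: holomorphic_intros)
  moreover have "Min F \<in> F" if "b \<in> F - {Min F}" for b
    using Suc.prems that Min_mem[of F b] by auto
  ultimately show ?case
    unfolding pairing_sum.simps using Suc.prems(2)
    by (intro holomorphic_on_sum holomorphic_on_add holomorphic_on_mult holomorphic_on_const) auto
qed simp

text \<open>
  The weights may depend on the coordinates in \<open>J - I\<close>, which is where the recursion puts the
  variables that have been placed already.
\<close>

lemma pairing_sum_tame_off_1:
  assumes "finite F" "I \<subseteq> J"
    "\<And>p i. p \<in> F \<Longrightarrow> i \<in> I \<Longrightarrow>
       tame_off_1 J (\<lambda>x. f x p (x i)) \<and> tame_off_1 J (\<lambda>x. f x p (inverse (x i)))"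
    "\<And>i x v. i \<in> I \<Longrightarrow> f (x(i := v)) = f x"
  shows "tame_off_1 J (\<lambda>x. pairing_sum m F (f x) I x)"
  using assms
proof (induction m arbitrary: F f I)
  case 0
  then show ?case by (simp add: tame_off_1_tameI tame.const)
next
  case (Suc m)
  show ?case
    unfolding pairing_sum.simps
  proof (intro tame_off_1_sum)
    fix i b assume i: "i \<in> I" and b: "b \<in> F - {Min F}"
    then have a: "Min F \<in> F" "b \<in> F" using Suc.prems Min_mem[of F b] by auto
    define \<Phi> where "\<Phi> x = f x (Min F) (x i) * f x b (inverse (x i)) *
       pairing_sum m (F - {Min F, b}) (twist b (x i) (f x)) (I - {i}) x" for x
    have "tame_off_1 J (\<lambda>x. pairing_sum m (F - {Min F, b}) (twist b (x i) (f x)) (I - {i}) x)"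
    proof (intro Suc.IH conjI)
      fix p j assume p: "p \<in> F - {Min F, b}" and j: "j \<in> I - {i}"
      have "tame J (\<lambda>x. if p < b then cross_factor (x i * x j) else 1)"
        "tame J (\<lambda>x. if p < b then cross_factor (x i * inverse (x j)) else 1)"
        using i j Suc.prems
        by (cases "p < b"; auto intro!: tame.intros tame_cross_factor
            simp: torus_def norm_mult norm_inverse subset_eq)+
      then show "tame_off_1 J (\<lambda>x. twist b (x i) (f x) p (x j))"
        "tame_off_1 J (\<lambda>x. twist b (x i) (f x) p (inverse (x j)))"
        unfolding twist_def using Suc.prems(3)[of p j] p j
        by (auto intro!: tame_off_1_mult intro: tame_off_1_tameI)
    next
      fix j x v assume "j \<in> I - {i}"
      then show "twist b ((x(j := v)) i) (f (x(j := v))) = twist b (x i) (f x)"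
        by (subst Suc.prems(4)) auto
    qed (use Suc.prems in auto)
    then have "tame_off_1 J \<Phi>"
      unfolding \<Phi>_def using Suc.prems(3) a i by (intro tame_off_1_mult) auto
    then have "tame_off_1 J (\<lambda>x. kernel (x i) * \<Phi> x + kernel (inverse (x i)) * \<Phi> (flip i x))"
      using Suc.prems i by (intro tame_off_1_kernel_reflected_sum) auto
    moreover have "\<Phi> (flip i x) = f x (Min F) (inverse (x i)) * f x b (x i) *
       pairing_sum m (F - {Min F, b}) (twist b (inverse (x i)) (f x)) (I - {i}) x" for x
    proof -
      have "f (flip i x) = f x"
        unfolding flip_def using Suc.prems(4)[OF i] .
      moreover have "pairing_sum m (F - {Min F, b}) g (I - {i}) (flip i x) =
          pairing_sum m (F - {Min F, b}) g (I - {i}) x" for g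
        using Suc.prems by (intro pairing_sum_cong) (auto simp: flip_def)
      ultimately show ?thesis
        by (simp add: \<Phi>_def) (simp add: flip_def)
    qed
    ultimately show "tame_off_1 J (\<lambda>x.
       kernel (x i) * (f x (Min F) (x i) * f x b (inverse (x i)) *
         pairing_sum m (F - {Min F, b}) (twist b (x i) (f x)) (I - {i}) x) +
       kernel (inverse (x i)) * (f x (Min F) (inverse (x i)) * f x b (x i) *
         pairing_sum m (F - {Min F, b}) (twist b (inverse (x i)) (f x)) (I - {i}) x))"
      by (simp add: \<Phi>_def)
  qed
qed

end

section \<open>Integrating out one variable at a time\<close>

interpretation circle_product: product_sigma_finite "\<lambda>_::nat. circle_measure"
  by standard

context hl_params
begin

lemma norm_eq_1_cross_factor_neq_0:
  assumes "norm z = 1"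
  shows "cross_factor z \<noteq> 0"
proof -
  have "t \<noteq> z" using norm_t assms by auto
  then show ?thesis
    using one_minus_t_mult[of z] assms by (simp add: cross_factor_def)
qed

lemma cross_factor_inverse:
  assumes "norm z = 1"
  shows "cross_factor (inverse z) = inverse (cross_factor z)"
proof -
  have "z \<noteq> 0" using assms by auto
  then show ?thesis
    by (simp add: cross_factor_def divide_simps) (simp add: algebra_simps)
qed

lemma cross_factor_0: "cross_factor 0 = t"
  by (simp add: cross_factor_def)

lemma cross_factor_1: "cross_factor 1 = -1"
  using one_minus_t by (simp add: cross_factor_def divide_simps)

lemma cross_factor_holomorphic:
  assumes "norm z = 1"
  shows "(\<lambda>y. cross_factor (y * z)) holomorphic_on ball 0 (1 / norm t)"
proof -
  have "1 - t * (y * z) \<noteq> 0" if "y \<in> ball 0 (1 / norm t)" for y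
  proof
    assume "1 - t * (y * z) = 0"
    then have "norm (t * (y * z)) = 1"
      by (metis eq_iff_diff_eq_0 norm_one)
    then have "norm t * norm y = 1"
      using assms by (simp add: norm_mult)
    moreover have "norm y < 1 / norm t"
      using that by simp
    moreover have "norm t > 0"
      using s_nonzero by (simp flip: s_sq)
    ultimately show False
      by (simp add: field_simps)
  qed
  then show ?thesis
    unfolding cross_factor_def by (intro holomorphic_intros) auto
qed

end

context hl_word
begin

text \<open>
  The weight of a letter \<open>z\<close> at position \<open>p\<close> when the positions \<open>X\<close> are marked. A marked arc from
  \<open>a\<close> to \<open>b\<close> contributes a cross factor at the positions between \<open>a\<close> and \<open>b\<close>; as all free positions
  come after \<open>a\<close>, counting the marks to the right of \<open>p\<close> amounts to the same.
\<close>

definition letter :: "nat set \<Rightarrow> nat \<Rightarrow> complex \<Rightarrow> complex" where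
  "letter X p z = z ^ lam p * cross_factor z ^ card {q\<in>X. p < q}"

lemma letter_pair:
  assumes "norm y = 1" "a < b" "a \<notin> X" "b \<notin> X" "finite X"
  shows "letter X a y * letter X b (inverse y) =
    y ^ (lam a - lam b) * cross_factor y ^ card (between a b X)"
proof -
  have le: "lam b \<le> lam a"
    using antimono_lam assms(2) by (simp add: antimono_def)
  have "{q\<in>X. a < q} = between a b X \<union> {q\<in>X. b < q}"
    using assms by (auto simp: between_def) (metis linorder_neqE_nat)
  moreover have "card (between a b X \<union> {q\<in>X. b < q}) = card (between a b X) + card {q\<in>X. b < q}"
    using assms by (intro card_Un_disjoint) (auto simp: between_def)
  ultimately have card: "card {q\<in>X. a < q} = card (between a b X) + card {q\<in>X. b < q}"
    by simp
  have pow: "y ^ lam a = y ^ (lam a - lam b) * y ^ lam b"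
    using le by (simp flip: power_add)
  have "y \<noteq> 0" using assms by auto
  then have "y ^ lam b * inverse y ^ lam b = 1"
    "cross_factor y ^ k * inverse (cross_factor y) ^ k = 1" for k
    using norm_eq_1_cross_factor_neq_0[OF assms(1)] by (simp_all flip: power_mult_distrib)
  then show ?thesis
    unfolding letter_def card pow power_add cross_factor_inverse[OF assms(1)]
    by (simp add: mult_ac)
qed

lemma tame_off_1_letter:
  assumes "i \<in> I"
  shows "tame_off_1 I (\<lambda>x. letter X p (x i))" "tame_off_1 I (\<lambda>x. letter X p (inverse (x i)))"
proof -
  have "tame I (\<lambda>x. x i ^ lam p * cross_factor (x i) ^ card {q\<in>X. p < q})"
    using assms by (intro tame.mult tame_power tame_cross_factor tame.coord) (auto simp: torus_def)
  moreover have "tame I (\<lambda>x. inverse (x i) ^ lam p * cross_factor (inverse (x i)) ^ card {q\<in>X. p < q})"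
    using assms by (intro tame.mult tame_power tame_cross_factor tame.inverse_coord)
      (auto simp: torus_def norm_inverse)
  ultimately show "tame_off_1 I (\<lambda>x. letter X p (x i))" "tame_off_1 I (\<lambda>x. letter X p (inverse (x i)))"
    unfolding letter_def by (auto intro: tame_off_1_tameI)
qed

lemma tame_off_1_pairing_sum_letter:
  assumes "finite F"
  shows "tame_off_1 I (\<lambda>x. pairing_sum m F (letter X) I x)"
  using assms by (intro pairing_sum_tame_off_1) (auto intro: tame_off_1_letter)

text \<open>
  The factor of \<open>kernel (x i)\<close> in \<open>pairing_sum\<close> when the variable \<open>x i\<close> forms the arc from \<open>a\<close> to \<open>b\<close>.
\<close>

definition arc_term :: "nat \<Rightarrow> nat \<Rightarrow> nat \<Rightarrow> nat set \<Rightarrow> nat set \<Rightarrow> nat set \<Rightarrow> nat \<Rightarrow> (nat \<Rightarrow> complex) \<Rightarrow> complex" where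
  "arc_term a b m F X I i x =
     letter X a (x i) * letter X b (inverse (x i)) *
       pairing_sum m (F - {a, b}) (twist b (x i) (letter X)) (I - {i}) x"

lemma pairing_sum_letter_Suc:
  assumes "finite F" "a = Min F"
  shows "pairing_sum (Suc m) F (letter X) I x = (\<Sum>i\<in>I. \<Sum>b\<in>F - {a}.
     kernel (x i) * arc_term a b m F X I i x + kernel (inverse (x i)) * arc_term a b m F X I i (flip i x))"
proof -
  have "pairing_sum m (F - {a, b}) g (I - {i}) (flip i x) = pairing_sum m (F - {a, b}) g (I - {i}) x"
    for b g i
    using assms by (intro pairing_sum_cong) (auto simp: flip_def)
  then show ?thesis
    by (simp add: arc_term_def assms(2)) (simp add: flip_def)
qed

lemma tame_off_1_arc_term:
  assumes "finite F" "i \<in> I"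
  shows "tame_off_1 I (arc_term a b m F X I i)"
proof -
  have "tame_off_1 I (\<lambda>x. pairing_sum m (F - {a, b}) (twist b (x i) (letter X)) (I - {i}) x)"
  proof (intro pairing_sum_tame_off_1 conjI)
    fix p j assume p: "p \<in> F - {a, b}" and j: "j \<in> I - {i}"
    have "tame I (\<lambda>x. if p < b then cross_factor (x i * x j) else 1)"
      "tame I (\<lambda>x. if p < b then cross_factor (x i * inverse (x j)) else 1)"
      using j assms
      by (cases "p < b"; auto intro!: tame.intros tame_cross_factor
          simp: torus_def norm_mult norm_inverse subset_eq)+
    then show "tame_off_1 I (\<lambda>x. twist b (x i) (letter X) p (x j))"
      "tame_off_1 I (\<lambda>x. twist b (x i) (letter X) p (inverse (x j)))"
      unfolding twist_def using tame_off_1_letter[of j I] j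
      by (auto intro!: tame_off_1_mult intro: tame_off_1_tameI)
  qed (use assms in auto)
  then show ?thesis
    unfolding arc_term_def[abs_def] using tame_off_1_letter assms by (intro tame_off_1_mult) auto
qed

text \<open>
  Apply \<open>circle_integral_kernel\<close> to the variable \<open>x i\<close>, the other variables being fixed. Evaluation
  at 1 marks the positions \<open>a\<close> and \<open>b\<close>, with one factor \<open>cross_factor 1 = - 1\<close> for each mark between
  them. Evaluation at 0 replaces each cross factor by \<open>cross_factor 0 = t\<close>, one for each position
  between \<open>a\<close> and \<open>b\<close> that is free or marked.
\<close>

lemma integral_arc_term:
  assumes F: "finite F" "card F = 2 * Suc m" "a \<in> F" "\<And>p. p \<in> F \<Longrightarrow> a \<le> p" "b \<in> F - {a}"
    and X: "finite X" "F \<inter> X = {}"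
    and I: "finite I" "i \<in> I"
  defines "T \<equiv> \<lambda>x. kernel (x i) * arc_term a b m F X I i x
                  + kernel (inverse (x i)) * arc_term a b m F X I i (flip i x)"
  shows "integrable (torus_on I) T"
    and "(\<integral>x. T x \<partial>torus_on I) = 2 *
      (zero_weight a b (F \<union> X) * (\<integral>x. pairing_sum m (F - {a, b}) (letter X) (I - {i}) x \<partial>torus_on (I - {i}))
     + c_one * (-1) ^ card (between a b X) *
         (\<integral>x. pairing_sum m (F - {a, b}) (letter (X \<union> {a, b})) (I - {i}) x \<partial>torus_on (I - {i})))"
proof -
  define J where "J = I - {i}"
  define E where "E = F - {a, b}"
  define e where "e = card (between a b X)"
  have J: "finite J" "i \<notin> J" "I = insert i J"
    using I by (auto simp: J_def)
  have E: "finite E" "card E = 2 * m"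
    using F by (auto simp: E_def card_Diff_subset)
  have ab: "a < b" "a \<notin> X" "b \<notin> X"
    using F X by (auto simp: le_neq_implies_less)
  have T: "tame_off_1 I T"
    unfolding T_def using F I by (intro tame_off_1_kernel_reflected_sum tame_off_1_arc_term)
  then show int: "integrable (torus_on I) T"
    using I by (intro tame_off_1_integrable)
  have T_meas: "T \<in> borel_measurable (torus_on (insert i J))"
    using T by (simp add: tame_off_1_def J(3))
  have inner: "(\<integral>y. T (x(i := y)) \<partial>circle_measure) = 2 *
      (zero_weight a b (F \<union> X) * pairing_sum m E (letter X) J x
     + c_one * (-1) ^ e * pairing_sum m E (letter (X \<union> {a, b})) J x)"
    if x: "x \<in> space (torus_on J)" "x \<in> torus J" for x
  proof -
    \<comment> \<open>The argument \<open>y * 1\<close> is written such that \<open>cross_factor_holomorphic\<close> applies.\<close>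
    define G where "G y = y ^ (lam a - lam b) * cross_factor (y * 1) ^ e *
      pairing_sum m E (twist b y (letter X)) J x" for y
    have arc: "arc_term a b m F X I i (x(i := y)) = G y" if "norm y = 1" for y
    proof -
      have "pairing_sum m E (twist b y (letter X)) J (x(i := y)) =
          pairing_sum m E (twist b y (letter X)) J x"
        using E J by (intro pairing_sum_cong) auto
      then show ?thesis
        using letter_pair[OF that ab X(1)]
        by (simp add: arc_term_def G_def e_def E_def J_def)
    qed
    have rho: "1 < 1 / norm t"
      using norm_t s_nonzero by (simp flip: s_sq)
    have "(\<lambda>y. pairing_sum m E (twist b y (letter X)) J x) holomorphic_on ball 0 (1 / norm t)"
    proof (intro pairing_sum_holomorphic conjI)
      fix p j assume j: "j \<in> J"
      have "norm (x j) = 1" "norm (inverse (x j)) = 1"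
        using x j by (auto simp: torus_def norm_inverse)
      then show "(\<lambda>y. twist b y (letter X) p (x j)) holomorphic_on ball 0 (1 / norm t)"
        "(\<lambda>y. twist b y (letter X) p (inverse (x j))) holomorphic_on ball 0 (1 / norm t)"
        unfolding twist_def
        by (cases "p < b"; auto intro!: holomorphic_intros cross_factor_holomorphic)+
    qed (use E in auto)
    then have G: "G holomorphic_on ball 0 (1 / norm t)"
      unfolding G_def by (intro holomorphic_intros cross_factor_holomorphic) auto
    have "(\<lambda>y. x(i := y)) \<in> circle_measure \<rightarrow>\<^sub>M torus_on (insert i J)"
      using measurable_component_update[OF x(1) J(2)] by simp
    from measurable_compose[OF this T_meas]
    have "(\<lambda>y. T (x(i := y))) \<in> borel_measurable borel"
      by simp
    moreover have "T (x(i := y)) = kernel y * G y + kernel (inverse y) * G (inverse y)"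
      if "norm y = 1" for y
    proof -
      have "flip i (x(i := y)) = x(i := inverse y)"
        by (simp add: flip_def)
      then show ?thesis
        using that arc[of y] arc[of "inverse y"] by (simp add: T_def norm_inverse)
    qed
    ultimately have int: "(\<integral>y. T (x(i := y)) \<partial>circle_measure) = 2 * (c_one * G 1 - s * G 0)"
      using G rho by (intro circle_integral_kernel) auto
    have G1: "G 1 = (-1) ^ e * pairing_sum m E (letter (X \<union> {a, b})) J x"
    proof -
      have "pairing_sum m E (twist b 1 (letter X)) J x =
          pairing_sum m E (letter (X \<union> {a, b})) J x"
      proof (intro pairing_sum_cong)
        fix p i assume p: "p \<in> E"
        have "twist b 1 (letter X) p z = letter (X \<union> {a, b}) p z" for z
        proof (cases "p < b")
          case True
          have "\<not> p < a" using F(4)[of p] p by (auto simp: E_def)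
          then have "{q \<in> X \<union> {a, b}. p < q} = insert b {q \<in> X. p < q}"
            using True by auto
          then show ?thesis
            using ab X True by (simp add: twist_def letter_def)
        next
          case False
          have "\<not> p < a" using F(4)[of p] p by (auto simp: E_def)
          then have "{q \<in> X \<union> {a, b}. p < q} = {q \<in> X. p < q}"
            using False by auto
          then show ?thesis
            using False by (simp add: twist_def letter_def)
        qed
        then show "twist b 1 (letter X) p (x i) = letter (X \<union> {a, b}) p (x i) \<and>
            twist b 1 (letter X) p (inverse (x i)) = letter (X \<union> {a, b}) p (inverse (x i))"
          by simp
      qed (use E in auto)
      then show ?thesis
        by (simp add: G_def cross_factor_1)
    qed
    have G0: "- s * G 0 = zero_weight a b (F \<union> X) * pairing_sum m E (letter X) J x"
    proof -
      have "pairing_sum m E (twist b 0 (letter X)) J x =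
          pairing_sum m E (\<lambda>p z. (if p < b then t else 1) * letter X p z) J x"
        using E by (intro pairing_sum_cong) (auto simp: twist_def cross_factor_0)
      also have "\<dots> = (\<Prod>p\<in>E. if p < b then t else 1) * pairing_sum m E (letter X) J x"
        using E by (rule pairing_sum_scale)
      also have "(\<Prod>p\<in>E. if p < b then t else 1) = t ^ card {p\<in>E. p < b}"
        using E by (simp add: prod.If_cases Int_def)
      also have "{p\<in>E. p < b} = between a b F"
        using F(4) by (auto simp: E_def between_def le_neq_implies_less)
      finally have G0': "G 0 = 0 ^ (lam a - lam b) * t ^ e * t ^ card (between a b F) *
          pairing_sum m E (letter X) J x"
        by (simp add: G_def cross_factor_0)
      have "between a b (F \<union> X) = between a b F \<union> between a b X"
        by (auto simp: between_def)
      moreover have "card (between a b F \<union> between a b X) = card (between a b F) + card (between a b X)"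
        using F X by (intro card_Un_disjoint) (auto simp: between_def)
      ultimately have "card (between a b (F \<union> X)) = card (between a b F) + e"
        by (simp add: e_def)
      moreover have "lam b \<le> lam a"
        using antimono_lam ab by (simp add: antimono_def)
      ultimately show ?thesis
        unfolding G0' zero_weight_def by (auto simp: power_add power_0_left)
    qed
    have "2 * (c_one * G 1 - s * G 0) = 2 * (- s * G 0 + c_one * G 1)"
      by (simp add: algebra_simps)
    then show ?thesis
      unfolding int G0 G1 by (simp only: mult.assoc)
  qed
  have reg: "tame_off_1 J (\<lambda>x. pairing_sum m E (letter Y) J x)" for Y
    using E by (intro tame_off_1_pairing_sum_letter)
  have "(\<integral>x. T x \<partial>torus_on I) = (\<integral>x. (\<integral>y. T (x(i := y)) \<partial>circle_measure) \<partial>torus_on J)"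
    unfolding J(3) using J int by (intro circle_product.product_integral_insert) auto
  also have "\<dots> = (\<integral>x. 2 *
      (zero_weight a b (F \<union> X) * pairing_sum m E (letter X) J x
     + c_one * (-1) ^ e * pairing_sum m E (letter (X \<union> {a, b})) J x) \<partial>torus_on J)"
  proof (rule integral_cong_AE)
    show "AE x in torus_on J. (\<integral>y. T (x(i := y)) \<partial>circle_measure) = 2 *
      (zero_weight a b (F \<union> X) * pairing_sum m E (letter X) J x
     + c_one * (-1) ^ e * pairing_sum m E (letter (X \<union> {a, b})) J x)"
      using AE_torus_on[OF J(1)] AE_space by eventually_elim (use inner in blast)
    have "(\<lambda>(x, y). x(i := y)) \<in> torus_on J \<Otimes>\<^sub>M circle_measure \<rightarrow>\<^sub>M torus_on (insert i J)"
      by (rule measurable_add_dim)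
    from measurable_compose[OF this T_meas]
    have "(\<lambda>(x, y). T (x(i := y))) \<in> borel_measurable (torus_on J \<Otimes>\<^sub>M circle_measure)"
      by (simp add: case_prod_beta')
    then show "(\<lambda>x. \<integral>y. T (x(i := y)) \<partial>circle_measure) \<in> borel_measurable (torus_on J)"
      by (rule circle.borel_measurable_lebesgue_integral)
    show "(\<lambda>x. 2 * (zero_weight a b (F \<union> X) * pairing_sum m E (letter X) J x
        + c_one * (-1) ^ e * pairing_sum m E (letter (X \<union> {a, b})) J x)) \<in> borel_measurable (torus_on J)"
      using reg unfolding tame_off_1_def
      by (intro borel_measurable_times borel_measurable_add borel_measurable_const) auto
  qed
  also have "\<dots> = 2 *
      (zero_weight a b (F \<union> X) * (\<integral>x. pairing_sum m E (letter X) J x \<partial>torus_on J)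
     + c_one * (-1) ^ e * (\<integral>x. pairing_sum m E (letter (X \<union> {a, b})) J x \<partial>torus_on J))"
    using tame_off_1_integrable[OF reg J(1)] by simp
  finally show "(\<integral>x. T x \<partial>torus_on I) = 2 *
      (zero_weight a b (F \<union> X) * (\<integral>x. pairing_sum m (F - {a, b}) (letter X) (I - {i}) x \<partial>torus_on (I - {i}))
     + c_one * (-1) ^ card (between a b X) *
         (\<integral>x. pairing_sum m (F - {a, b}) (letter (X \<union> {a, b})) (I - {i}) x \<partial>torus_on (I - {i})))"
    unfolding E_def J_def e_def .
qed

theorem integral_pairing_sum:
  assumes "finite F" "card F = 2 * m" "finite I" "card I = m" "finite X" "F \<inter> X = {}"
  shows "(\<integral>x. pairing_sum m F (letter X) I x \<partial>torus_on I) = 2 ^ m * fact m * partial_pairings F X"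
  using assms
proof (induction m arbitrary: F I X)
  case 0
  interpret prob_space "torus_on {}" by (rule prob_space_torus_on)
  from 0 show ?case by (simp add: partial_pairings_empty prob_space)
next
  case (Suc m)
  define a where "a = Min F"
  have "F \<noteq> {}" using Suc.prems by auto
  then have a: "a \<in> F" "\<And>p. p \<in> F \<Longrightarrow> a \<le> p"
    using Suc.prems by (auto simp: a_def)
  define T where "T i b x = kernel (x i) * arc_term a b m F X I i x
      + kernel (inverse (x i)) * arc_term a b m F X I i (flip i x)" for i b x
  define w where "w b = zero_weight a b (F \<union> X) * partial_pairings (F - {a, b}) X
      + c_one * (-1) ^ card (between a b X) * partial_pairings (F - {a, b}) (X \<union> {a, b})" for b
  have T: "integrable (torus_on I) (T i b)"
    "(\<integral>x. T i b x \<partial>torus_on I) = 2 ^ Suc m * fact m * w b" if "i \<in> I" "b \<in> F - {a}" for i b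
  proof -
    have "finite (F - {a, b})" "card (F - {a, b}) = 2 * m" "finite (I - {i})" "card (I - {i}) = m"
      using Suc.prems a that by (auto simp: card_Diff_subset)
    note IH = Suc.IH[OF this]
    have IH1: "(\<integral>x. pairing_sum m (F - {a, b}) (letter X) (I - {i}) x \<partial>torus_on (I - {i}))
        = 2 ^ m * fact m * partial_pairings (F - {a, b}) X"
      by (rule IH) (use Suc.prems in auto)
    have IH2: "(\<integral>x. pairing_sum m (F - {a, b}) (letter (X \<union> {a, b})) (I - {i}) x \<partial>torus_on (I - {i}))
        = 2 ^ m * fact m * partial_pairings (F - {a, b}) (X \<union> {a, b})"
      by (rule IH) (use Suc.prems in auto)
    show "integrable (torus_on I) (T i b)"
      unfolding T_def[abs_def] by (rule integral_arc_term(1)) (use Suc.prems a that in auto)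
    have "(\<integral>x. T i b x \<partial>torus_on I) = 2 *
      (zero_weight a b (F \<union> X) * (2 ^ m * fact m * partial_pairings (F - {a, b}) X)
     + c_one * (-1) ^ card (between a b X) *
         (2 ^ m * fact m * partial_pairings (F - {a, b}) (X \<union> {a, b})))"
      unfolding T_def IH1[symmetric] IH2[symmetric]
      by (rule integral_arc_term(2)) (use Suc.prems a that in auto)
    then show "(\<integral>x. T i b x \<partial>torus_on I) = 2 ^ Suc m * fact m * w b"
      by (simp add: w_def algebra_simps)
  qed
  have "(\<integral>x. pairing_sum (Suc m) F (letter X) I x \<partial>torus_on I)
      = (\<integral>x. (\<Sum>i\<in>I. \<Sum>b\<in>F - {a}. T i b x) \<partial>torus_on I)"
    using Suc.prems by (simp only: pairing_sum_letter_Suc[OF _ a_def] T_def)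
  also have "\<dots> = (\<Sum>i\<in>I. \<Sum>b\<in>F - {a}. (\<integral>x. T i b x \<partial>torus_on I))"
  proof -
    have "(\<integral>x. (\<Sum>i\<in>I. \<Sum>b\<in>F - {a}. T i b x) \<partial>torus_on I)
        = (\<Sum>i\<in>I. (\<integral>x. (\<Sum>b\<in>F - {a}. T i b x) \<partial>torus_on I))"
      by (rule Bochner_Integration.integral_sum) (intro Bochner_Integration.integrable_sum T(1))
    also have "\<dots> = (\<Sum>i\<in>I. \<Sum>b\<in>F - {a}. (\<integral>x. T i b x \<partial>torus_on I))"
      by (intro sum.cong[OF refl] Bochner_Integration.integral_sum T(1))
    finally show ?thesis .
  qed
  also have "\<dots> = (\<Sum>i\<in>I. \<Sum>b\<in>F - {a}. 2 ^ Suc m * fact m * w b)"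
    by (intro sum.cong refl T(2))
  also have "\<dots> = 2 ^ Suc m * fact (Suc m) * (\<Sum>b\<in>F - {a}. w b)"
    using Suc.prems by (simp add: sum_distrib_left mult_ac)
  also have "(\<Sum>b\<in>F - {a}. w b) = partial_pairings F X"
    unfolding w_def using Suc.prems a by (intro partial_pairings_rec[symmetric]) auto
  finally show ?case .
qed

end

section \<open>Hall--Littlewood sums over words\<close>

text \<open>
  Compare the leading coefficients in Lagrange's interpolation formula.
\<close>

lemma sum_monic_divided_difference:
  fixes A :: "complex set" and p :: "complex poly"
  assumes "finite A" "card A = Suc (degree p)" "lead_coeff p = 1"
  shows "(\<Sum>a\<in>A. poly p a / (\<Prod>b\<in>A - {a}. a - b)) = 1"
proof -
  define c where "c a = poly p a / (\<Prod>b\<in>A - {a}. a - b)" for a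
  define B where "B a = (\<Prod>b\<in>A - {a}. [:- b, 1:])" for a
  have B: "degree (B a) = degree p" "coeff (B a) (degree p) = 1" if "a \<in> A" for a
  proof -
    have "degree (B a) = (\<Sum>b\<in>A - {a}. degree [:- b, 1:])"
      unfolding B_def by (intro degree_prod_eq_sum_degree) auto
    then show "degree (B a) = degree p"
      using assms that by simp
    moreover have "lead_coeff (B a) = 1"
      unfolding B_def lead_coeff_prod by simp
    ultimately show "coeff (B a) (degree p) = 1" by simp
  qed
  define q where "q = (\<Sum>a\<in>A. smult (c a) (B a))"
  have "p = q"
  proof (rule poly_eqI_degree)
    fix a assume a: "a \<in> A"
    have "poly (B b) a = 0" if "b \<in> A - {a}" for b
      unfolding B_def poly_prod using assms a that by (intro prod_zero) auto
    then have "poly q a = c a * poly (B a) a"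
      unfolding q_def poly_sum using assms a by (simp add: sum.remove[of A a])
    also have "\<dots> = poly p a"
      using assms by (simp add: c_def B_def poly_prod)
    finally show "poly p a = poly q a" by simp
  next
    have "degree q \<le> degree p"
      unfolding q_def using B by (intro degree_sum_le assms(1)) (auto intro: order_trans[OF degree_smult_le])
    then show "card A > degree q" "card A > degree p"
      using assms by auto
  qed
  then have "1 = coeff q (degree p)"
    using assms by simp
  also have "\<dots> = (\<Sum>a\<in>A. c a)"
    unfolding q_def coeff_sum using B by (intro sum.cong) auto
  finally show ?thesis
    by (simp add: c_def)
qed

text \<open>
  The points of the torus at which the \<open>2 * n\<close> arguments are distinct, so that the symmetrization
  that defines the Hall--Littlewood polynomial has no vanishing denominator.
\<close>

definition pairwise_generic :: "nat set \<Rightarrow> (nat \<Rightarrow> complex) \<Rightarrow> bool" where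
  "pairwise_generic I x \<longleftrightarrow> x \<in> torus I \<and> (\<forall>i\<in>I. x i \<noteq> inverse (x i)) \<and>
     (\<forall>i\<in>I. \<forall>j\<in>I. i \<noteq> j \<longrightarrow> x i \<noteq> x j \<and> x i \<noteq> inverse (x j))"

definition letters :: "nat set \<Rightarrow> (nat \<Rightarrow> complex) \<Rightarrow> complex set" where
  "letters I x = (\<Union>i\<in>I. {x i, inverse (x i)})"

lemma finite_letters: "finite I \<Longrightarrow> finite (letters I x)"
  by (simp add: letters_def)

lemma letters_remove:
  assumes "pairwise_generic I x" "i \<in> I"
  shows "letters (I - {i}) x = letters I x - {x i, inverse (x i)}"
  using assms by (auto simp: letters_def pairwise_generic_def) (metis inverse_inverse_eq)+

lemma pairwise_generic_subset: "pairwise_generic I x \<Longrightarrow> J \<subseteq> I \<Longrightarrow> pairwise_generic J x"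
  unfolding pairwise_generic_def torus_def by blast

lemma letters_disjoint:
  assumes "pairwise_generic I x"
  shows "\<forall>i\<in>I. \<forall>j\<in>I. i \<noteq> j \<longrightarrow> {x i, inverse (x i)} \<inter> {x j, inverse (x j)} = {}"
proof (intro ballI impI)
  fix i j assume "i \<in> I" "j \<in> I" "i \<noteq> j"
  then have "x i \<noteq> x j" "x i \<noteq> inverse (x j)"
    using assms by (auto simp: pairwise_generic_def)
  then show "{x i, inverse (x i)} \<inter> {x j, inverse (x j)} = {}"
    by auto
qed

lemma sum_letters:
  fixes g :: "complex \<Rightarrow> 'a::comm_monoid_add"
  assumes "finite I" "pairwise_generic I x"
  shows "(\<Sum>l\<in>letters I x. g l) = (\<Sum>i\<in>I. g (x i) + g (inverse (x i)))"
proof -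
  have "(\<Sum>l\<in>letters I x. g l) = (\<Sum>i\<in>I. \<Sum>l\<in>{x i, inverse (x i)}. g l)"
    unfolding letters_def using assms
    by (intro sum.UNION_disjoint letters_disjoint) auto
  then show ?thesis
    using assms by (simp add: pairwise_generic_def)
qed

lemma prod_letters:
  fixes g :: "complex \<Rightarrow> 'a::comm_monoid_mult"
  assumes "finite I" "pairwise_generic I x"
  shows "(\<Prod>l\<in>letters I x. g l) = (\<Prod>i\<in>I. g (x i) * g (inverse (x i)))"
proof -
  have "(\<Prod>l\<in>letters I x. g l) = (\<Prod>i\<in>I. \<Prod>l\<in>{x i, inverse (x i)}. g l)"
    unfolding letters_def using assms
    by (intro prod.UNION_disjoint letters_disjoint) auto
  then show ?thesis
    using assms by (simp add: pairwise_generic_def)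
qed

text \<open>
  By Fubini, as a single point is a null set of the circle.
\<close>

lemma AE_torus_on_neq:
  assumes "finite I" "i \<in> I" "j \<in> I" "i \<noteq> j" and h: "h \<in> borel_measurable borel"
  shows "AE x in torus_on I. x i \<noteq> h (x j)"
proof -
  define J where "J = I - {i}"
  have J: "finite J" "i \<notin> J" "j \<in> J" "I = insert i J"
    using assms by (auto simp: J_def)
  define f where "f x = (indicator {0} (x i - h (x j)) :: ennreal)" for x :: "nat \<Rightarrow> complex"
  have [measurable]: "(\<lambda>x. x i) \<in> borel_measurable (torus_on I)" "(\<lambda>x. x j) \<in> borel_measurable (torus_on I)"
    using tame_measurable[OF tame.coord] assms by auto
  have "(\<lambda>x. h (x j)) \<in> borel_measurable (torus_on I)"
    by (rule measurable_compose[OF _ h]) measurable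
  then have f[measurable]: "f \<in> borel_measurable (torus_on I)"
    unfolding f_def by measurable
  have "(\<integral>\<^sup>+x. f x \<partial>torus_on I) = (\<integral>\<^sup>+x. (\<integral>\<^sup>+y. f (x(i := y)) \<partial>circle_measure) \<partial>torus_on J)"
    using f J by (simp only: J(4)) (intro circle_product.product_nn_integral_insert)
  also have "\<dots> = 0"
  proof -
    have "(\<integral>\<^sup>+y. f (x(i := y)) \<partial>circle_measure) = (\<integral>\<^sup>+y. 0 \<partial>circle_measure)" for x
    proof (rule nn_integral_cong_AE)
      show "AE y in circle_measure. f (x(i := y)) = 0"
        using AE_circle_neq[of "h (x j)"] by eventually_elim (use assms in \<open>auto simp: f_def\<close>)
    qed
    then show ?thesis by simp
  qed
  finally have "AE x in torus_on I. f x = 0"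
    by (simp add: nn_integral_0_iff_AE)
  then show ?thesis
    by eventually_elim (auto simp: f_def indicator_def split: if_splits)
qed

lemma AE_pairwise_generic:
  assumes "finite I"
  shows "AE x in torus_on I. pairwise_generic I x"
proof -
  have "AE x in torus_on I. x i \<noteq> inverse (x i)" if "i \<in> I" for i
  proof (rule AE_PiM_component[OF prob_space_circle_measure that])
    show "AE y in circle_measure. y \<noteq> inverse y"
      using AE_circle_norm AE_circle_neq[of 1] AE_circle_neq[of "-1"]
    proof eventually_elim
      case (elim y)
      then have "y \<noteq> 0" "y\<^sup>2 \<noteq> 1"
        by (auto simp: power2_eq_1_iff)
      then show ?case
        by (auto simp: field_simps power2_eq_square)
    qed
  qed
  then have "AE x in torus_on I. \<forall>i\<in>I. x i \<noteq> inverse (x i)"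
    using assms by (intro AE_finite_allI) auto
  moreover have "AE x in torus_on I. \<forall>i\<in>I. \<forall>j\<in>I. i \<noteq> j \<longrightarrow> x i \<noteq> x j \<and> x i \<noteq> inverse (x j)"
  proof (intro AE_finite_allI assms)
    fix i j assume ij: "i \<in> I" "j \<in> I"
    show "AE x in torus_on I. i \<noteq> j \<longrightarrow> x i \<noteq> x j \<and> x i \<noteq> inverse (x j)"
    proof (cases "i = j")
      case False
      have "AE x in torus_on I. x i \<noteq> x j" "AE x in torus_on I. x i \<noteq> inverse (x j)"
        using AE_torus_on_neq[OF assms ij False, of "\<lambda>y. y"]
          AE_torus_on_neq[OF assms ij False, of inverse] by auto
      then show ?thesis by eventually_elim auto
    qed simp
  qed
  ultimately show ?thesis
    using AE_torus_on[OF assms] by eventually_elim (auto simp: pairwise_generic_def)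
qed

definition bijections :: "'a set \<Rightarrow> 'b set \<Rightarrow> ('a \<Rightarrow> 'b) set" where
  "bijections F L = {g \<in> extensional F. bij_betw g F L}"

lemma finite_bijections: "finite F \<Longrightarrow> finite L \<Longrightarrow> finite (bijections F L)"
  by (rule finite_subset[OF _ finite_PiE[of F "\<lambda>_. L"]]) (auto simp: bijections_def PiE_def bij_betw_def)

lemma sum_bijections_remove:
  fixes g :: "('a \<Rightarrow> 'b) \<Rightarrow> 'c::comm_monoid_add"
  assumes "finite F" "finite L" "a \<in> F"
  shows "(\<Sum>h\<in>bijections F L. g h) = (\<Sum>l\<in>L. \<Sum>h\<in>bijections (F - {a}) (L - {l}). g (h(a := l)))"
proof -
  have "(\<Sum>l\<in>L. \<Sum>h\<in>bijections (F - {a}) (L - {l}). g (h(a := l))) =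
      (\<Sum>(l, h)\<in>Sigma L (\<lambda>l. bijections (F - {a}) (L - {l})). g (h(a := l)))"
    using assms by (subst sum.Sigma) (auto intro!: finite_bijections)
  also have "\<dots> = (\<Sum>h\<in>bijections F L. g h)"
  proof (rule sum.reindex_bij_witness[of _ "\<lambda>h. (h a, restrict h (F - {a}))" "\<lambda>(l, h). h(a := l)"])
    fix z assume "z \<in> Sigma L (\<lambda>l. bijections (F - {a}) (L - {l}))"
    then obtain l h where z: "z = (l, h)" "l \<in> L" "h \<in> extensional (F - {a})" "bij_betw h (F - {a}) (L - {l})"
      by (auto simp: bijections_def)
    then show "((case z of (l, h) \<Rightarrow> h(a := l)) a, restrict (case z of (l, h) \<Rightarrow> h(a := l)) (F - {a})) = z"
      by (auto simp: fun_eq_iff restrict_def extensional_def)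
    have "bij_betw (h(a := l)) (F - {a}) (L - {l})"
      using z(4) by (subst bij_betw_cong[of _ _ h]) auto
    then have "bij_betw (h(a := l)) (insert a (F - {a})) (insert l (L - {l}))"
      using notIn_Un_bij_betw[of a "F - {a}" "h(a := l)" "L - {l}"] by simp
    then have "bij_betw (h(a := l)) F L"
      using assms z by (simp add: insert_absorb)
    then show "(case z of (l, h) \<Rightarrow> h(a := l)) \<in> bijections F L"
      using z assms by (auto simp: bijections_def extensional_def)
  next
    fix h assume "h \<in> bijections F L"
    then have h: "h \<in> extensional F" "bij_betw h F L" by (auto simp: bijections_def)
    show "(case (h a, restrict h (F - {a})) of (l, h) \<Rightarrow> h(a := l)) = h"
      using h by (auto simp: fun_eq_iff extensional_def)
    have "bij_betw h (F - {a}) (L - {h a})"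
      using h(2) assms by (intro bij_betw_subset[of h F L, OF _ _ , of "F - {a}"])
        (auto simp: bij_betw_def inj_on_def)
    then have "bij_betw (restrict h (F - {a})) (F - {a}) (L - {h a})"
      by (subst bij_betw_cong[of _ _ h]) auto
    moreover have "h a \<in> L"
      using h assms by (auto simp: bij_betw_def)
    ultimately show "(h a, restrict h (F - {a})) \<in> Sigma L (\<lambda>l. bijections (F - {a}) (L - {l}))"
      by (auto simp: bijections_def)
  qed auto
  finally show ?thesis by simp
qed

lemma prod_ordered_pairs_remove:
  fixes g :: "nat \<Rightarrow> nat \<Rightarrow> 'a::comm_monoid_mult"
  assumes "finite I" "i \<in> I" "\<And>p q. g p q = g q p"
  shows "(\<Prod>q\<in>I. \<Prod>p | p \<in> I \<and> p < q. g p q) =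
    (\<Prod>j\<in>I - {i}. g i j) * (\<Prod>q\<in>I - {i}. \<Prod>p | p \<in> I - {i} \<and> p < q. g p q)"
proof -
  have *: "(\<Prod>p | p \<in> I \<and> p < q. g p q) =
      (if i < q then g i q else 1) * (\<Prod>p | p \<in> I - {i} \<and> p < q. g p q)" if "q \<in> I - {i}" for q
  proof (cases "i < q")
    case True
    then have "{p. p \<in> I \<and> p < q} = insert i {p. p \<in> I - {i} \<and> p < q}"
      using assms by auto
    then show ?thesis using True assms by simp
  next
    case False
    then have "{p. p \<in> I \<and> p < q} = {p. p \<in> I - {i} \<and> p < q}"
      by auto
    then show ?thesis using False by simp
  qed
  have "(\<Prod>p | p \<in> I \<and> p < i. g p i) = (\<Prod>p\<in>I - {i}. if p < i then g p i else 1)"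
    using assms by (subst prod.If_cases) (auto intro!: prod.cong)
  then have "(\<Prod>q\<in>I. \<Prod>p | p \<in> I \<and> p < q. g p q) =
      (\<Prod>p\<in>I - {i}. if p < i then g p i else 1) *
      ((\<Prod>q\<in>I - {i}. if i < q then g i q else 1) *
      (\<Prod>q\<in>I - {i}. \<Prod>p | p \<in> I - {i} \<and> p < q. g p q))"
    using assms * by (simp add: prod.remove[of I i] prod.distrib)
  also have "\<dots> = (\<Prod>p\<in>I - {i}. (if p < i then g p i else 1) * (if i < p then g i p else 1)) *
      (\<Prod>q\<in>I - {i}. \<Prod>p | p \<in> I - {i} \<and> p < q. g p q)"
    by (simp add: prod.distrib mult.assoc)
  also have "(\<Prod>p\<in>I - {i}. (if p < i then g p i else 1) * (if i < p then g i p else 1))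
      = (\<Prod>j\<in>I - {i}. g i j)"
    using assms(3) by (intro prod.cong) auto
  finally show ?thesis .
qed

context hl_params
begin

definition hl_ratio :: "complex \<Rightarrow> complex \<Rightarrow> complex" where
  "hl_ratio a b = (a - t * b) / (a - b)"

text \<open>
  The symmetrization that defines the Hall--Littlewood polynomial, with general weights \<open>f\<close> and
  summed up position by position: \<open>l\<close> is the letter at the first position.
\<close>

primrec word_sum :: "nat \<Rightarrow> nat set \<Rightarrow> (nat \<Rightarrow> complex \<Rightarrow> complex) \<Rightarrow> complex set \<Rightarrow> complex" where
  "word_sum 0 F f L = 1"
| "word_sum (Suc k) F f L = (\<Sum>l\<in>L. f (Min F) l * (\<Prod>l'\<in>L - {l}. hl_ratio l l') *
     word_sum k (F - {Min F}) f (L - {l}))"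

lemma word_sum_cong:
  assumes "finite F" "card F = k" "\<And>p l. p \<in> F \<Longrightarrow> l \<in> L \<Longrightarrow> f p l = g p l"
  shows "word_sum k F f L = word_sum k F g L"
  using assms
proof (induction k arbitrary: F L)
  case (Suc k)
  have "F \<noteq> {}" using Suc.prems by auto
  then have "Min F \<in> F"
    using Suc.prems by (intro Min_in)
  moreover have "word_sum k (F - {Min F}) f (L - {l}) = word_sum k (F - {Min F}) g (L - {l})" for l
    using Suc.prems \<open>Min F \<in> F\<close> by (intro Suc.IH) auto
  ultimately show ?case
    using Suc.prems by (auto intro!: sum.cong)
qed simp

lemma word_sum_bijections:
  assumes "finite F" "card F = k" "finite L" "card L = k"
  shows "word_sum k F f L = (\<Sum>g\<in>bijections F L. (\<Prod>p\<in>F. f p (g p)) *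
    (\<Prod>q\<in>F. \<Prod>p | p \<in> F \<and> p < q. hl_ratio (g p) (g q)))"
  using assms
proof (induction k arbitrary: F L)
  case 0
  then have "bijections F L = {\<lambda>_. undefined}"
    by (auto simp: bijections_def bij_betw_def extensional_def)
  with 0 show ?case by simp
next
  case (Suc k)
  define a where "a = Min F"
  have "F \<noteq> {}" using Suc.prems by auto
  then have a: "a \<in> F" "\<And>p. p \<in> F \<Longrightarrow> a \<le> p"
    using Suc.prems by (auto simp: a_def)
  define W where "W F g = (\<Prod>p\<in>F. f p (g p)) *
    (\<Prod>q\<in>F. \<Prod>p | p \<in> F \<and> p < q. hl_ratio (g p) (g q))" for F g
  have W: "W F (h(a := l)) = f a l * (\<Prod>l'\<in>L - {l}. hl_ratio l l') * W (F - {a}) h"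
    if "h \<in> bijections (F - {a}) (L - {l})" for h l
  proof -
    have bij: "bij_betw h (F - {a}) (L - {l})"
      using that by (simp add: bijections_def)
    have "(\<Prod>p\<in>F. f p ((h(a := l)) p)) = f a l * (\<Prod>p\<in>F - {a}. f p (h p))"
      using Suc.prems a by (subst prod.remove[of F a]) (auto intro!: prod.cong)
    moreover have "(\<Prod>q\<in>F. \<Prod>p | p \<in> F \<and> p < q. hl_ratio ((h(a := l)) p) ((h(a := l)) q))
        = (\<Prod>q\<in>F - {a}. hl_ratio l (h q)) *
          (\<Prod>q\<in>F - {a}. \<Prod>p | p \<in> F - {a} \<and> p < q. hl_ratio (h p) (h q))"
    proof -
      have "(\<Prod>p | p \<in> F \<and> p < a. hl_ratio ((h(a := l)) p) ((h(a := l)) a)) = 1"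
        using a by (intro prod.neutral) force
      moreover have "(\<Prod>p | p \<in> F \<and> p < q. hl_ratio ((h(a := l)) p) ((h(a := l)) q)) =
          hl_ratio l (h q) * (\<Prod>p | p \<in> F - {a} \<and> p < q. hl_ratio (h p) (h q))"
        if q: "q \<in> F - {a}" for q
      proof -
        have "{p. p \<in> F \<and> p < q} = insert a {p. p \<in> F - {a} \<and> p < q}"
          using q a by (auto simp: le_neq_implies_less)
        then show ?thesis
          using q Suc.prems by (auto intro!: prod.cong)
      qed
      ultimately show ?thesis
        using Suc.prems a by (simp add: prod.remove[of F a] prod.distrib)
    qed
    moreover have "(\<Prod>q\<in>F - {a}. hl_ratio l (h q)) = (\<Prod>l'\<in>L - {l}. hl_ratio l l')"
      by (rule prod.reindex_bij_betw[OF bij])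
    ultimately show ?thesis
      by (simp add: W_def mult_ac)
  qed
  have "(\<Sum>g\<in>bijections F L. W F g) =
      (\<Sum>l\<in>L. \<Sum>h\<in>bijections (F - {a}) (L - {l}). W F (h(a := l)))"
    using Suc.prems a by (intro sum_bijections_remove) auto
  also have "\<dots> = (\<Sum>l\<in>L. f a l * (\<Prod>l'\<in>L - {l}. hl_ratio l l') *
      (\<Sum>h\<in>bijections (F - {a}) (L - {l}). W (F - {a}) h))"
    by (simp add: W sum_distrib_left)
  also have "\<dots> = word_sum (Suc k) F f L"
    unfolding word_sum.simps a_def[symmetric]
    by (intro sum.cong refl arg_cong2[of _ _ _ _ "(*)"], subst Suc.IH)
       (use Suc.prems a in \<open>auto simp: W_def\<close>)
  finally show ?case
    by (simp add: W_def)
qed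

lemma hall_littlewood_eq_word_sum:
  assumes "inj_on z {..<N}" "v_factor N lam t \<noteq> 0"
  shows "v_factor N lam t * hall_littlewood N lam z t =
    word_sum N {..<N} (\<lambda>p y. y ^ lam p) (z ` {..<N})"
proof -
  define W where "W g = (\<Prod>p<N. g p ^ lam p) * (\<Prod>q<N. \<Prod>p<q. hl_ratio (g p) (g q))"
    for g :: "nat \<Rightarrow> complex"
  have W_cong: "W g = W h" if "\<And>p. p < N \<Longrightarrow> g p = h p" for g h
    unfolding W_def using that by (intro arg_cong2[of _ _ _ _ "(*)"] prod.cong) auto
  have "word_sum N {..<N} (\<lambda>p y. y ^ lam p) (z ` {..<N}) = (\<Sum>g\<in>bijections {..<N} (z ` {..<N}). W g)"
    using assms
  proof (subst word_sum_bijections)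
    have "{p. p \<in> {..<N} \<and> p < q} = {..<q}" if "q < N" for q
      using that by auto
    then show "(\<Sum>g\<in>bijections {..<N} (z ` {..<N}). (\<Prod>p\<in>{..<N}. g p ^ lam p) *
        (\<Prod>q\<in>{..<N}. \<Prod>p | p \<in> {..<N} \<and> p < q. hl_ratio (g p) (g q))) =
        (\<Sum>g\<in>bijections {..<N} (z ` {..<N}). W g)"
      unfolding W_def by (intro sum.cong refl arg_cong2[of _ _ _ _ "(*)"] prod.cong) auto
  qed (auto simp: card_image)
  also have "\<dots> = (\<Sum>w | w permutes {..<N}. W (\<lambda>i. z (w i)))"
  proof (rule sum.reindex_bij_witness[of _ "\<lambda>w. restrict (\<lambda>i. z (w i)) {..<N}"
        "\<lambda>g i. if i < N then inv_into {..<N} z (g i) else i"])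
    fix g assume "g \<in> bijections {..<N} (z ` {..<N})"
    then have g: "g \<in> extensional {..<N}" "bij_betw g {..<N} (z ` {..<N})"
      by (auto simp: bijections_def)
    then have g_in: "g i \<in> z ` {..<N}" if "i < N" for i
      using that by (auto simp: bij_betw_def)
    show "restrict (\<lambda>i. z (if i < N then inv_into {..<N} z (g i) else i)) {..<N} = g"
      using g(1) g_in by (auto simp: fun_eq_iff extensional_def f_inv_into_f)
    have "bij_betw (inv_into {..<N} z \<circ> g) {..<N} {..<N}"
      using g(2) assms(1)
      by (intro bij_betw_trans[OF g(2)] bij_betw_inv_into) (simp add: bij_betw_def)
    then have "bij_betw (\<lambda>i. if i < N then inv_into {..<N} z (g i) else i) {..<N} {..<N}"
      by (subst bij_betw_cong[of _ _ "inv_into {..<N} z \<circ> g"]) auto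
    then show "(\<lambda>i. if i < N then inv_into {..<N} z (g i) else i) \<in> {w. w permutes {..<N}}"
      by (auto intro!: bij_imp_permutes split: if_splits)
    show "W (\<lambda>i. z (if i < N then inv_into {..<N} z (g i) else i)) = W g"
      using g_in by (intro W_cong) (simp add: f_inv_into_f)
  next
    fix w assume "w \<in> {w. w permutes {..<N}}"
    then have w: "w permutes {..<N}" by simp
    then have "bij_betw (z \<circ> w) {..<N} (z ` {..<N})"
      using assms(1) by (intro bij_betw_trans[OF permutes_imp_bij[OF w]]) (simp add: bij_betw_def)
    then have "bij_betw (restrict (\<lambda>i. z (w i)) {..<N}) {..<N} (z ` {..<N})"
      by (subst bij_betw_cong[of _ _ "z \<circ> w"]) auto
    then show "restrict (\<lambda>i. z (w i)) {..<N} \<in> bijections {..<N} (z ` {..<N})"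
      by (auto simp: bijections_def)
    show "(\<lambda>i. if i < N then inv_into {..<N} z (restrict (\<lambda>i. z (w i)) {..<N} i) else i) = w"
    proof
      fix i
      show "(if i < N then inv_into {..<N} z (restrict (\<lambda>i. z (w i)) {..<N} i) else i) = w i"
        using w assms(1) permutes_in_image[OF w, of i] permutes_not_in[OF w, of i]
        by (auto simp: inv_into_f_f)
    qed
  qed
  also have "\<dots> = v_factor N lam t * hall_littlewood N lam z t"
    using assms(2) by (simp add: hall_littlewood_def W_def hl_ratio_def)
  finally show ?thesis by simp
qed

text \<open>
  Instead of the letter at the first position, one can sum over the position \<open>b\<close> of a given letter
  \<open>l\<close>. The letters in front of \<open>b\<close> see \<open>l\<close> on their right instead of on their left, which is
  corrected by a change of their weights.
\<close>

lemma word_sum_extract: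
  assumes "finite F" "card F = Suc k" "finite L" "card L = Suc k" "l \<in> L"
    "\<And>m. m \<in> L - {l} \<Longrightarrow> hl_ratio l m \<noteq> 0"
  shows "word_sum (Suc k) F f L = (\<Sum>b\<in>F. f b l * (\<Prod>l'\<in>L - {l}. hl_ratio l l') *
    word_sum k (F - {b}) (\<lambda>p z. f p z * (if p < b then hl_ratio z l / hl_ratio l z else 1)) (L - {l}))"
  using assms
proof (induction k arbitrary: F L)
  case 0
  obtain a where "F = {a}" using 0 by (auto simp: card_1_singleton_iff)
  moreover obtain l' where "L = {l'}" using 0 by (auto simp: card_1_singleton_iff)
  ultimately show ?case using 0 by simp
next
  case (Suc k)
  define a where "a = Min F"
  have "F \<noteq> {}" using Suc.prems by auto
  then have a: "a \<in> F" "\<And>p. p \<in> F \<Longrightarrow> a \<le> p"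
    using Suc.prems by (auto simp: a_def)
  define tw where "tw b p z = f p z * (if p < b then hl_ratio z l / hl_ratio l z else 1)" for b p z
  define P where "P m M = (\<Prod>l'\<in>M. hl_ratio m l')" for m M
  have fin: "finite F" "finite L" "l \<in> L" using Suc.prems by auto
  have first: "f a l * P l (L - {l}) * word_sum (Suc k) (F - {a}) f (L - {l})
      = f a l * P l (L - {l}) * word_sum (Suc k) (F - {a}) (tw a) (L - {l})"
    using Suc.prems a
    by (intro arg_cong2[of _ _ _ _ "(*)"] refl word_sum_cong) (auto simp: tw_def dest: leD)
  have later: "f a m * P m (L - {m}) * word_sum (Suc k) (F - {a}) f (L - {m})
     = (\<Sum>b\<in>F - {a}. f b l * P l (L - {l}) *
         (tw b a m * P m (L - {l} - {m}) * word_sum k (F - {b} - {a}) (tw b) (L - {l} - {m})))"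
    if m: "m \<in> L - {l}" for m
  proof -
    have "word_sum (Suc k) (F - {a}) f (L - {m}) = (\<Sum>b\<in>F - {a}. f b l *
        P l (L - {m} - {l}) * word_sum k (F - {a} - {b}) (tw b) (L - {m} - {l}))"
      unfolding P_def tw_def using Suc.prems a m by (intro Suc.IH) auto
    also have "\<dots> = (\<Sum>b\<in>F - {a}. f b l *
        P l (L - {l} - {m}) * word_sum k (F - {b} - {a}) (tw b) (L - {l} - {m}))"
      by (intro sum.cong refl) (simp add: Diff_insert2[symmetric] Diff_insert[symmetric] insert_commute)
    finally have IH: "word_sum (Suc k) (F - {a}) f (L - {m}) = \<dots>" .
    have Pl: "P l (L - {l}) = hl_ratio l m * P l (L - {l} - {m})"
      unfolding P_def using fin m by (intro prod.remove) auto
    have "L - {m} - {l} = L - {l} - {m}" by auto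
    then have Pm: "P m (L - {m}) = hl_ratio m l * P m (L - {l} - {m})"
      unfolding P_def using fin m by (subst prod.remove[of _ l]) auto
    have nz: "hl_ratio l m \<noteq> 0"
      using Suc.prems(6)[OF m] .
    have tw: "tw b a m = f a m * (hl_ratio m l / hl_ratio l m)" if "b \<in> F - {a}" for b
      using a that by (simp add: tw_def le_neq_implies_less)
    show ?thesis
      unfolding IH Pl Pm sum_distrib_left
      by (intro sum.cong refl) (use nz in \<open>simp add: tw\<close>)
  qed
  have Min_b: "Min (F - {b}) = a" if "b \<in> F - {a}" for b
    using a fin that by (intro Min_eqI) auto
  have "word_sum (Suc (Suc k)) F f L = (\<Sum>m\<in>L. f a m * P m (L - {m}) * word_sum (Suc k) (F - {a}) f (L - {m}))"
    by (simp add: P_def a_def)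
  also have "\<dots> = f a l * P l (L - {l}) * word_sum (Suc k) (F - {a}) f (L - {l}) +
      (\<Sum>m\<in>L - {l}. f a m * P m (L - {m}) * word_sum (Suc k) (F - {a}) f (L - {m}))"
    using fin by (simp add: sum.remove)
  also have "(\<Sum>m\<in>L - {l}. f a m * P m (L - {m}) * word_sum (Suc k) (F - {a}) f (L - {m})) =
      (\<Sum>m\<in>L - {l}. \<Sum>b\<in>F - {a}. f b l * P l (L - {l}) *
         (tw b a m * P m (L - {l} - {m}) * word_sum k (F - {b} - {a}) (tw b) (L - {l} - {m})))"
    by (intro sum.cong refl later)
  also have "\<dots> = (\<Sum>b\<in>F - {a}. \<Sum>m\<in>L - {l}. f b l * P l (L - {l}) *
         (tw b a m * P m (L - {l} - {m}) * word_sum k (F - {b} - {a}) (tw b) (L - {l} - {m})))"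
    by (rule sum.swap)
  also have "\<dots> = (\<Sum>b\<in>F - {a}. f b l * P l (L - {l}) * word_sum (Suc k) (F - {b}) (tw b) (L - {l}))"
    by (intro sum.cong refl) (simp add: Min_b sum_distrib_left P_def)
  also have "f a l * P l (L - {l}) * word_sum (Suc k) (F - {a}) f (L - {l}) + \<dots> =
      (\<Sum>b\<in>F. f b l * P l (L - {l}) * word_sum (Suc k) (F - {b}) (tw b) (L - {l}))"
    unfolding first using fin a by (simp add: sum.remove)
  finally show ?case
    by (simp add: P_def tw_def[abs_def])
qed

text \<open>
  Lagrange interpolation of \<open>\<Prod>l\<in>L. X - t * l\<close> at the nodes \<open>L\<close> and 0; the node 0 contributes the
  term \<open>t ^ card L\<close>.
\<close>

lemma sum_prod_hl_ratio:
  assumes "finite L" "0 \<notin> L"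
  shows "(\<Sum>l\<in>L. \<Prod>l'\<in>L - {l}. hl_ratio l l') = (1 - t ^ card L) / (1 - t)"
proof -
  define p where "p = (\<Prod>l\<in>L. [:- t * l, 1:])"
  have "degree p = (\<Sum>l\<in>L. degree [:- t * l, 1:])"
    unfolding p_def by (intro degree_prod_eq_sum_degree) auto
  then have deg: "degree p = card L" by simp
  have lead: "lead_coeff p = 1"
    unfolding p_def lead_coeff_prod by simp
  have poly: "poly p y = (\<Prod>l\<in>L. y - t * l)" for y
    by (simp add: p_def poly_prod)
  have zero: "poly p 0 / (\<Prod>b\<in>insert 0 L - {0}. 0 - b) = t ^ card L"
  proof -
    have "insert 0 L - {0} = L" using assms by auto
    moreover have "poly p 0 = t ^ card L * (\<Prod>b\<in>L. 0 - b)"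
      unfolding poly by (simp add: prod.distrib[symmetric] flip: prod_constant)
    moreover have "(\<Prod>b\<in>L. 0 - b) \<noteq> 0" using assms by auto
    ultimately show ?thesis by simp
  qed
  have other: "poly p l / (\<Prod>b\<in>insert 0 L - {l}. l - b) = (1 - t) * (\<Prod>l'\<in>L - {l}. hl_ratio l l')"
    if l: "l \<in> L" for l
  proof -
    have "l \<noteq> 0" using l assms by auto
    then have "insert 0 L - {l} = insert 0 (L - {l})" by auto
    then have "(\<Prod>b\<in>insert 0 L - {l}. l - b) = l * (\<Prod>b\<in>L - {l}. l - b)"
      using assms by simp
    moreover have "poly p l = (1 - t) * l * (\<Prod>b\<in>L - {l}. l - t * b)"
      unfolding poly using assms l by (simp add: prod.remove[of L l] algebra_simps)
    ultimately show ?thesis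
      using \<open>l \<noteq> 0\<close> by (simp add: hl_ratio_def prod_dividef)
  qed
  have "1 = (\<Sum>a\<in>insert 0 L. poly p a / (\<Prod>b\<in>insert 0 L - {a}. a - b))"
    using assms deg lead by (subst sum_monic_divided_difference) auto
  also have "\<dots> = t ^ card L + (\<Sum>l\<in>L. poly p l / (\<Prod>b\<in>insert 0 L - {l}. l - b))"
    using assms zero by (subst sum.insert) auto
  also have "\<dots> = t ^ card L + (1 - t) * (\<Sum>l\<in>L. \<Prod>l'\<in>L - {l}. hl_ratio l l')"
    by (simp add: other sum_distrib_left)
  finally show ?thesis
    using one_minus_t by (simp add: field_simps)
qed

lemma word_sum_one:
  assumes "finite L" "0 \<notin> L" "card L = k"
  shows "word_sum k F (\<lambda>_ _. 1) L = (\<Prod>j=1..k. (1 - t ^ j) / (1 - t))"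
  using assms
proof (induction k arbitrary: F L)
  case (Suc k)
  have "word_sum (Suc k) F (\<lambda>_ _. 1) L =
      (\<Sum>l\<in>L. (\<Prod>l'\<in>L - {l}. hl_ratio l l') * (\<Prod>j=1..k. (1 - t ^ j) / (1 - t)))"
    using Suc.prems by (simp add: Suc.IH cong: sum.cong)
  also have "\<dots> = (\<Sum>l\<in>L. \<Prod>l'\<in>L - {l}. hl_ratio l l') * (\<Prod>j=1..k. (1 - t ^ j) / (1 - t))"
    by (simp only: sum_distrib_right)
  finally show ?case
    using sum_prod_hl_ratio[OF Suc.prems(1,2)] Suc.prems(3) by (simp add: mult.commute)
qed simp

end

section \<open>From words to pairings\<close>

lemma down_closed_eq_lessThan:
  fixes A :: "nat set"
  assumes "finite A" "\<And>p q. p \<in> A \<Longrightarrow> q \<le> p \<Longrightarrow> q \<in> A"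
  shows "A = {..<card A}"
proof (cases "A = {}")
  case False
  have "A = {..Max A}"
    using assms(1) assms(2)[OF Max_in[OF assms(1) False]] by (auto intro: Max_ge)
  then show ?thesis
    by (metis card_atMost lessThan_Suc_atMost)
qed simp

context hl_params
begin

text \<open>
  The factors of the density, with its parameters 1, \<open>s\<close>, 0, 0. The density for an arbitrary index
  set is needed because variables are split off one by one.
\<close>

definition cross_density :: "complex \<Rightarrow> complex \<Rightarrow> complex" where
  "cross_density y z = (\<Prod>w\<in>#{# y * z, y * inverse z, inverse y * z, inverse y * inverse z #}.
     (1 - w) / (1 - t * w))"

definition single_density :: "complex \<Rightarrow> complex" where
  "single_density y = (1 - y\<^sup>2) * (1 - (inverse y)\<^sup>2) /
     ((1 - y) * (1 - s * y) * ((1 - inverse y) * (1 - s * inverse y)))"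

definition density :: "nat set \<Rightarrow> (nat \<Rightarrow> complex) \<Rightarrow> complex" where
  "density I x = (\<Prod>i\<in>I. single_density (x i)) *
     (\<Prod>j\<in>I. \<Prod>i | i \<in> I \<and> i < j. cross_density (x i) (x j))"

lemma cross_density_commute: "cross_density y z = cross_density z y"
  by (simp add: cross_density_def mult_ac)

lemma cross_density_inverse: "cross_density (inverse y) z = cross_density y z"
  by (simp add: cross_density_def mult_ac)

lemma single_density_inverse: "single_density (inverse y) = single_density y"
  by (simp add: single_density_def mult_ac)

lemma density_remove:
  assumes "finite I" "i \<in> I"
  shows "density I x = single_density (x i) * (\<Prod>j\<in>I - {i}. cross_density (x i) (x j)) * density (I - {i}) x"
proof -
  have "(\<Prod>q\<in>I. \<Prod>p | p \<in> I \<and> p < q. cross_density (x p) (x q)) =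
    (\<Prod>j\<in>I - {i}. cross_density (x i) (x j)) *
    (\<Prod>q\<in>I - {i}. \<Prod>p | p \<in> I - {i} \<and> p < q. cross_density (x p) (x q))"
    using assms cross_density_commute by (rule prod_ordered_pairs_remove)
  then show ?thesis
    unfolding density_def prod.remove[OF assms] by (simp only: mult_ac)
qed

lemma koornwinder_density_eq:
  "koornwinder_density n x 1 s 0 0 t = 1 / (2 ^ n * fact n) * density {..<n} x"
proof -
  have "(1 :: int) \<noteq> -1" by simp
  then have "(\<Prod>e\<in>{1, -1}. (1 - y powi (2 * e)) /
        ((1 - 1 * y powi e) * (1 - s * y powi e) * (1 - 0 * y powi e) * (1 - 0 * y powi e)))
      = single_density y" for y :: complex
    by (simp add: single_density_def power_int_minus power_inverse)
  moreover have "(\<Prod>e\<in>{1, -1}. \<Prod>e'\<in>{1, -1}.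
        (1 - y powi e * z powi e') / (1 - t * y powi e * z powi e')) = cross_density y z"
    for y z :: complex
    using \<open>(1 :: int) \<noteq> -1\<close>
    by (simp add: cross_density_def power_int_minus mult_ac)
  moreover have "{i. i \<in> {..<n} \<and> i < j} = {..<j}" if "j < n" for j
    using that by auto
  ultimately show ?thesis
    unfolding koornwinder_density_def density_def
    by (simp add: mult.assoc)
qed

lemma hl_ratio_kernel:
  assumes "norm y = 1" "y \<noteq> inverse y"
  shows "hl_ratio y (inverse y) * single_density y = kernel y"
proof -
  have y: "y \<noteq> 0" "y \<noteq> 1" "y \<noteq> -1" "y\<^sup>2 \<noteq> 1"
    using assms by (auto simp: power2_eq_1_iff)
  have d: "1 - s * y \<noteq> 0" "1 - s * inverse y \<noteq> 0"
    by (rule one_minus_s_mult; simp add: assms norm_inverse)+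
  have d2: "y - s \<noteq> 0"
    using d y by (simp add: field_simps)
  have "hl_ratio y (inverse y) = (y - s) * (y + s) / (y\<^sup>2 - 1)"
    unfolding hl_ratio_def unfolding s_sq[symmetric]
    using y by (simp add: divide_simps) (simp add: algebra_simps power2_eq_square)
  moreover have "single_density y = (1 - y\<^sup>2) * (y\<^sup>2 - 1) / ((1 - y) * (1 - s * y) * ((y - 1) * (y - s)))"
    using y d d2 by (simp add: single_density_def divide_simps) (simp add: algebra_simps power2_eq_square)
  moreover have "1 - y\<^sup>2 = (1 - y) * (1 + y)"
    by (simp add: algebra_simps power2_eq_square)
  ultimately show ?thesis
    using y d d2 by (simp add: kernel_def mult_ac)
qed

text \<open>
  Two arcs that do not overlap contribute nothing: their four Hall--Littlewood factors are the
  inverse of their factor of the density.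
\<close>

lemma hl_ratio_cross_density:
  assumes "norm y = 1" "norm z = 1" "y \<noteq> z" "y \<noteq> inverse z"
  shows "hl_ratio y z * hl_ratio y (inverse z) * hl_ratio (inverse y) z * hl_ratio (inverse y) (inverse z)
     * cross_density y z = 1"
proof -
  have nz: "y \<noteq> 0" "z \<noteq> 0" using assms by auto
  have *: "hl_ratio v w = (1 - t * (inverse v * w)) / (1 - inverse v * w)" if "v \<noteq> 0" for v w
  proof -
    have "v - t * w = v * (1 - t * (inverse v * w))" "v - w = v * (1 - inverse v * w)"
      using that by (simp_all add: algebra_simps)
    then show ?thesis
      using that by (simp add: hl_ratio_def)
  qed
  have t: "1 - t * w \<noteq> 0" if "norm w = 1" for w
    using that by (intro one_minus_t_mult) auto
  have "1 - y * z \<noteq> 0" "1 - y * inverse z \<noteq> 0" "1 - inverse y * z \<noteq> 0" "1 - inverse y * inverse z \<noteq> 0"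
    using assms nz by (auto simp: field_simps)
  moreover have "1 - t * (y * z) \<noteq> 0" "1 - t * (y * inverse z) \<noteq> 0"
      "1 - t * (inverse y * z) \<noteq> 0" "1 - t * (inverse y * inverse z) \<noteq> 0"
    by (rule t; simp add: assms norm_mult norm_inverse)+
  moreover have "p1 / q1 * (p2 / q2) * (p3 / q3) * (p4 / q4) * (q3 / p3 * (q4 / p4 * (q1 / p1 * (q2 / p2)))) = 1"
    if "p1 \<noteq> 0" "p2 \<noteq> 0" "p3 \<noteq> 0" "p4 \<noteq> 0" "q1 \<noteq> 0" "q2 \<noteq> 0" "q3 \<noteq> 0" "q4 \<noteq> 0"
    for p1 p2 p3 p4 q1 q2 q3 q4 :: complex
    using that by simp
  ultimately show ?thesis
    using nz by (simp add: * cross_density_def)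
qed

text \<open>
  Exchanging the order of \<open>z\<close> and the right end of the arc of \<open>y\<close> costs a cross factor.
\<close>

lemma hl_ratio_swap:
  assumes "norm y = 1" "norm z = 1" "y \<noteq> inverse z"
  shows "hl_ratio z (inverse y) / hl_ratio (inverse y) z = cross_factor (y * z)"
proof -
  have nz: "y \<noteq> 0" "z \<noteq> 0" using assms by auto
  have d: "1 - y * z \<noteq> 0" "y * z - 1 \<noteq> 0" using assms nz by (auto simp: field_simps)
  have t: "1 - t * (y * z) \<noteq> 0"
    using assms by (intro one_minus_t_mult) (simp add: norm_mult)
  have 1: "hl_ratio z (inverse y) = (y * z - t) / (y * z - 1)"
    using nz d by (simp add: hl_ratio_def divide_simps) (simp add: algebra_simps)
  have 2: "hl_ratio (inverse y) z = (1 - t * (y * z)) / (1 - y * z)"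
    using nz d by (simp add: hl_ratio_def divide_simps) (simp add: algebra_simps)
  show ?thesis
    unfolding 1 2 cross_factor_def using d t by (simp add: divide_simps) (simp add: algebra_simps)
qed

text \<open>
  Take out the letter \<open>y\<close> at the first position by the definition of \<open>word_sum\<close>, and its inverse by
  \<open>word_sum_extract\<close>. As if the arc of \<open>y\<close> ended before all other letters, the Hall--Littlewood
  factors of \<open>y\<close> and \<open>1 / y\<close> cancel those of the density, except for \<open>kernel y\<close>; the correction
  of the weights in \<open>word_sum_extract\<close> is \<open>twist\<close>.
\<close>

theorem word_sum_density:
  assumes "finite F" "card F = 2 * m" "finite I" "card I = m" "pairwise_generic I x"
  shows "word_sum (2 * m) F f (letters I x) * density I x = pairing_sum m F f I x"
  using assms
proof (induction m arbitrary: F f I)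
  case 0
  then show ?case by (simp add: density_def)
next
  case (Suc m)
  define a where "a = Min F"
  have "F \<noteq> {}" using Suc.prems by auto
  then have a: "a \<in> F"
    using Suc.prems by (auto simp: a_def)
  define L where "L = letters I x"
  have L: "finite L" "card L = Suc (Suc (2 * m))"
  proof -
    show "finite L"
      using Suc.prems by (simp add: L_def finite_letters)
    have "card L = (\<Sum>l\<in>letters I x. 1)"
      by (simp add: L_def)
    also have "\<dots> = Suc (Suc (2 * m))"
      using Suc.prems by (subst sum_letters) auto
    finally show "card L = Suc (Suc (2 * m))" .
  qed
  have norm_L: "norm l = 1" if "l \<in> L" for l
    using that Suc.prems(5) by (auto simp: L_def letters_def pairwise_generic_def torus_def norm_inverse)
  define T where "T y = f a y * (\<Prod>l'\<in>L - {y}. hl_ratio y l') * word_sum (Suc (2 * m)) (F - {a}) f (L - {y})" for y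
  have T: "T y * density I x = (\<Sum>b\<in>F - {a}. kernel y * (f a y * f b (inverse y) *
      pairing_sum m (F - {a, b}) (twist b y f) (I - {i}) x))"
    if i: "i \<in> I" and y: "y = x i \<or> y = inverse (x i)" for i y
  proof -
    define J where "J = I - {i}"
    define L' where "L' = letters J x"
    have J: "finite J" "card J = m" "pairwise_generic J x"
      using Suc.prems i by (auto simp: J_def intro: pairwise_generic_subset)
    have y1: "norm y = 1" "y \<noteq> inverse y" "y \<in> L" "inverse y \<in> L"
      using Suc.prems(5) i y by (auto simp: pairwise_generic_def torus_def norm_inverse L_def letters_def)
    have L': "L' = L - {y, inverse y}"
      unfolding L'_def J_def letters_remove[OF Suc.prems(5) i] L_def using y by auto
    have yj: "norm (x j) = 1" "y \<noteq> x j" "y \<noteq> inverse (x j)" if "j \<in> J" for j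
    proof -
      have "x i \<noteq> x j" "x i \<noteq> inverse (x j)" "norm (x j) = 1"
        using that Suc.prems(5) i by (auto simp: J_def pairwise_generic_def torus_def)
      then show "norm (x j) = 1" "y \<noteq> x j" "y \<noteq> inverse (x j)"
        using y by auto
    qed
    have IH: "word_sum (2 * m) (F - {a} - {b}) (\<lambda>p z. f p z *
          (if p < b then hl_ratio z (inverse y) / hl_ratio (inverse y) z else 1)) (L - {y} - {inverse y})
        * density J x = pairing_sum m (F - {a, b}) (twist b y f) J x" (is "?W * _ = _")
      if b: "b \<in> F - {a}" for b
    proof -
      have eq: "F - {a} - {b} = F - {a, b}" "L - {y} - {inverse y} = letters J x"
        using L' by (auto simp: L'_def)
      have "finite (F - {a, b})" "card (F - {a, b}) = 2 * m"
        using Suc.prems a b by (auto simp: card_Diff_subset)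
      then have "?W * density J x = pairing_sum m (F - {a, b}) (\<lambda>p z. f p z *
          (if p < b then hl_ratio z (inverse y) / hl_ratio (inverse y) z else 1)) J x"
        unfolding eq using J by (intro Suc.IH)
      also have "\<dots> = pairing_sum m (F - {a, b}) (twist b y f) J x"
        using Suc.prems yj y1(1)
        by (intro pairing_sum_cong) (auto simp: twist_def hl_ratio_swap norm_inverse)
      finally show ?thesis .
    qed
    have weight: "(\<Prod>l'\<in>L - {y}. hl_ratio y l') * (\<Prod>l'\<in>L - {y} - {inverse y}. hl_ratio (inverse y) l') *
        (single_density (x i) * (\<Prod>j\<in>J. cross_density (x i) (x j))) = kernel y"
    proof -
      have sym: "single_density (x i) = single_density y" "cross_density (x i) z = cross_density y z" for z
        using y by (auto simp: single_density_inverse cross_density_inverse)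
      have "L - {y} - {inverse y} = L'" using L' by auto
      moreover from this have "(\<Prod>l'\<in>L - {y}. hl_ratio y l') = hl_ratio y (inverse y) * (\<Prod>l'\<in>L'. hl_ratio y l')"
        using L y1 by (subst prod.remove[of _ "inverse y"]) auto
      ultimately have "(\<Prod>l'\<in>L - {y}. hl_ratio y l') * (\<Prod>l'\<in>L - {y} - {inverse y}. hl_ratio (inverse y) l') *
        (single_density (x i) * (\<Prod>j\<in>J. cross_density (x i) (x j)))
        = hl_ratio y (inverse y) * single_density y *
          (\<Prod>j\<in>J. hl_ratio y (x j) * hl_ratio y (inverse (x j)) * hl_ratio (inverse y) (x j) *
             hl_ratio (inverse y) (inverse (x j)) * cross_density y (x j))"
        using J by (simp add: sym L'_def prod_letters prod.distrib mult_ac)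
      also have "\<dots> = hl_ratio y (inverse y) * single_density y"
        using y1 yj by (simp add: hl_ratio_cross_density)
      finally show ?thesis
        using y1 by (simp add: hl_ratio_kernel)
    qed
    have "word_sum (Suc (2 * m)) (F - {a}) f (L - {y}) = (\<Sum>b\<in>F - {a}. f b (inverse y) *
        (\<Prod>l'\<in>L - {y} - {inverse y}. hl_ratio (inverse y) l') * word_sum (2 * m) (F - {a} - {b})
          (\<lambda>p z. f p z * (if p < b then hl_ratio z (inverse y) / hl_ratio (inverse y) z else 1))
          (L - {y} - {inverse y}))"
    proof (rule word_sum_extract)
      fix l assume l: "l \<in> L - {y} - {inverse y}"
      have "norm (t * l) < 1"
        using norm_t norm_L[of l] l by (simp add: norm_mult)
      moreover have "norm (inverse y) = 1"
        using y1 by (simp add: norm_inverse)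
      ultimately have "inverse y \<noteq> t * l"
        by (metis less_irrefl)
      then show "hl_ratio (inverse y) l \<noteq> 0"
        using l by (auto simp: hl_ratio_def)
    qed (use Suc.prems L a y1 in auto)
    moreover have "density I x = single_density (x i) * (\<Prod>j\<in>J. cross_density (x i) (x j)) * density J x"
      unfolding J_def using Suc.prems i by (intro density_remove)
    ultimately have "T y * density I x = (\<Sum>b\<in>F - {a}. f a y * f b (inverse y) *
        ((\<Prod>l'\<in>L - {y}. hl_ratio y l') * (\<Prod>l'\<in>L - {y} - {inverse y}. hl_ratio (inverse y) l') *
          (single_density (x i) * (\<Prod>j\<in>J. cross_density (x i) (x j)))) *
        (word_sum (2 * m) (F - {a} - {b}) (\<lambda>p z. f p z *
          (if p < b then hl_ratio z (inverse y) / hl_ratio (inverse y) z else 1)) (L - {y} - {inverse y})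
        * density J x))"
      by (simp only: T_def sum_distrib_left sum_distrib_right mult_ac)
    also have "\<dots> = (\<Sum>b\<in>F - {a}. f a y * f b (inverse y) * kernel y *
        pairing_sum m (F - {a, b}) (twist b y f) J x)"
      unfolding weight by (intro sum.cong refl) (simp only: IH)
    finally show ?thesis
      by (simp add: J_def mult_ac)
  qed
  have "word_sum (2 * Suc m) F f (letters I x) * density I x = (\<Sum>l\<in>letters I x. T l) * density I x"
    by (simp add: T_def a_def L_def)
  also have "\<dots> = (\<Sum>i\<in>I. T (x i) * density I x + T (inverse (x i)) * density I x)"
    using Suc.prems by (simp add: sum_letters sum_distrib_right distrib_right)
  also have "\<dots> = (\<Sum>i\<in>I. \<Sum>b\<in>F - {a}.
     kernel (x i) * (f a (x i) * f b (inverse (x i)) *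
       pairing_sum m (F - {a, b}) (twist b (x i) f) (I - {i}) x) +
     kernel (inverse (x i)) * (f a (inverse (x i)) * f b (x i) *
       pairing_sum m (F - {a, b}) (twist b (inverse (x i)) f) (I - {i}) x))"
    by (intro sum.cong refl) (simp add: T sum.distrib)
  finally show ?case
    by (simp add: a_def)
qed

lemma pm_args_generic:
  assumes "pairwise_generic {..<n} x"
  shows "inj_on (pm_args x) {..<2 * n}" "pm_args x ` {..<2 * n} = letters {..<n} x"
proof -
  have gen: "x i \<noteq> inverse (x i)" "i \<noteq> j \<Longrightarrow> x i \<noteq> x j" "i \<noteq> j \<Longrightarrow> x i \<noteq> inverse (x j)"
    if "i < n" "j < n" for i j
    using assms that by (auto simp: pairwise_generic_def)
  show "inj_on (pm_args x) {..<2 * n}"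
  proof (rule inj_onI)
    fix k l assume kl: "k \<in> {..<2 * n}" "l \<in> {..<2 * n}" "pm_args x k = pm_args x l"
    have "k div 2 < n" "l div 2 < n" using kl by auto
    note g = gen[OF this] gen[OF this(2) this(1)]
    have "k div 2 = l div 2"
      using g kl(3) by (auto simp: pm_args_def split: if_splits) (metis inverse_inverse_eq)+
    moreover from this have "even k \<longleftrightarrow> even l"
      using g(1) kl(3) by (auto simp: pm_args_def split: if_splits)
    ultimately show "k = l"
      by (metis div_mult_mod_eq even_iff_mod_2_eq_zero odd_iff_mod_2_eq_one)
  qed
  show "pm_args x ` {..<2 * n} = letters {..<n} x"
  proof
    show "pm_args x ` {..<2 * n} \<subseteq> letters {..<n} x"
    proof
      fix l assume "l \<in> pm_args x ` {..<2 * n}"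
      then obtain k where k: "k < 2 * n" "l = pm_args x k" by auto
      then have "k div 2 \<in> {..<n}" by auto
      then show "l \<in> letters {..<n} x"
        unfolding letters_def by (rule UN_I) (simp add: k pm_args_def)
    qed
    show "letters {..<n} x \<subseteq> pm_args x ` {..<2 * n}"
    proof
      fix l assume "l \<in> letters {..<n} x"
      then obtain i where "i < n" "l = x i \<or> l = inverse (x i)"
        by (auto simp: letters_def)
      then have "l = pm_args x (2 * i) \<and> 2 * i < 2 * n \<or> l = pm_args x (2 * i + 1) \<and> 2 * i + 1 < 2 * n"
        by (auto simp: pm_args_def)
      then show "l \<in> pm_args x ` {..<2 * n}"
        by auto
    qed
  qed
qed

lemma power_s_neq_1: "j > 0 \<Longrightarrow> s ^ j \<noteq> 1"
  using norm_s by (metis norm_one norm_power power_less_one_iff less_irrefl norm_ge_zero)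

lemma power_t_neq_1: "j > 0 \<Longrightarrow> t ^ j \<noteq> 1"
  using norm_t by (metis norm_one norm_power power_less_one_iff less_irrefl norm_ge_zero)

lemma v_factor_nonzero: "v_factor N lam t \<noteq> 0"
  using power_t_neq_1 one_minus_t by (simp add: v_factor_def prod_zero_iff)

lemma hall_littlewood_measurable:
  "(\<lambda>x. hall_littlewood (2 * n) lam (pm_args x) t) \<in> borel_measurable (torus_on {..<n})"
proof -
  have pm: "(\<lambda>x. pm_args x k) \<in> borel_measurable (torus_on {..<n})" if "k < 2 * n" for k
  proof -
    have "k div 2 \<in> {..<n}" using that by auto
    then show ?thesis
      unfolding pm_args_def
      using tame_measurable[OF tame.coord] tame_measurable[OF tame.inverse_coord] by (cases "even k") auto
  qed
  have "w k < 2 * n" if "w permutes {..<2 * n}" "k < 2 * n" for w k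
    using permutes_in_image[OF that(1), of k] that(2) by simp
  then show ?thesis
    unfolding hall_littlewood_def
    by (intro borel_measurable_times borel_measurable_const borel_measurable_sum borel_measurable_prod
        borel_measurable_power borel_measurable_divide borel_measurable_diff pm) auto
qed

lemma density_measurable: "density I \<in> borel_measurable (torus_on I)"
proof -
  have "(\<lambda>x. x i) \<in> borel_measurable (torus_on I)" if "i \<in> I" for i
    using tame_measurable[OF tame.coord[OF that]] .
  then show ?thesis
    unfolding density_def[abs_def] single_density_def cross_density_def
    by (auto intro!: borel_measurable_times borel_measurable_prod borel_measurable_divide
        borel_measurable_diff borel_measurable_power borel_measurable_inverse)
qed

end

section \<open>Evaluation of the integrals\<close>

context hl_params
begin

text \<open>
  The contribution per position that is left when \<open>v_factor\<close> at \<open>t\<close> is replaced by \<open>v_factor\<close> at \<open>s\<close>.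
  It occurs to the power \<open>2 * n\<close> for every partition and cancels in the quotient by \<open>Z\<close>.
\<close>

definition norm_const :: complex where
  "norm_const = gam / (1 + s) * (1 - t) / (1 - s)"

lemma norm_const_nonzero: "norm_const \<noteq> 0"
proof -
  have "gam ^ 2 \<noteq> 0"
    using one_plus_s one_minus_s by (simp add: gam_sq c_one_def)
  then show ?thesis
    using one_plus_s one_minus_s one_minus_t by (simp add: norm_const_def)
qed

lemma block_weight_quotient:
  "block_weight m / (\<Prod>j=1..m. (1 - t ^ j) / (1 - t)) = norm_const ^ m / (\<Prod>j=1..m. (1 - s ^ j) / (1 - s))"
proof -
  have "(1 + s ^ j) / ((1 - t ^ j) / (1 - t)) = (1 - t) / (1 - s) / ((1 - s ^ j) / (1 - s))" if "j \<ge> 1" for j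
  proof -
    have "1 - t ^ j = (1 - s ^ j) * (1 + s ^ j)"
    proof -
      have "t ^ j = s ^ j * s ^ j"
        by (simp flip: s_sq power_mult power_add add: mult_2)
      then show ?thesis
        by (simp add: algebra_simps)
    qed
    moreover have "1 - t ^ j \<noteq> 0"
      using power_t_neq_1[of j] that by auto
    ultimately have "1 - s ^ j \<noteq> 0" "1 + s ^ j \<noteq> 0" "1 - t ^ j = (1 - s ^ j) * (1 + s ^ j)"
      by auto
    then show ?thesis
      using one_minus_s one_minus_t by simp
  qed
  then have "(\<Prod>j=1..m. (1 + s ^ j) / ((1 - t ^ j) / (1 - t)))
      = (\<Prod>j=1..m. (1 - t) / (1 - s) / ((1 - s ^ j) / (1 - s)))"
    by (intro prod.cong) auto
  then have "(\<Prod>j=1..m. 1 + s ^ j) / (\<Prod>j=1..m. (1 - t ^ j) / (1 - t)) =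
      ((1 - t) / (1 - s)) ^ m / (\<Prod>j=1..m. (1 - s ^ j) / (1 - s))"
    unfolding prod_dividef[of "\<lambda>j. 1 + s ^ j" "\<lambda>j. (1 - t ^ j) / (1 - t)"]
      prod_dividef[of "\<lambda>_. (1 - t) / (1 - s)" "\<lambda>j. (1 - s ^ j) / (1 - s)"] prod_constant
    by simp
  then have "(gam / (1 + s)) ^ m * ((\<Prod>j=1..m. 1 + s ^ j) / (\<Prod>j=1..m. (1 - t ^ j) / (1 - t))) =
      (gam / (1 + s)) ^ m * (((1 - t) / (1 - s)) ^ m / (\<Prod>j=1..m. (1 - s ^ j) / (1 - s)))"
    by (rule arg_cong)
  moreover have "norm_const ^ m = (gam / (1 + s)) ^ m * ((1 - t) / (1 - s)) ^ m"
    by (simp add: norm_const_def flip: power_mult_distrib)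
  ultimately show ?thesis
    by (simp only: block_weight_def times_divide_eq_right)
qed

end

context hl_word
begin

lemma integral_hall_littlewood_koornwinder:
  "(\<integral>x. hall_littlewood (2 * n) lam (pm_args x) t * koornwinder_density n x 1 s 0 0 t \<partial>torus_measure n)
   = norm_const ^ (2 * n) / v_factor (2 * n) lam s"
proof -
  define J where "J = {..<n}"
  define c where "c = 1 / (v_factor (2 * n) lam t * (2 ^ n * fact n))"
  have v: "v_factor (2 * n) lam t \<noteq> 0"
    by (rule v_factor_nonzero)
  have letter: "letter {} = (\<lambda>p y. y ^ lam p)"
    by (simp add: letter_def fun_eq_iff)
  have reg: "tame_off_1 J (\<lambda>x. pairing_sum n {..<2 * n} (letter {}) J x)"
    by (intro tame_off_1_pairing_sum_letter) simp
  have "(\<integral>x. hall_littlewood (2 * n) lam (pm_args x) t * koornwinder_density n x 1 s 0 0 t \<partial>torus_measure n)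
      = (\<integral>x. c * pairing_sum n {..<2 * n} (letter {}) J x \<partial>torus_on J)"
    unfolding torus_measure_def J_def[symmetric]
  proof (rule integral_cong_AE)
    have "AE x in torus_on J. pairwise_generic J x"
      by (rule AE_pairwise_generic) (simp add: J_def)
    then show "AE x in torus_on J. hall_littlewood (2 * n) lam (pm_args x) t *
        koornwinder_density n x 1 s 0 0 t = c * pairing_sum n {..<2 * n} (letter {}) J x"
    proof eventually_elim
      case (elim x)
      have "v_factor (2 * n) lam t * hall_littlewood (2 * n) lam (pm_args x) t
          = word_sum (2 * n) {..<2 * n} (letter {}) (letters J x)"
        using hall_littlewood_eq_word_sum[of "pm_args x" "2 * n" lam] pm_args_generic[of n x] elim v
        by (simp add: J_def letter)
      moreover have "word_sum (2 * n) {..<2 * n} (letter {}) (letters J x) * density J x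
          = pairing_sum n {..<2 * n} (letter {}) J x"
        by (rule word_sum_density) (use elim in \<open>auto simp: J_def\<close>)
      ultimately have "pairing_sum n {..<2 * n} (letter {}) J x =
          v_factor (2 * n) lam t * hall_littlewood (2 * n) lam (pm_args x) t * density J x"
        by simp
      then show ?case
        using v by (simp add: c_def koornwinder_density_eq J_def)
    qed
    show "(\<lambda>x. hall_littlewood (2 * n) lam (pm_args x) t * koornwinder_density n x 1 s 0 0 t)
        \<in> borel_measurable (torus_on J)"
      unfolding koornwinder_density_eq J_def
      by (intro borel_measurable_times borel_measurable_const hall_littlewood_measurable density_measurable)
    show "(\<lambda>x. c * pairing_sum n {..<2 * n} (letter {}) J x) \<in> borel_measurable (torus_on J)"
      using reg by (auto simp: tame_off_1_def)
  qed
  also have "\<dots> = c * (2 ^ n * fact n * partial_pairings {..<2 * n} {})"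
    by (simp add: integral_pairing_sum J_def)
  also have "\<dots> = partial_pairings {..<2 * n} {} / v_factor (2 * n) lam t"
    by (simp add: c_def)
  also have "partial_pairings {..<2 * n} {} = (\<Prod>i\<le>lam 0. block_weight (part_mult (2 * n) lam i))"
  proof -
    have "lam p \<le> lam 0" for p
      using antimono_lam by (simp add: antimono_def)
    then show ?thesis
      by (subst partial_pairings_eq_prod_blocks[of _ "lam 0"]) (simp_all add: part_mult_def)
  qed
  also have "(\<Prod>i\<le>lam 0. block_weight (part_mult (2 * n) lam i)) / v_factor (2 * n) lam t =
      (\<Prod>i\<le>lam 0. norm_const ^ part_mult (2 * n) lam i) / v_factor (2 * n) lam s"
    unfolding v_factor_def atLeast0AtMost prod_dividef[symmetric] block_weight_quotient ..
  also have "(\<Prod>i\<le>lam 0. norm_const ^ part_mult (2 * n) lam i) = norm_const ^ (2 * n)"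
  proof -
    have "(\<Sum>i\<le>lam 0. part_mult (2 * n) lam i) = card (\<Union>i\<le>lam 0. {k. k < 2 * n \<and> lam k = i})"
      unfolding part_mult_def by (subst card_UN_disjoint) auto
    also have "(\<Union>i\<le>lam 0. {k. k < 2 * n \<and> lam k = i}) = {..<2 * n}"
      using antimono_lam by (auto simp: antimono_def)
    finally show ?thesis
      by (simp add: power_sum[symmetric])
  qed
  finally show ?thesis .
qed

end

context hl_params
begin

lemma v_factor_zero: "v_factor N (\<lambda>_. 0) r = (\<Prod>j=1..N. (1 - r ^ j) / (1 - r))"
  by (simp add: v_factor_def part_mult_def)

lemma hall_littlewood_zero:
  assumes "inj_on z {..<N}" "0 \<notin> z ` {..<N}"
  shows "hall_littlewood N (\<lambda>_. 0) z t = 1"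
proof -
  have "v_factor N (\<lambda>_. 0) t * hall_littlewood N (\<lambda>_. 0) z t = v_factor N (\<lambda>_. 0) t"
    using hall_littlewood_eq_word_sum[OF assms(1) v_factor_nonzero, of "\<lambda>_. 0"]
      word_sum_one[of "z ` {..<N}" N] assms
    by (simp add: card_image v_factor_zero)
  then show ?thesis
    using v_factor_nonzero by simp
qed

lemma integral_koornwinder:
  "(\<integral>x. koornwinder_density n x 1 s 0 0 t \<partial>torus_measure n) = norm_const ^ (2 * n) / v_factor (2 * n) (\<lambda>_. 0) s"
proof -
  interpret zero: hl_word s t "\<lambda>_. 0"
    by unfold_locales (simp add: antimono_def)
  have "(\<integral>x. koornwinder_density n x 1 s 0 0 t \<partial>torus_measure n) =
      (\<integral>x. hall_littlewood (2 * n) (\<lambda>_. 0) (pm_args x) t * koornwinder_density n x 1 s 0 0 t \<partial>torus_measure n)"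
    unfolding torus_measure_def
  proof (rule integral_cong_AE)
    have "AE x in torus_on {..<n}. pairwise_generic {..<n} x"
      by (rule AE_pairwise_generic) simp
    then show "AE x in torus_on {..<n}. koornwinder_density n x 1 s 0 0 t =
        hall_littlewood (2 * n) (\<lambda>_. 0) (pm_args x) t * koornwinder_density n x 1 s 0 0 t"
    proof eventually_elim
      case (elim x)
      have "norm (x i) = 1" if "i < n" for i
        using elim that unfolding pairwise_generic_def torus_def by blast
      then have "x i \<noteq> 0" if "i < n" for i
        using that by fastforce
      then have "0 \<notin> letters {..<n} x"
        by (auto simp: letters_def)
      then show ?case
        using pm_args_generic[OF elim] by (simp add: hall_littlewood_zero)
    qed
    have "(\<lambda>x. koornwinder_density n x 1 s 0 0 t) \<in> borel_measurable (torus_on {..<n})"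
      unfolding koornwinder_density_eq
      by (intro borel_measurable_times borel_measurable_const density_measurable)
    then show "(\<lambda>x. koornwinder_density n x 1 s 0 0 t) \<in> borel_measurable (torus_on {..<n})"
      "(\<lambda>x. hall_littlewood (2 * n) (\<lambda>_. 0) (pm_args x) t * koornwinder_density n x 1 s 0 0 t)
        \<in> borel_measurable (torus_on {..<n})"
      by (auto intro: borel_measurable_times hall_littlewood_measurable)
  qed
  also have "\<dots> = norm_const ^ (2 * n) / v_factor (2 * n) (\<lambda>_. 0) s"
    by (rule zero.integral_hall_littlewood_koornwinder)
  finally show ?thesis .
qed

lemma phi_eq: "phi m s = (1 - s) ^ m * (\<Prod>j=1..m. (1 - s ^ j) / (1 - s))"
  using one_minus_s by (simp add: phi_def prod_dividef)

lemma phi_nonzero: "phi m s \<noteq> 0"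
  using power_s_neq_1 by (auto simp: phi_def prod_zero_iff)

end

theorem corollary6p4:
  fixes t s Z :: complex and n :: nat and lam :: "nat \<Rightarrow> nat"
  assumes "0 < norm t" and "norm t < 1"
    and "s ^ 2 = t"
    and "n \<ge> 1"
    and "is_partition lam" and "part_length lam \<le> 2 * n"
    and "Z = (\<integral>x. koornwinder_density n x 1 s 0 0 t \<partial>torus_measure n)"
  shows "1 / Z * (\<integral>x. hall_littlewood (2 * n) lam (pm_args x) t *
             koornwinder_density n x 1 s 0 0 t \<partial>torus_measure n)
           = phi (2 * n) s / ((1 - s) ^ (2 * n) * v_factor (2 * n) lam s)
         \<and> phi (2 * n) s / ((1 - s) ^ (2 * n) * v_factor (2 * n) lam s)
           = C_zero lam (t ^ n) s / C_minus lam s"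
proof -
  interpret hl_word s t lam
  proof
    show "s ^ 2 = t" "antimono lam"
      using assms by (auto simp: is_partition_def)
    show "s \<noteq> 0"
      using assms by auto
    have "norm s ^ 2 < 1"
      using assms by (simp flip: norm_power)
    then show "norm s < 1"
      by (simp add: power_less_one_iff)
  qed
  define l where "l = part_length lam"
  have l: "l \<le> 2 * n"
    using assms(6) by (simp add: l_def)
  have supp: "{k. lam k \<noteq> 0} = {..<l}"
    unfolding l_def part_length_def
  proof (rule down_closed_eq_lessThan)
    show "finite {k. lam k \<noteq> 0}"
      using assms(5) by (simp add: is_partition_def)
    fix p q assume p: "p \<in> {k. lam k \<noteq> 0}" "q \<le> p"
    then have "lam p \<le> lam q"
      using antimono_lam by (simp add: antimono_def)
    then show "q \<in> {k. lam k \<noteq> 0}"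
      using p by auto
  qed
  then have lam_zero: "lam k = 0 \<longleftrightarrow> k \<ge> l" for k
    by (metis lessThan_iff mem_Collect_eq not_less)
  have ratio: "1 / Z * (\<integral>x. hall_littlewood (2 * n) lam (pm_args x) t *
             koornwinder_density n x 1 s 0 0 t \<partial>torus_measure n)
           = phi (2 * n) s / ((1 - s) ^ (2 * n) * v_factor (2 * n) lam s)"
    unfolding assms(7) integral_hall_littlewood_koornwinder integral_koornwinder v_factor_zero phi_eq
    using norm_const_nonzero one_minus_s by simp
  define m where "m = part_mult (2 * n) lam"
  have card_parts: "card {k. lam k = i} = m i" if "i \<ge> 1" for i
  proof -
    have "k < 2 * n" if "lam k = i" for k
      using lam_zero[of k] l that \<open>i \<ge> 1\<close> by linarith
    then have "{k. lam k = i} = {k. k < 2 * n \<and> lam k = i}"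
      by auto
    then show ?thesis
      by (simp add: m_def part_mult_def)
  qed
  have sum_pos: "(\<Sum>i=1..lam 0. m i) = l"
  proof -
    have "(\<Sum>i=1..lam 0. m i) = (\<Sum>i=1..lam 0. card {k. lam k = i})"
      by (intro sum.cong refl) (simp add: card_parts)
    also have "\<dots> = card (\<Union>i\<in>{1..lam 0}. {k. lam k = i})"
    proof (rule card_UN_disjoint[symmetric])
      have "{k. lam k = i} \<subseteq> {k. lam k \<noteq> 0}" if "i \<ge> 1" for i
        using that by auto
      then show "\<forall>i\<in>{1..lam 0}. finite {k. lam k = i}"
        unfolding supp using finite_subset by (metis atLeastAtMost_iff finite_lessThan)
    qed auto
    also have "(\<Union>i\<in>{1..lam 0}. {k. lam k = i}) = {..<l}"
      unfolding supp[symmetric] using antimono_lam by (auto simp: antimono_def)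
    finally show ?thesis by simp
  qed
  have m0: "m 0 = 2 * n - l"
  proof -
    have eq: "{k. k < 2 * n \<and> lam k = 0} = {l..<2 * n}"
      unfolding lam_zero by auto
    show ?thesis
      unfolding m_def part_mult_def eq by simp
  qed
  have v: "(1 - s) ^ (2 * n) * v_factor (2 * n) lam s = phi (m 0) s * C_minus lam s"
  proof -
    have v1: "v_factor (2 * n) lam s = (\<Prod>j=1..m 0. (1 - s ^ j) / (1 - s)) *
        (\<Prod>i=1..lam 0. \<Prod>j=1..m i. (1 - s ^ j) / (1 - s))"
      unfolding v_factor_def m_def by (subst prod.atLeast_Suc_atMost) simp_all
    have v2: "C_minus lam s = (1 - s) ^ l * (\<Prod>i=1..lam 0. \<Prod>j=1..m i. (1 - s ^ j) / (1 - s))"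
      unfolding C_minus_def l_def by (intro arg_cong2[of _ _ _ _ "(*)"] refl prod.cong) (auto simp: card_parts)
    have v3: "(1 - s) ^ (2 * n) = (1 - s) ^ m 0 * (1 - s) ^ l"
      using l by (simp add: m0 flip: power_add)
    show ?thesis
      unfolding v1 v2 v3 phi_eq by (simp only: mult_ac)
  qed
  have zero: "phi (2 * n) s = phi (m 0) s * C_zero lam (t ^ n) s"
  proof -
    have "1 - s powi (1 - int i) * t ^ n = 1 - s ^ (2 * n + 1 - i)" if "i \<in> {1..l}" for i
    proof -
      have "s powi (1 - int i) * t ^ n = s powi (1 - int i) * s powi int (2 * n)"
        by (simp only: s_sq[symmetric] power_int_of_nat power_mult)
      also have "\<dots> = s powi (1 - int i + int (2 * n))"
        using s_nonzero by (simp add: power_int_add)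
      also have "1 - int i + int (2 * n) = int (2 * n + 1 - i)"
        using that l by auto
      finally show ?thesis
        by (simp del: of_nat_diff)
    qed
    then have "C_zero lam (t ^ n) s = (\<Prod>i=1..l. 1 - s ^ (2 * n + 1 - i))"
      unfolding C_zero_def l_def[symmetric] by (intro prod.cong) auto
    also have "\<dots> = (\<Prod>j\<in>{m 0 + 1..2 * n}. 1 - s ^ j)"
      by (rule prod.reindex_bij_witness[of _ "\<lambda>j. 2 * n + 1 - j" "\<lambda>i. 2 * n + 1 - i"])
        (use l in \<open>auto simp: m0\<close>)
    finally have "phi (m 0) s * C_zero lam (t ^ n) s =
        (\<Prod>j\<in>{1..m 0} \<union> {m 0 + 1..2 * n}. 1 - s ^ j)"
      unfolding phi_def by (subst prod.union_disjoint) auto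
    also have "{1..m 0} \<union> {m 0 + 1..2 * n} = {1..2 * n}"
      by (auto simp: m0)
    finally show ?thesis
      by (simp add: phi_def)
  qed
  show ?thesis
    using ratio phi_nonzero[of "m 0"] unfolding v zero by simp
qed

end
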